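(* Let $d\ge 0$ and let $b$ be a non-simple block of $S_d(G_1T)$. Then $b$ is a shift of the block of $S_{d'}(G_1T)$ containing $\widehat V(d')$ for some $d'\le d$ of the form $d'=sp+a$ with $s\in\mathbb{N}_0$ and $0\le a\le p-2$.
   Context: $k$ is an algebraically closed field of characteristic $p\ge3$, $G=\mathrm{GL}_2$, $T\subseteq G$ is the torus of diagonal matrices, $X(T)\cong\mathbb{Z}^2$, $G_1$ is the first Frobenius kernel. $G_1T=(\mathrm{SL}_2)_1T$-modules are viewed as $\mathbb{Z}^2$-graded (by $T$-weights) modules over $U_0(\mathfrak{sl}_2)$, with $\deg e=(1,-1)$, $\deg f=(-1,1)$, $\deg h=(0,0)$. Let $A_d(G_1T)$ be the image in $k[G_1T]$ of the space of homogeneous polynomials of degree $d$ in $k[\mathrm{Mat}_2]=k[X_{ij}]$; it is a finite-dimensional coalgebra, and $S_d(G_1T)=A_d(G_1T)^*$ is the infinitesimal Schur algebra. $S_d(G_1T)$-modules are regarded as $G_1T$-modules. For $d\ge0$, $\widehat V(d)$ is the $G_1T$-module with basis $v_0,\dots,v_d$, $\deg(v_i)=(i,d-i)$ and $e.v_i=(i+1)v_{i+1}$, $f.v_i=(d-i+1)v_{i-1}$, $h.v_i=(2i-d)v_i$ (with $v_{-1}=v_{d+1}=0$). For $\lambda\in\mathbb{Z}^2$ the shift functor $[\lambda]$ is given by $M[\lambda]_\mu=M_{\mu-\lambda}$. A block $b$ of $S_d(G_1T)$ is a shift of a block $b'$ of $S_{d'}(G_1T)$ if some shift functor $[\lambda]$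 restricts to an equivalence from the category of finite-dimensional modules belonging to $b'$ to the category of finite-dimensional modules belonging to $b$. *)

theory Defs
  imports
    "HOL-Library.Poly_Mapping"
    "HOL-Library.Numeral_Type"
    "HOL-Computational_Algebra.Polynomial"
    "HOL-Algebra.Ideal"
    "Jordan_Normal_Form.Matrix"
begin

section \<open>The coordinate ring of two-by-two matrices\<close>

text \<open>
  Matrix positions are pairs of indices in the two-element type \<open>2\<close>, whose elements are
  written \<open>1\<close> and \<open>2\<close> (internally the second one is also \<open>0\<close>). The type \<open>'k mat2_poly\<close> is the
  polynomial ring \<open>k[Mat\<^sub>2] = k[X\<^sub>1\<^sub>1, X\<^sub>1\<^sub>2, X\<^sub>2\<^sub>1, X\<^sub>2\<^sub>2]\<close>.
\<close>

type_synonym pos = "2 \<times> 2"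
type_synonym 'k mat2_poly = "(pos \<Rightarrow>\<^sub>0 nat) \<Rightarrow>\<^sub>0 'k"

definition Xvar :: "pos \<Rightarrow> 'k::comm_ring_1 mat2_poly" where
  "Xvar ij = Poly_Mapping.single (Poly_Mapping.single ij 1) 1"

definition Const :: "'k::comm_ring_1 \<Rightarrow> 'k mat2_poly" where
  "Const c = Poly_Mapping.single 0 c"

definition mon_deg :: "(pos \<Rightarrow>\<^sub>0 nat) \<Rightarrow> nat" where
  "mon_deg m = (\<Sum>ij\<in>UNIV. Poly_Mapping.lookup m ij)"

definition homogeneous :: "nat \<Rightarrow> 'k::comm_ring_1 mat2_poly \<Rightarrow> bool" where
  "homogeneous d f \<longleftrightarrow> (\<forall>m\<in>Poly_Mapping.keys f. mon_deg m = d)"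

definition hom_component :: "nat \<Rightarrow> 'k::comm_ring_1 mat2_poly \<Rightarrow> 'k mat2_poly" where
  "hom_component d f =
     (\<Sum>m\<in>{m\<in>Poly_Mapping.keys f. mon_deg m = d}. Poly_Mapping.single m (Poly_Mapping.lookup f m))"

text \<open>Evaluation at a matrix \<open>x\<close> over a \<open>k\<close>-algebra \<open>R\<close> with structure map \<open>\<iota> : k \<rightarrow> R\<close>.\<close>

definition eval_at ::
  "('k::comm_ring_1 \<Rightarrow> 'r::comm_ring_1) \<Rightarrow> (pos \<Rightarrow> 'r) \<Rightarrow> 'k mat2_poly \<Rightarrow> 'r" where
  "eval_at \<iota> x f = (\<Sum>m\<in>Poly_Mapping.keys f. \<iota> (Poly_Mapping.lookup f m) * (\<Prod>ij\<in>UNIV. x ij ^ Poly_Mapping.lookup m ij))"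

text \<open>
  The comultiplication \<open>X\<^sub>i\<^sub>j \<mapsto> \<Sum>\<^sub>l X\<^sub>i\<^sub>l \<otimes> X\<^sub>l\<^sub>j\<close>, with \<open>k[Mat\<^sub>2] \<otimes> k[Mat\<^sub>2]\<close> realised as \<open>k[X][Y]\<close>:
  the left tensor factor is the coefficient ring \<open>k[X]\<close>, and the outer variables \<open>Y\<close> form
  the right tensor factor.
\<close>

definition comult :: "'k::comm_ring_1 mat2_poly \<Rightarrow> 'k mat2_poly mat2_poly" where
  "comult = eval_at (\<lambda>c. Const (Const c)) (\<lambda>(i, j). \<Sum>l\<in>UNIV. Const (Xvar (i, l)) * Xvar (l, j))"

definition det_poly :: "'k::comm_ring_1 mat2_poly" where
  "det_poly = Xvar (1, 1) * Xvar (2, 2) - Xvar (1, 2) * Xvar (2, 1)"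

text \<open>
  \<open>k[GL\<^sub>2]\<close> is the localisation of \<open>k[Mat\<^sub>2]\<close> at the determinant, and \<open>G\<^sub>1T\<close> is the closed
  subgroup scheme of \<open>GL\<^sub>2\<close> (the preimage of \<open>T\<close> under the Frobenius morphism) cut out by
  \<open>X\<^sub>1\<^sub>2\<^sup>p\<close> and \<open>X\<^sub>2\<^sub>1\<^sup>p\<close>. The following set is the kernel of the resulting map
  \<open>k[Mat\<^sub>2] \<rightarrow> k[GL\<^sub>2] \<rightarrow> k[G\<^sub>1T]\<close>.
\<close>

definition G1T_kernel :: "'k::comm_ring_1 mat2_poly set" where
  "G1T_kernel = {f. \<exists>n g h. det_poly ^ n * f =
     Xvar (1, 2) ^ CHAR('k) * g + Xvar (2, 1) ^ CHAR('k) * h}"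


section \<open>The infinitesimal Schur algebra\<close>

text \<open>
  A linear form on \<open>A\<^sub>d(G\<^sub>1T)\<close>, the image of the homogeneous polynomials of degree \<open>d\<close> in
  \<open>k[G\<^sub>1T]\<close>, is a linear form on these polynomials that vanishes on the kernel. It is
  represented here by its extension to \<open>k[Mat\<^sub>2]\<close> by zero on the other homogeneous components.
\<close>

type_synonym 'k form = "'k mat2_poly \<Rightarrow> 'k"

definition schur_forms :: "nat \<Rightarrow> 'k::field form set" where
  "schur_forms d = {\<phi>. Vector_Spaces.linear (\<lambda>c f. Const c * f) (*) \<phi>
     \<and> (\<forall>f\<in>G1T_kernel. \<phi> f = 0)
     \<and> (\<forall>e f. e \<noteq> d \<longrightarrow> homogeneous e f \<longrightarrow> \<phi> f = 0)}"

text \<open>\<open>(\<phi> \<otimes> \<psi>) \<circ> comult\<close>\<close>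

definition convolution :: "'k::comm_ring_1 form \<Rightarrow> 'k form \<Rightarrow> 'k form" where
  "convolution \<phi> \<psi> f = (\<Sum>m\<in>Poly_Mapping.keys (comult f).
     \<phi> (Poly_Mapping.lookup (comult f) m) * \<psi> (Poly_Mapping.single m 1))"

definition diag_mat2 :: "'k::zero \<Rightarrow> 'k \<Rightarrow> pos \<Rightarrow> 'k" where
  "diag_mat2 t u = (\<lambda>(i, j). if i \<noteq> j then 0 else if i = 1 then t else u)"

text \<open>The action of the point \<open>diag(t, u)\<close> of the torus \<open>T\<close>.\<close>

definition torus_form :: "nat \<Rightarrow> 'k::comm_ring_1 \<Rightarrow> 'k \<Rightarrow> 'k form" where
  "torus_form d t u f = eval_at id (diag_mat2 t u) (hom_component d f)"

text \<open>
  The action of the matrix unit \<open>E\<^sub>i\<^sub>j\<close> of \<open>gl\<^sub>2 = Lie(GL\<^sub>2)\<close>: the coefficient of \<open>\<epsilon>\<close> in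
  \<open>f(1 + \<epsilon> E\<^sub>i\<^sub>j)\<close>.
\<close>

definition lie_form :: "nat \<Rightarrow> pos \<Rightarrow> 'k::comm_ring_1 form" where
  "lie_form d ij f = coeff (eval_at (\<lambda>c. [:c:])
     (\<lambda>rs. (if fst rs = snd rs then 1 else 0) + (if rs = ij then [:0, 1:] else 0))
     (hom_component d f)) 1"

definition schur_alg :: "nat \<Rightarrow> 'k::field form ring" where
  "schur_alg d = \<lparr>carrier = schur_forms d, mult = convolution, one = torus_form d 1 1,
     zero = (\<lambda>f. 0), add = (\<lambda>\<phi> \<psi> f. \<phi> f + \<psi> f)\<rparr>"


section \<open>Blocks\<close>

text \<open>
  A block of a ring is an indecomposable two-sided direct summand; it is given here by the
  primitive central idempotent \<open>b\<close> that generates it.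
\<close>

definition central_idempotent :: "('a, 'm) ring_scheme \<Rightarrow> 'a \<Rightarrow> bool" where
  "central_idempotent R c \<longleftrightarrow> c \<in> carrier R \<and> c \<otimes>\<^bsub>R\<^esub> c = c
     \<and> (\<forall>x\<in>carrier R. c \<otimes>\<^bsub>R\<^esub> x = x \<otimes>\<^bsub>R\<^esub> c)"

definition is_block :: "('a, 'm) ring_scheme \<Rightarrow> 'a \<Rightarrow> bool" where
  "is_block R b \<longleftrightarrow> central_idempotent R b \<and> b \<noteq> \<zero>\<^bsub>R\<^esub>
     \<and> (\<forall>c c'. central_idempotent R c \<longrightarrow> central_idempotent R c' \<longrightarrow> c \<otimes>\<^bsub>R\<^esub> c' = \<zero>\<^bsub>R\<^esub>
          \<longrightarrow> b = c \<oplus>\<^bsub>R\<^esub> c' \<longrightarrow> c = \<zero>\<^bsub>R\<^esub> \<or> c' = \<zero>\<^bsub>R\<^esub>)"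

definition block_ideal :: "('a, 'm) ring_scheme \<Rightarrow> 'a \<Rightarrow> 'a set" where
  "block_ideal R b = {x \<otimes>\<^bsub>R\<^esub> b | x. x \<in> carrier R}"

text \<open>
  A block is simple if its block algebra is a simple algebra. The two-sided ideals of the block
  algebra are exactly the two-sided ideals of \<open>R\<close> contained in it.
\<close>

definition simple_block :: "('a, 'm) ring_scheme \<Rightarrow> 'a \<Rightarrow> bool" where
  "simple_block R b \<longleftrightarrow> is_block R b
     \<and> (\<forall>I. ideal I R \<longrightarrow> I \<subseteq> block_ideal R b \<longrightarrow> I = {\<zero>\<^bsub>R\<^esub>} \<or> I = block_ideal R b)"


section \<open>Finite-dimensional modules\<close>

text \<open>
  The category of finite-dimensional modules is represented by its skeleton of modules with
  underlying space \<open>k\<^sup>n\<close>: a left module over the Schur algebra is a unital matrix representation.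
\<close>

definition schur_module :: "nat \<Rightarrow> nat \<Rightarrow> ('k::field form \<Rightarrow> 'k mat) \<Rightarrow> bool" where
  "schur_module d n \<rho> \<longleftrightarrow>
     (\<forall>\<phi>\<in>schur_forms d. \<rho> \<phi> \<in> carrier_mat n n)
     \<and> (\<forall>\<phi>\<in>schur_forms d. \<forall>\<psi>\<in>schur_forms d. \<rho> (\<lambda>f. \<phi> f + \<psi> f) = \<rho> \<phi> + \<rho> \<psi>)
     \<and> (\<forall>c. \<forall>\<phi>\<in>schur_forms d. \<rho> (\<lambda>f. c * \<phi> f) = c \<cdot>\<^sub>m \<rho> \<phi>)
     \<and> (\<forall>\<phi>\<in>schur_forms d. \<forall>\<psi>\<in>schur_forms d. \<rho> (convolution \<phi> \<psi>) = \<rho> \<phi> * \<rho> \<psi>)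
     \<and> \<rho> (torus_form d 1 1) = 1\<^sub>m n"

text \<open>
  A finite-dimensional \<open>\<int>\<^sup>2\<close>-graded module over \<open>U\<^sub>0(sl\<^sub>2)\<close>: its dimension, its homogeneous
  components and the matrices of \<open>e\<close>, \<open>f\<close>, \<open>h\<close>.
\<close>

record 'k graded_module =
  gdim :: nat
  gcomp :: "int \<times> int \<Rightarrow> 'k vec set"
  act_e :: "'k mat"
  act_f :: "'k mat"
  act_h :: "'k mat"

text \<open>
  The graded module underlying the \<open>G\<^sub>1T\<close>-module given by \<open>\<rho>\<close>; the components are the weight
  spaces of \<open>T\<close>, and \<open>e = E\<^sub>1\<^sub>2\<close>, \<open>f = E\<^sub>2\<^sub>1\<close>, \<open>h = E\<^sub>1\<^sub>1 - E\<^sub>2\<^sub>2\<close>.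
\<close>

definition G1T_module :: "nat \<Rightarrow> nat \<Rightarrow> ('k::field form \<Rightarrow> 'k mat) \<Rightarrow> 'k graded_module" where
  "G1T_module d n \<rho> = \<lparr>
     gdim = n,
     gcomp = (\<lambda>\<mu>. {v \<in> carrier_vec n. \<forall>t u. t \<noteq> 0 \<longrightarrow> u \<noteq> 0 \<longrightarrow>
       \<rho> (torus_form d t u) *\<^sub>v v = (t powi fst \<mu> * u powi snd \<mu>) \<cdot>\<^sub>v v}),
     act_e = \<rho> (lie_form d (1, 2)),
     act_f = \<rho> (lie_form d (2, 1)),
     act_h = \<rho> (lie_form d (1, 1)) - \<rho> (lie_form d (2, 2))\<rparr>"

text \<open>
  The finite-dimensional modules belonging to the block \<open>b\<close> of \<open>S\<^sub>d(G\<^sub>1T)\<close>, regarded as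
  \<open>G\<^sub>1T\<close>-modules.
\<close>

definition block_modules :: "nat \<Rightarrow> 'k::field form \<Rightarrow> 'k graded_module set" where
  "block_modules d b = {G1T_module d n \<rho> | n \<rho>. schur_module d n \<rho> \<and> \<rho> b = 1\<^sub>m n}"

definition graded_hom :: "'k::field graded_module \<Rightarrow> 'k graded_module \<Rightarrow> 'k mat set" where
  "graded_hom M N = {P \<in> carrier_mat (gdim N) (gdim M).
     P * act_e M = act_e N * P \<and> P * act_f M = act_f N * P \<and> P * act_h M = act_h N * P
     \<and> (\<forall>\<mu>. \<forall>v\<in>gcomp M \<mu>. P *\<^sub>v v \<in> gcomp N \<mu>)}"

definition graded_iso :: "'k::field graded_module \<Rightarrow> 'k graded_module \<Rightarrow> bool" where
  "graded_iso M N \<longleftrightarrow> (\<exists>P\<in>graded_hom M N. \<exists>Q\<in>graded_hom N M.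
     Q * P = 1\<^sub>m (gdim M) \<and> P * Q = 1\<^sub>m (gdim N))"

definition shift :: "int \<times> int \<Rightarrow> 'k graded_module \<Rightarrow> 'k graded_module" where
  "shift \<nu> M = M\<lparr>gcomp := (\<lambda>\<mu>. gcomp M (fst \<mu> - fst \<nu>, snd \<mu> - snd \<nu>))\<rparr>"

text \<open>
  The shift functor leaves the matrix of a homomorphism unchanged. It restricts to an equivalence
  between full subcategories \<open>C\<close> and \<open>D\<close> of graded modules if it maps \<open>C\<close> to \<open>D\<close>, is fully
  faithful, and is essentially surjective.
\<close>

definition shift_equivalence ::
  "int \<times> int \<Rightarrow> 'k::field graded_module set \<Rightarrow> 'k graded_module set \<Rightarrow> bool" where
  "shift_equivalence \<nu> C D \<longleftrightarrow>
     (\<forall>M\<in>C. shift \<nu> M \<in> D)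
     \<and> (\<forall>M\<in>C. \<forall>N\<in>C. bij_betw (\<lambda>P. P) (graded_hom M N) (graded_hom (shift \<nu> M) (shift \<nu> N)))
     \<and> (\<forall>N\<in>D. \<exists>M\<in>C. graded_iso (shift \<nu> M) N)"

definition is_shift_of_block :: "nat \<Rightarrow> 'k::field form \<Rightarrow> nat \<Rightarrow> 'k form \<Rightarrow> bool" where
  "is_shift_of_block d b d' b' \<longleftrightarrow>
     (\<exists>\<nu>. shift_equivalence \<nu> (block_modules d' b') (block_modules d b))"

text \<open>The basis vector \<open>v\<^sub>i\<close> is the \<open>i\<close>-th unit vector, with indices starting at \<open>0\<close>.\<close>

definition V_hat :: "nat \<Rightarrow> 'k::field graded_module" where
  "V_hat d = \<lparr>
     gdim = d + 1,
     gcomp = (\<lambda>\<mu>. {v \<in> carrier_vec (d + 1).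
       \<forall>i\<le>d. v $ i \<noteq> 0 \<longrightarrow> \<mu> = (int i, int d - int i)}),
     act_e = mat (d + 1) (d + 1) (\<lambda>(r, i). if r = i + 1 then of_nat (i + 1) else 0),
     act_f = mat (d + 1) (d + 1) (\<lambda>(r, i). if i = r + 1 then of_nat (d - i + 1) else 0),
     act_h = mat (d + 1) (d + 1) (\<lambda>(r, i). if r = i then of_int (2 * int i - int d) else 0)\<rparr>"

end

theory Submission
  imports Defs "HOL-Algebra.RingHom"
begin

text \<open>
  Multiplication by the determinant embeds the forms of degree \<open>d\<close> into those of degree \<open>d + 2\<close>.
  Dually there is a surjective ring homomorphism \<open>\<theta>\<close> from \<open>S\<^sub>d\<^sub>+\<^sub>2(G\<^sub>1T)\<close> to \<open>S\<^sub>d(G\<^sub>1T)\<close>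
  (\<open>det_twist\<close>), and pulling a module back along \<open>\<theta>\<close> is the shift by \<open>(1, 1)\<close>. If \<open>\<theta>\<close> is
  injective on the block \<open>b\<close>, then \<open>\<theta> b\<close> is a non-simple block of \<open>S\<^sub>d(G\<^sub>1T)\<close> and \<open>b\<close> is its
  shift. So the theorem follows by induction on the degree, once every non-simple block \<open>b\<close> of
  \<open>S\<^sub>d(G\<^sub>1T)\<close> on which \<open>\<theta>\<close> is not injective is shown to contain \<open>V(d)\<close>, with \<open>p\<close> not
  dividing \<open>d + 1\<close>.

  The tool for this is the action on tensor space. A monomial of degree \<open>d\<close> is a product of
  variables \<open>X\<^sub>i\<^sub>j\<close> with \<open>i\<close> and \<open>j\<close> running through two words of length \<open>d\<close> in the letters
  1 and 2. A linear form thereby becomes a matrix indexed by words, and convolution becomes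
  matrix multiplication (\<open>convolution_word\<close>). The sums of all words with a given number of
  ones span \<open>V(d)\<close> inside tensor space, and \<open>weyl d 1 \<phi> n i\<close> is the matrix of \<open>\<phi>\<close> on it.

  A form \<open>\<kappa>\<close> killed by \<open>\<theta>\<close> does not distinguish \<open>X\<^sub>1\<^sub>1X\<^sub>2\<^sub>2\<close> from \<open>X\<^sub>1\<^sub>2X\<^sub>2\<^sub>1\<close>, so its value on
  a pair of words depends only on the numbers of ones in them. It is zero if the first word has
  at least \<open>p\<close> ones and at least \<open>p\<close> twos, because the monomial can then be rewritten with an
  off-diagonal exponent of at least \<open>p\<close>. Hence the product of \<open>b\<close> with \<open>\<kappa>\<close> involves only
  columns \<open>l\<close> of the matrix of \<open>b\<close> on \<open>V(d)\<close> with \<open>l < p\<close> or \<open>d - l < p\<close>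
  (\<open>convolution_det_twist_kernel\<close>). If \<open>\<theta>\<close> is not injective on \<open>b\<close>, one of these columns is
  nonzero, and there are two cases.

  If \<open>p\<close> does not divide \<open>d + 1\<close>, the central element \<open>b\<close> acts on \<open>V(d)\<close> by a scalar: it
  commutes with the torus, so its matrix is diagonal, and for all \<open>i\<close> one of \<open>e\<close> and \<open>f\<close>
  connects \<open>v\<^sub>i\<close> with \<open>v\<^sub>i\<^sub>+\<^sub>1\<close>. A nonzero idempotent scalar is 1, so \<open>V(d)\<close> belongs to \<open>b\<close>
  (\<open>V_hat_in_block_modules\<close>).

  If \<open>p\<close> divides \<open>d + 1\<close>, then \<open>v\<^sub>0, \<dots>, v\<^sub>p\<^sub>-\<^sub>1\<close> span a Steinberg module, and likewise at the
  other end of \<open>V(d)\<close>. The forms that factor through such a module constitute a full matrix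
  algebra, whose unit \<open>steinberg_form d r\<close> is central; the block \<open>b\<close> meets it, hence lies in it
  and is simple (\<open>steinberg_block_simple\<close>), contrary to assumption.
\<close>


section \<open>Letters, matrix positions and monomials\<close>

lemma UNIV_two: "(UNIV :: 2 set) = {1, 2}"
proof -
  have "{1, 2} = (UNIV :: 2 set)"
    by (intro card_subset_eq) auto
  then show ?thesis by simp
qed

lemma sum_two: "(\<Sum>l\<in>UNIV. f (l :: 2)) = f 1 + f 2"
  by (simp add: UNIV_two)

lemma prod_pos:
  "(\<Prod>ij\<in>UNIV. f (ij :: pos)) = f (1, 1) * f (1, 2) * f (2, 1) * (f (2, 2) :: 'r :: comm_monoid_mult)"
proof -
  have U: "(UNIV :: pos set) = {(1, 1), (1, 2), (2, 1), (2, 2)}"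
    using UNIV_two by (auto simp: set_eq_iff)
  show ?thesis unfolding U by (simp add: mult_ac)
qed

lemma two_cases: "(i :: 2) = 1 \<or> i = 2"
  using UNIV_two by auto

lemma poly_mapping_sum_single:
  fixes f :: "'a \<Rightarrow>\<^sub>0 'b::comm_monoid_add"
  shows "(\<Sum>m\<in>Poly_Mapping.keys f. Poly_Mapping.single m (Poly_Mapping.lookup f m)) = f"
  by (rule poly_mapping_eqI)
     (auto simp: lookup_sum lookup_single when_def sum.delta in_keys_iff)

lemma poly_mapping_single_induct [case_names single add]:
  fixes f :: "'a \<Rightarrow>\<^sub>0 'b::comm_monoid_add"
  assumes single: "\<And>m c. P (Poly_Mapping.single m c)"
    and add: "\<And>f g. P f \<Longrightarrow> P g \<Longrightarrow> P (f + g)"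
  shows "P f"
proof -
  have "P (\<Sum>m\<in>A. Poly_Mapping.single m (Poly_Mapping.lookup f m))" if "finite A" for A
    using that
    by induction (use assms single[of undefined 0] in auto)
  from this[of "Poly_Mapping.keys f"] show ?thesis
    by (simp add: poly_mapping_sum_single)
qed

lemma sum_keys_single:
  assumes "\<And>m. F m 0 = 0"
  shows "(\<Sum>m\<in>Poly_Mapping.keys (Poly_Mapping.single n c).
      F m (Poly_Mapping.lookup (Poly_Mapping.single n c) m)) = F n c"
  by (cases "c = 0") (auto simp: assms)

lemma sum_keys_add:
  assumes "\<And>m. F m 0 = 0" "\<And>m a b. F m (a + b) = F m a + F m b"
  shows "(\<Sum>m\<in>Poly_Mapping.keys (f + g). F m (Poly_Mapping.lookup (f + g) m)) =
    (\<Sum>m\<in>Poly_Mapping.keys f. F m (Poly_Mapping.lookup f m)) +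
    (\<Sum>m\<in>Poly_Mapping.keys g. F m (Poly_Mapping.lookup g m))"
  by (rule setsum_keys_plus_distrib) (auto simp: assms)


section \<open>Evaluation\<close>

context
  fixes \<iota> :: "'k::comm_ring_1 \<Rightarrow> 'r::comm_ring_1" and x :: "pos \<Rightarrow> 'r"
  assumes hom: "comm_ring_hom \<iota>"
begin

interpretation comm_ring_hom \<iota> by (rule hom)

lemma eval_at_single:
  "eval_at \<iota> x (Poly_Mapping.single m c) = \<iota> c * (\<Prod>ij\<in>UNIV. x ij ^ Poly_Mapping.lookup m ij)"
  unfolding eval_at_def by (subst sum_keys_single) auto

lemma eval_at_add: "eval_at \<iota> x (f + g) = eval_at \<iota> x f + eval_at \<iota> x g"
  unfolding eval_at_def by (rule sum_keys_add) (auto simp: hom_distribs algebra_simps)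

lemma eval_at_mult: "eval_at \<iota> x (f * g) = eval_at \<iota> x f * eval_at \<iota> x g"
proof (induction f rule: poly_mapping_single_induct)
  case (single m c)
  show ?case
  proof (induction g rule: poly_mapping_single_induct)
    case (single n d)
    then show ?case
      by (simp add: mult_single eval_at_single lookup_add power_add prod.distrib hom_distribs mult_ac)
  qed (simp add: algebra_simps eval_at_add)
qed (simp add: algebra_simps eval_at_add)

lemma comm_ring_hom_eval_at: "comm_ring_hom (eval_at \<iota> x)"
  by unfold_locales
     (simp_all add: eval_at_add eval_at_mult eval_at_single flip: single_one, simp add: eval_at_def)

lemma eval_at_Const: "eval_at \<iota> x (Const c) = \<iota> c"
  by (simp add: Const_def eval_at_single)

lemma eval_at_Xvar: "eval_at \<iota> x (Xvar ij) = x ij"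
proof -
  have "(\<Prod>rs\<in>UNIV. x rs ^ Poly_Mapping.lookup (Poly_Mapping.single ij (1::nat)) rs)
      = (\<Prod>rs\<in>UNIV. if rs = ij then x rs else 1)"
    by (rule prod.cong) (auto simp: lookup_single when_def)
  then show ?thesis by (simp add: Xvar_def eval_at_single)
qed

end

lemma comm_ring_hom_Const: "comm_ring_hom Const"
  by unfold_locales (simp_all add: Const_def single_add mult_single)

interpretation Const: comm_ring_hom Const by (rule comm_ring_hom_Const)

lemma comm_ring_hom_Const_Const: "comm_ring_hom (\<lambda>c. Const (Const c))"
  by unfold_locales (simp_all add: hom_distribs)

interpretation comult: comm_ring_hom comult
  unfolding comult_def by (intro comm_ring_hom_eval_at comm_ring_hom_Const_Const)

lemma comult_Const: "comult (Const c) = Const (Const c)"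
  by (simp add: comult_def eval_at_Const comm_ring_hom_Const_Const)

lemma comult_Xvar:
  "comult (Xvar (i, j)) = (\<Sum>l\<in>UNIV. Const (Xvar (i, l)) * Xvar (l, j))"
  by (simp add: comult_def eval_at_Xvar comm_ring_hom_Const_Const)

lemma Const_mult_single: "Const c * Poly_Mapping.single m d = Poly_Mapping.single m (c * d)"
  by (simp add: Const_def mult_single)

lemma Const_mult_monomial: "Const c * Poly_Mapping.single m 1 = Poly_Mapping.single m c"
  by (simp add: Const_def mult_single)

lemma lookup_monomial_mult_add:
  fixes f :: "('a::cancel_comm_monoid_add \<Rightarrow>\<^sub>0 'b::comm_ring_1)"
  shows "Poly_Mapping.lookup (Poly_Mapping.single n 1 * f) (n + m) = Poly_Mapping.lookup f m"
  by (induction f rule: poly_mapping_single_induct)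
     (simp_all add: mult_single lookup_single when_def lookup_add algebra_simps)

lemma lookup_monomial_mult_eq_0:
  fixes f :: "('a::cancel_comm_monoid_add \<Rightarrow>\<^sub>0 'b::comm_ring_1)"
  assumes "\<And>l. m \<noteq> n + l"
  shows "Poly_Mapping.lookup (Poly_Mapping.single n 1 * f) m = 0"
  by (induction f rule: poly_mapping_single_induct)
     (use assms in \<open>auto simp add: mult_single lookup_single when_def lookup_add algebra_simps\<close>)

lemma Xvar_power: "Xvar ij ^ n = Poly_Mapping.single (Poly_Mapping.single ij n) 1"
  by (induction n) (simp_all add: Xvar_def mult_single flip: single_add)

lemma det_poly_alt:
  "det_poly = Poly_Mapping.single (Poly_Mapping.single (1, 1) 1 + Poly_Mapping.single (2, 2) 1) 1
            - Poly_Mapping.single (Poly_Mapping.single (1, 2) 1 + Poly_Mapping.single (2, 1) 1) 1"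
  by (simp add: det_poly_def Xvar_def mult_single)


section \<open>The kernel of restriction to \<open>G\<^sub>1T\<close>\<close>

definition reduced :: "nat \<Rightarrow> (pos \<Rightarrow>\<^sub>0 nat) \<Rightarrow> bool" where
  "reduced p m \<longleftrightarrow> Poly_Mapping.lookup m (1, 2) < p \<and> Poly_Mapping.lookup m (2, 1) < p"

lemma exponent_split:
  fixes m :: "pos \<Rightarrow>\<^sub>0 nat"
  assumes "n \<le> Poly_Mapping.lookup m ij"
  shows "m = Poly_Mapping.single ij n + (m - Poly_Mapping.single ij n)"
  by (rule poly_mapping_eqI)
     (use assms in \<open>auto simp: lookup_add lookup_minus lookup_single when_def\<close>)

text \<open>
  The determinant is not a zero divisor modulo \<open>X\<^sub>1\<^sub>2\<^sup>p\<close> and \<open>X\<^sub>2\<^sub>1\<^sup>p\<close>: the coefficient of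
  \<open>det \<cdot> f\<close> at \<open>X\<^sub>1\<^sub>1X\<^sub>2\<^sub>2m\<close> is the coefficient of \<open>f\<close> at \<open>m\<close>, up to a coefficient at a monomial
  with smaller exponent of \<open>X\<^sub>1\<^sub>2\<close>.
\<close>

lemma det_cancel:
  fixes f :: "'k::comm_ring_1 mat2_poly"
  assumes "\<And>m. reduced p m \<Longrightarrow> Poly_Mapping.lookup (det_poly * f) m = 0"
    and "reduced p m"
  shows "Poly_Mapping.lookup f m = 0"
  using assms(2)
proof (induction "Poly_Mapping.lookup m (1, 2)" arbitrary: m rule: less_induct)
  case less
  let ?d = "Poly_Mapping.single (1, 1) 1 + Poly_Mapping.single (2, 2) 1 :: pos \<Rightarrow>\<^sub>0 nat"
  let ?o = "Poly_Mapping.single (1, 2) 1 + Poly_Mapping.single (2, 1) 1 :: pos \<Rightarrow>\<^sub>0 nat"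
  have red: "reduced p (?d + m)"
    using less.prems by (simp add: reduced_def lookup_add lookup_single)
  have "Poly_Mapping.lookup (Poly_Mapping.single ?o 1 * f) (?d + m) = 0"
  proof (cases "\<exists>l. ?d + m = ?o + l")
    case True
    then obtain l where l: "?d + m = ?o + l" ..
    have eq: "Poly_Mapping.lookup (?d + m) ij = Poly_Mapping.lookup (?o + l) ij" for ij
      by (simp only: l)
    have "Poly_Mapping.lookup l (1, 2) < Poly_Mapping.lookup m (1, 2)" "reduced p l"
      using eq[of "(1, 2)"] eq[of "(2, 1)"] less.prems
      by (auto simp: reduced_def lookup_add lookup_single)
    then have "Poly_Mapping.lookup f l = 0" by (rule less.hyps)
    then show ?thesis unfolding l by (simp only: lookup_monomial_mult_add)
  next
    case False
    then show ?thesis by (intro lookup_monomial_mult_eq_0) auto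
  qed
  moreover have "Poly_Mapping.lookup (Poly_Mapping.single ?d 1 * f) (?d + m) = Poly_Mapping.lookup f m"
    by (rule lookup_monomial_mult_add)
  moreover have "Poly_Mapping.lookup (det_poly * f) (?d + m) = 0"
    using red by (rule assms)
  ultimately show ?case
    by (simp add: det_poly_alt left_diff_distrib lookup_minus)
qed

lemma lookup_Xvar_power_mult:
  assumes "Poly_Mapping.lookup m ij < n"
  shows "Poly_Mapping.lookup (Xvar ij ^ n * f) m = 0"
  unfolding Xvar_power
  by (rule lookup_monomial_mult_eq_0) (use assms in \<open>auto simp: lookup_add\<close>)

text \<open>
  Localising at the determinant adds nothing to the monomial ideal generated by \<open>X\<^sub>1\<^sub>2\<^sup>p\<close> and
  \<open>X\<^sub>2\<^sub>1\<^sup>p\<close>, so the kernel is spanned by the monomials that are not reduced.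
\<close>

lemma G1T_kernel_iff:
  fixes f :: "'k::comm_ring_1 mat2_poly"
  shows "f \<in> G1T_kernel \<longleftrightarrow> (\<forall>m. reduced CHAR('k) m \<longrightarrow> Poly_Mapping.lookup f m = 0)"
proof
  assume "f \<in> G1T_kernel"
  then obtain n g h where eq: "det_poly ^ n * f = Xvar (1, 2) ^ CHAR('k) * g + Xvar (2, 1) ^ CHAR('k) * h"
    unfolding G1T_kernel_def by blast
  have "Poly_Mapping.lookup (det_poly ^ n * f) m = 0" if "reduced CHAR('k) m" for m
    using that by (simp add: eq lookup_add lookup_Xvar_power_mult reduced_def)
  then have "Poly_Mapping.lookup f m = 0" if "reduced CHAR('k) m" for m
    using that
  proof (induction n arbitrary: m)
    case (Suc n)
    show ?case
      by (rule Suc.IH) (use Suc.prems det_cancel[of _ "det_poly ^ n * f"] in \<open>auto simp: mult_ac\<close>)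
  qed simp
  then show "\<forall>m. reduced CHAR('k) m \<longrightarrow> Poly_Mapping.lookup f m = 0" by blast
next
  assume *: "\<forall>m. reduced CHAR('k) m \<longrightarrow> Poly_Mapping.lookup f m = 0"
  have single: "\<exists>g h. Poly_Mapping.single m c = Xvar (1, 2) ^ CHAR('k) * g + Xvar (2, 1) ^ CHAR('k) * h"
    if m: "\<not> reduced CHAR('k) m" for m and c :: 'k
  proof -
    have "\<exists>g. Poly_Mapping.single m c = Xvar ij ^ CHAR('k) * g"
      if "CHAR('k) \<le> Poly_Mapping.lookup m ij" for ij
      using that
      by (intro exI[of _ "Poly_Mapping.single (m - Poly_Mapping.single ij CHAR('k)) c"])
         (simp add: Xvar_power mult_single flip: exponent_split)
    with m show ?thesis
      unfolding reduced_def not_less de_Morgan_conj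
      by (metis add.right_neutral add.left_neutral mult_zero_right)
  qed
  have "\<exists>g h. (\<Sum>m\<in>A. Poly_Mapping.single m (Poly_Mapping.lookup f m))
      = Xvar (1, 2) ^ CHAR('k) * g + Xvar (2, 1) ^ CHAR('k) * h"
    if "finite A" "A \<subseteq> Poly_Mapping.keys f" for A
    using that
  proof (induction)
    case empty
    show ?case by (rule exI[of _ 0], rule exI[of _ 0]) simp
  next
    case (insert m A)
    from insert obtain g h where 1: "(\<Sum>m\<in>A. Poly_Mapping.single m (Poly_Mapping.lookup f m))
      = Xvar (1, 2) ^ CHAR('k) * g + Xvar (2, 1) ^ CHAR('k) * h" by auto
    from insert * have "\<not> reduced CHAR('k) m" by (auto simp: in_keys_iff)
    from single[OF this, of "Poly_Mapping.lookup f m"] obtain g' h' where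
      2: "Poly_Mapping.single m (Poly_Mapping.lookup f m)
        = Xvar (1, 2) ^ CHAR('k) * g' + Xvar (2, 1) ^ CHAR('k) * h'" by auto
    show ?case
      by (rule exI[of _ "g' + g"], rule exI[of _ "h' + h"])
         (use insert in \<open>simp add: 1 2 algebra_simps\<close>)
  qed
  from this[of "Poly_Mapping.keys f"] obtain g h
    where "det_poly ^ 0 * f = Xvar (1, 2) ^ CHAR('k) * g + Xvar (2, 1) ^ CHAR('k) * h"
    by (auto simp: poly_mapping_sum_single)
  then show "f \<in> G1T_kernel"
    unfolding G1T_kernel_def by blast
qed


section \<open>Linear forms\<close>

definition linear_form :: "'k::field form \<Rightarrow> bool" where
  "linear_form \<phi> \<longleftrightarrow> (\<forall>f g. \<phi> (f + g) = \<phi> f + \<phi> g) \<and> (\<forall>c f. \<phi> (Const c * f) = c * \<phi> f)"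

lemma linear_form_iff:
  fixes \<phi> :: "'k::field form"
  shows "Vector_Spaces.linear (\<lambda>c f. Const c * f) (*) \<phi> \<longleftrightarrow> linear_form \<phi>"
proof -
  have "vector_space (\<lambda>c f. Const c * f :: 'k::field mat2_poly)"
    by unfold_locales (simp_all add: algebra_simps hom_distribs)
  moreover have "vector_space ((*) :: 'k \<Rightarrow> 'k \<Rightarrow> 'k)"
    by unfold_locales (simp_all add: algebra_simps)
  ultimately show ?thesis
    unfolding Vector_Spaces.linear_iff linear_form_def by auto
qed

lemma linear_form_add: "linear_form \<phi> \<Longrightarrow> \<phi> (f + g) = \<phi> f + \<phi> g"
  and linear_form_scale: "linear_form \<phi> \<Longrightarrow> \<phi> (Const c * f) = c * \<phi> f"
  by (simp_all add: linear_form_def)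

lemma linear_form_0: "linear_form \<phi> \<Longrightarrow> \<phi> 0 = 0"
  using linear_form_scale[of \<phi> 0 0] by simp

lemma linear_form_diff: "linear_form \<phi> \<Longrightarrow> \<phi> (f - g) = \<phi> f - \<phi> g"
  using linear_form_add[of \<phi> "f - g" g] by simp

lemma linear_form_single: "linear_form \<phi> \<Longrightarrow> \<phi> (Poly_Mapping.single m c) = c * \<phi> (Poly_Mapping.single m 1)"
  using linear_form_scale[of \<phi> c "Poly_Mapping.single m 1"] by (simp add: Const_mult_monomial)

lemma linear_form_sum: "linear_form \<phi> \<Longrightarrow> \<phi> (\<Sum>i\<in>A. F i) = (\<Sum>i\<in>A. \<phi> (F i))"
  by (induction A rule: infinite_finite_induct) (simp_all add: linear_form_0 linear_form_add)

lemma linear_form_value: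
  assumes "linear_form \<phi>"
  shows "\<phi> f = (\<Sum>m\<in>Poly_Mapping.keys f. Poly_Mapping.lookup f m * \<phi> (Poly_Mapping.single m 1))"
  using linear_form_sum[OF assms, of "\<lambda>m. Poly_Mapping.single m (Poly_Mapping.lookup f m)" "Poly_Mapping.keys f"]
  by (simp add: poly_mapping_sum_single linear_form_single[OF assms, of _ "Poly_Mapping.lookup f _"])

lemma linear_form_eqI:
  assumes "linear_form \<phi>" "linear_form \<psi>"
    and "\<And>m. \<phi> (Poly_Mapping.single m 1) = \<psi> (Poly_Mapping.single m 1)"
  shows "\<phi> = \<psi>"
proof
  fix f
  show "\<phi> f = \<psi> f"
    unfolding linear_form_value[OF assms(1), of f] linear_form_value[OF assms(2), of f] by (simp only: assms(3))
qed

lemma linear_form_zero: "linear_form (\<lambda>f. 0)"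
  and linear_form_plus: "linear_form \<phi> \<Longrightarrow> linear_form \<psi> \<Longrightarrow> linear_form (\<lambda>f. \<phi> f + \<psi> f)"
  and linear_form_times: "linear_form \<phi> \<Longrightarrow> linear_form (\<lambda>f. c * \<phi> f)"
  by (simp_all add: linear_form_def algebra_simps)

lemma linear_form_mult:
  assumes "linear_form \<phi>"
  shows "linear_form (\<lambda>f. \<phi> (g * f))"
  using assms by (simp add: linear_form_def ring_distribs mult.left_commute[of g "Const _"])

definition form_of :: "((pos \<Rightarrow>\<^sub>0 nat) \<Rightarrow> 'k) \<Rightarrow> 'k::field form" where
  "form_of F f = (\<Sum>m\<in>Poly_Mapping.keys f. Poly_Mapping.lookup f m * F m)"

lemma form_of_monomial [simp]: "form_of F (Poly_Mapping.single m 1) = F m"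
  unfolding form_of_def by (subst sum_keys_single) auto

lemma linear_form_form_of: "linear_form (form_of F)"
  unfolding linear_form_def
proof (intro conjI allI)
  show add: "form_of F (f + g) = form_of F f + form_of F g" for f g
    unfolding form_of_def by (rule sum_keys_add) (auto simp: algebra_simps)
  show "form_of F (Const c * f) = c * form_of F f" for c f
  proof (induction f rule: poly_mapping_single_induct)
    case (single m d)
    have "form_of F (Poly_Mapping.single m e) = e * F m" for e
      unfolding form_of_def by (subst sum_keys_single) auto
    then show ?case by (simp add: Const_mult_single)
  qed (simp add: algebra_simps add)
qed

text \<open>
  The Schur algebra is the dual of the space spanned by the reduced monomials of degree \<open>d\<close>.
\<close>

lemma schur_forms_iff:
  fixes \<phi> :: "'k::field form"
  shows "\<phi> \<in> schur_forms d \<longleftrightarrow> linear_form \<phi> \<and>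
    (\<forall>m. \<phi> (Poly_Mapping.single m 1) \<noteq> 0 \<longrightarrow> reduced CHAR('k) m \<and> mon_deg m = d)"
    (is "_ \<longleftrightarrow> _ \<and> ?R")
proof (intro iffI conjI)
  assume \<phi>: "\<phi> \<in> schur_forms d"
  then show "linear_form \<phi>" by (simp add: schur_forms_def linear_form_iff)
  show ?R
  proof (intro allI impI)
    fix m assume nz: "\<phi> (Poly_Mapping.single m 1) \<noteq> 0"
    have "reduced CHAR('k) m"
    proof (rule ccontr)
      assume "\<not> reduced CHAR('k) m"
      then have "(Poly_Mapping.single m 1 :: 'k mat2_poly) \<in> G1T_kernel"
        by (auto simp: G1T_kernel_iff lookup_single when_def)
      with \<phi> nz show False by (simp add: schur_forms_def)
    qed
    moreover have "homogeneous (mon_deg m) (Poly_Mapping.single m 1 :: 'k mat2_poly)"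
      by (simp add: homogeneous_def)
    then have "mon_deg m = d" using \<phi> nz by (auto simp: schur_forms_def)
    ultimately show "reduced CHAR('k) m \<and> mon_deg m = d" ..
  qed
next
  assume "linear_form \<phi> \<and> ?R"
  then have lin: "linear_form \<phi>" and R: ?R by auto
  have "\<phi> f = 0" if "f \<in> G1T_kernel" for f
    unfolding linear_form_value[OF lin, of f]
    using that R by (intro sum.neutral) (auto simp: G1T_kernel_iff)
  moreover have "\<phi> f = 0" if "e \<noteq> d" "homogeneous e f" for e f
    unfolding linear_form_value[OF lin, of f]
    using that R by (intro sum.neutral) (auto simp: homogeneous_def)
  ultimately show "\<phi> \<in> schur_forms d"
    using lin by (auto simp: schur_forms_def linear_form_iff)
qed

lemma schur_forms_linear: "\<phi> \<in> schur_forms d \<Longrightarrow> linear_form \<phi>"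
  by (simp add: schur_forms_iff)

lemma schur_forms_mon_deg: "\<phi> \<in> schur_forms d \<Longrightarrow> mon_deg m \<noteq> d \<Longrightarrow> \<phi> (Poly_Mapping.single m 1) = 0"
  by (auto simp: schur_forms_iff)

lemma schur_forms_reduced:
  fixes \<phi> :: "'k::field form"
  shows "\<phi> \<in> schur_forms d \<Longrightarrow> \<not> reduced CHAR('k) m \<Longrightarrow> \<phi> (Poly_Mapping.single m 1) = 0"
  by (auto simp: schur_forms_iff)

lemma schur_forms_plus:
  "\<phi> \<in> schur_forms d \<Longrightarrow> \<psi> \<in> schur_forms d \<Longrightarrow> (\<lambda>f. \<phi> f + \<psi> f) \<in> schur_forms d"
  unfolding schur_forms_iff by (intro conjI linear_form_plus) (auto, (metis add.right_neutral)+)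

lemma schur_forms_times: "\<phi> \<in> schur_forms d \<Longrightarrow> (\<lambda>f. c * \<phi> f) \<in> schur_forms d"
  unfolding schur_forms_iff by (auto intro: linear_form_times)

lemma schur_forms_zero: "(\<lambda>f. 0) \<in> schur_forms d"
  unfolding schur_forms_iff by (auto intro: linear_form_zero)

lemma schur_forms_sum:
  assumes "\<And>i. i \<in> A \<Longrightarrow> F i \<in> schur_forms d"
  shows "(\<lambda>f. \<Sum>i\<in>A. F i f) \<in> schur_forms d"
  using assms
  by (induction A rule: infinite_finite_induct) (auto intro: schur_forms_zero schur_forms_plus)

lemma form_of_in_schur_forms:
  assumes "\<And>m. F m \<noteq> 0 \<Longrightarrow> reduced CHAR('k) m \<and> mon_deg m = d"
  shows "(form_of F :: 'k::field form) \<in> schur_forms d"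
  unfolding schur_forms_iff using assms by (auto intro: linear_form_form_of)

lemma schur_form_Xvar_power:
  fixes \<phi> :: "'k::field form"
  assumes "\<phi> \<in> schur_forms d" "i \<noteq> j"
  shows "\<phi> (Xvar (i, j) ^ CHAR('k) * f) = 0"
proof -
  have "Xvar (i, j) ^ CHAR('k) * f \<in> G1T_kernel"
    using two_cases[of i] two_cases[of j] assms(2)
    by (auto simp: G1T_kernel_iff reduced_def intro!: lookup_Xvar_power_mult)
  with assms(1) show ?thesis by (simp add: schur_forms_def)
qed


section \<open>Words\<close>

definition words :: "nat \<Rightarrow> 2 list set" where
  "words d = {I. length I = d}"

text \<open>
  The exponent of the product of the variables \<open>X\<^sub>i\<^sub>j\<close> over the letters \<open>i\<close> of \<open>I\<close> and \<open>j\<close> of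
  \<open>J\<close>. Different pairs of words may give the same monomial; allowing this redundancy turns a
  form into a matrix on tensor space.
\<close>

definition wexp :: "2 list \<Rightarrow> 2 list \<Rightarrow> pos \<Rightarrow>\<^sub>0 nat" where
  "wexp I J = sum_list (map2 (\<lambda>i j. Poly_Mapping.single (i, j) 1) I J)"

abbreviation wmon :: "2 list \<Rightarrow> 2 list \<Rightarrow> 'k::comm_ring_1 mat2_poly" where
  "wmon I J \<equiv> Poly_Mapping.single (wexp I J) 1"

lemma finite_words [simp]: "finite (words d)"
  using finite_lists_length_eq[of "UNIV :: 2 set" d] by (simp add: words_def)

lemma words_0 [simp]: "words 0 = {[]}"
  by (auto simp: words_def)

lemma wexp_simps [simp]:
  "wexp [] J = 0"
  "wexp (i # I) (j # J) = Poly_Mapping.single (i, j) 1 + wexp I J"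
  by (simp_all add: wexp_def)

lemma sum_words_Suc: "(\<Sum>I\<in>words (Suc d). F I) = (\<Sum>i\<in>UNIV. \<Sum>I\<in>words d. F (i # I))"
proof -
  have "words (Suc d) = (\<lambda>(i, I). i # I) ` (UNIV \<times> words d)"
    by (auto simp: words_def length_Suc_conv image_iff)
  moreover have "inj_on (\<lambda>(i, I). i # I) (UNIV \<times> words d)"
    by (auto simp: inj_on_def)
  ultimately have "(\<Sum>I\<in>words (Suc d). F I) = (\<Sum>iI\<in>UNIV \<times> words d. F (fst iI # snd iI))"
    by (simp add: sum.reindex case_prod_unfold)
  then show ?thesis by (simp add: sum.cartesian_product case_prod_unfold)
qed

text \<open>
  The weights of a monomial for left and right multiplication by the torus are the contents of
  the two words.
\<close>

lemma lookup_wexp_row: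
  "length I = length J \<Longrightarrow>
    Poly_Mapping.lookup (wexp I J) (i, 1) + Poly_Mapping.lookup (wexp I J) (i, 2) = count_list I i"
  by (induction I J rule: list_induct2)
     (use two_cases in \<open>auto simp: lookup_add lookup_single when_def\<close>)

lemma lookup_wexp_col:
  "length I = length J \<Longrightarrow>
    Poly_Mapping.lookup (wexp I J) (1, j) + Poly_Mapping.lookup (wexp I J) (2, j) = count_list J j"
  by (induction I J rule: list_induct2)
     (use two_cases in \<open>auto simp: lookup_add lookup_single when_def\<close>)

lemma count_list_two: "count_list I 1 + count_list I (2::2) = length I"
  by (induction I) (use two_cases in auto)

lemma mon_deg_add: "mon_deg (m + n) = mon_deg m + mon_deg n"
  by (simp add: mon_deg_def lookup_add sum.distrib)

lemma mon_deg_single: "mon_deg (Poly_Mapping.single ij n) = n"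
  by (simp add: mon_deg_def lookup_single when_def)

lemma mon_deg_wexp: "length I = length J \<Longrightarrow> mon_deg (wexp I J) = length I"
  by (induction I J rule: list_induct2) (simp_all add: mon_deg_add mon_deg_single, simp add: mon_deg_def)

lemma exponent_is_word: "\<exists>I\<in>words (mon_deg m). \<exists>J\<in>words (mon_deg m). m = wexp I J"
proof (induction "mon_deg m" arbitrary: m)
  case 0
  have "Poly_Mapping.lookup m ij \<le> mon_deg m" for ij
    unfolding mon_deg_def by (rule member_le_sum) auto
  with 0 have "m = 0"
    by (intro poly_mapping_eqI) simp
  with 0 show ?case by auto
next
  case (Suc d)
  have "mon_deg m \<noteq> 0" using Suc.hyps(2) by simp
  then obtain ij where "Poly_Mapping.lookup m ij \<noteq> 0"
    unfolding mon_deg_def by (metis (mono_tags) sum.neutral)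
  then obtain i j where "Poly_Mapping.lookup m (i, j) \<noteq> 0" by (cases ij) metis
  then have m: "m = Poly_Mapping.single (i, j) 1 + (m - Poly_Mapping.single (i, j) 1)"
    by (intro exponent_split) auto
  define n where "n = m - Poly_Mapping.single (i, j) 1"
  have m: "m = Poly_Mapping.single (i, j) 1 + n" using m unfolding n_def .
  then have "d = mon_deg n" using Suc.hyps(2) by (simp add: mon_deg_add mon_deg_single)
  from Suc.hyps(1)[OF this] obtain I J where "I \<in> words d" "J \<in> words d" "n = wexp I J"
    unfolding \<open>d = mon_deg n\<close>[symmetric] by blast
  then have "i # I \<in> words (Suc d)" "j # J \<in> words (Suc d)" "m = wexp (i # I) (j # J)"
    by (simp_all add: words_def m)
  then show ?case unfolding Suc.hyps(2)[symmetric] by blast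
qed

lemma schur_forms_eqI:
  assumes "\<phi> \<in> schur_forms d" "\<psi> \<in> schur_forms d"
    and "\<And>I J. I \<in> words d \<Longrightarrow> J \<in> words d \<Longrightarrow> \<phi> (wmon I J) = \<psi> (wmon I J)"
  shows "\<phi> = \<psi>"
proof (rule linear_form_eqI)
  fix m
  show "\<phi> (Poly_Mapping.single m 1) = \<psi> (Poly_Mapping.single m 1)"
  proof (cases "mon_deg m = d")
    case True
    then show ?thesis using exponent_is_word[of m] assms(3) by auto
  next
    case False
    then show ?thesis using assms(1,2) by (simp add: schur_forms_mon_deg)
  qed
qed (use assms in \<open>auto dest: schur_forms_linear\<close>)


section \<open>Convolution\<close>

text \<open>
  The form \<open>\<phi> \<otimes> \<psi>\<close> on \<open>k[X][Y]\<close>, separated from the comultiplication so that factors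
  of the argument can be moved into \<open>\<phi>\<close> and \<open>\<psi>\<close>.
\<close>

definition tensor_form :: "'k::field form \<Rightarrow> 'k form \<Rightarrow> 'k mat2_poly mat2_poly \<Rightarrow> 'k" where
  "tensor_form \<phi> \<psi> F =
    (\<Sum>m\<in>Poly_Mapping.keys F. \<phi> (Poly_Mapping.lookup F m) * \<psi> (Poly_Mapping.single m 1))"

lemma convolution_alt: "convolution \<phi> \<psi> f = tensor_form \<phi> \<psi> (comult f)"
  by (simp add: convolution_def tensor_form_def)

lemma tensor_form_single:
  "linear_form \<phi> \<Longrightarrow> tensor_form \<phi> \<psi> (Poly_Mapping.single m g) = \<phi> g * \<psi> (Poly_Mapping.single m 1)"
  unfolding tensor_form_def by (subst sum_keys_single) (auto simp: linear_form_0)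

lemma tensor_form_add:
  "linear_form \<phi> \<Longrightarrow> tensor_form \<phi> \<psi> (F + G) = tensor_form \<phi> \<psi> F + tensor_form \<phi> \<psi> G"
  unfolding tensor_form_def
  by (rule sum_keys_add) (auto simp: linear_form_0 linear_form_add algebra_simps)

lemma tensor_form_diff:
  "linear_form \<phi> \<Longrightarrow> tensor_form \<phi> \<psi> (F - G) = tensor_form \<phi> \<psi> F - tensor_form \<phi> \<psi> G"
  using tensor_form_add[of \<phi> \<psi> "F - G" G] by simp

lemma tensor_form_sum:
  "linear_form \<phi> \<Longrightarrow> tensor_form \<phi> \<psi> (\<Sum>i\<in>A. F i) = (\<Sum>i\<in>A. tensor_form \<phi> \<psi> (F i))"
  by (induction A rule: infinite_finite_induct)
     (simp_all add: tensor_form_add, simp_all add: tensor_form_def)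

lemma tensor_form_mult:
  assumes "linear_form \<phi>"
  shows "tensor_form \<phi> \<psi> (Const c * (Poly_Mapping.single n 1 * F)) =
    tensor_form (\<lambda>g. \<phi> (c * g)) (\<lambda>g. \<psi> (Poly_Mapping.single n 1 * g)) F"
proof (induction F rule: poly_mapping_single_induct)
  case (single m g)
  show ?case
    using assms by (simp add: mult_single Const_mult_single tensor_form_single linear_form_mult)
next
  case (add F G)
  then show ?case using assms by (simp add: distrib_left tensor_form_add linear_form_mult)
qed

lemma linear_form_convolution:
  assumes "linear_form \<phi>"
  shows "linear_form (convolution \<phi> \<psi>)"
  unfolding linear_form_def convolution_alt
proof (intro conjI allI)
  fix c f
  have "tensor_form \<phi> \<psi> (Const (Const c) * F) = c * tensor_form \<phi> \<psi> F" for F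
    by (induction F rule: poly_mapping_single_induct)
       (use assms in \<open>simp_all add: Const_mult_single tensor_form_single linear_form_scale
         tensor_form_add distrib_left mult.assoc\<close>)
  then show "tensor_form \<phi> \<psi> (comult (Const c * f)) = c * tensor_form \<phi> \<psi> (comult f)"
    by (simp add: comult_Const comult.hom_mult)
qed (use assms in \<open>simp add: comult.hom_add tensor_form_add\<close>)

text \<open>
  Each factor \<open>X\<^sub>i\<^sub>j\<close> contributes a sum over a middle letter; together these letters form the
  word \<open>L\<close>.
\<close>

lemma comult_word:
  assumes "length I = length J"
  shows "comult (wmon I J :: 'k::comm_ring_1 mat2_poly) = (\<Sum>L\<in>words (length I). Poly_Mapping.single (wexp L J) (wmon I L))"
  using assms
proof (induction I J rule: list_induct2)
  case Nil
  then show ?case by simp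
next
  case (Cons i I j J)
  have "comult (wmon (i # I) (j # J) :: 'k mat2_poly) = comult (Xvar (i, j)) * comult (wmon I J)"
    by (simp only: comult.hom_mult[symmetric] Xvar_def mult_single wexp_simps mult_1)
  also have "\<dots> = (\<Sum>l\<in>UNIV. \<Sum>L\<in>words (length I).
      Const (Xvar (i, l)) * Xvar (l, j) * Poly_Mapping.single (wexp L J) (wmon I L))"
    by (simp only: comult_Xvar Cons.IH sum_product)
  also have "\<dots> = (\<Sum>l\<in>UNIV. \<Sum>L\<in>words (length I).
      Poly_Mapping.single (wexp (l # L) (j # J)) (wmon (i # I) (l # L)))"
    by (simp only: Xvar_def Const_def mult_single wexp_simps mult_1 mult_1_right add_0_left)
  finally show ?case by (simp only: list.size(4) sum_words_Suc add_Suc_right add_0_right)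
qed

lemma convolution_word:
  assumes "linear_form \<phi>" "I \<in> words d" "J \<in> words d"
  shows "convolution \<phi> \<psi> (wmon I J) = (\<Sum>L\<in>words d. \<phi> (wmon I L) * \<psi> (wmon L J))"
  using assms by (auto simp: convolution_alt comult_word words_def tensor_form_sum tensor_form_single)

lemma CHAR_mat2_poly: "CHAR('k mat2_poly) = CHAR('k::comm_ring_1)"
proof (rule CHAR_eqI)
  have *: "Poly_Mapping.lookup (of_nat n :: 'k mat2_poly) 0 = of_nat n" for n
    by (simp add: lookup_of_nat)
  show "of_nat CHAR('k) = (0 :: 'k mat2_poly)"
    by (rule poly_mapping_eqI) (simp add: lookup_of_nat)
  show "CHAR('k) dvd n" if "of_nat n = (0 :: 'k mat2_poly)" for n
    using *[of n] that by (simp add: of_nat_eq_0_iff_char_dvd)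
qed

text \<open>
  In characteristic \<open>p\<close> the comultiplication sends \<open>X\<^sub>i\<^sub>j\<^sup>p\<close> to the sum of all
  \<open>X\<^sub>i\<^sub>l\<^sup>p \<otimes> X\<^sub>l\<^sub>j\<^sup>p\<close>. If \<open>i \<noteq> j\<close>, every summand has an off-diagonal factor, and the form that is
  applied to it vanishes.
\<close>

lemma convolution_closed:
  fixes \<phi> \<psi> :: "'k::field form"
  assumes p: "prime CHAR('k)" and \<phi>: "\<phi> \<in> schur_forms d" and \<psi>: "\<psi> \<in> schur_forms d"
  shows "convolution \<phi> \<psi> \<in> schur_forms d"
  unfolding schur_forms_iff
proof (intro conjI allI impI)
  have lin: "linear_form \<phi>" "linear_form \<psi>"
    using \<phi> \<psi> by (auto dest: schur_forms_linear)
  then show "linear_form (convolution \<phi> \<psi>)" by (intro linear_form_convolution)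
  fix m assume nz: "convolution \<phi> \<psi> (Poly_Mapping.single m 1) \<noteq> 0"
  show "mon_deg m = d"
  proof (rule ccontr)
    assume e: "mon_deg m \<noteq> d"
    obtain I J where IJ: "I \<in> words (mon_deg m)" "J \<in> words (mon_deg m)" "m = wexp I J"
      using exponent_is_word by blast
    have "\<phi> (wmon I L) = 0" if "L \<in> words (mon_deg m)" for L
    proof -
      have "length I = mon_deg m" "length L = mon_deg m"
        using IJ(1) that by (simp_all add: words_def)
      then have "mon_deg (wexp I L) \<noteq> d" using e by (simp add: mon_deg_wexp)
      then show ?thesis by (rule schur_forms_mon_deg[OF \<phi>])
    qed
    then have "convolution \<phi> \<psi> (wmon I J) = 0"
      by (simp add: convolution_word[OF lin(1) IJ(1,2)])
    with nz IJ(3) show False by simp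
  qed
  have "Poly_Mapping.lookup m (i, j) < CHAR('k)" if "i \<noteq> j" for i j
  proof (rule ccontr)
    assume "\<not> Poly_Mapping.lookup m (i, j) < CHAR('k)"
    then obtain n where "m = Poly_Mapping.single (i, j) CHAR('k) + n"
      using exponent_split[of "CHAR('k)" m "(i, j)"] by (auto simp: not_less)
    then have "Poly_Mapping.single m 1 = Xvar (i, j) ^ CHAR('k) * (Poly_Mapping.single n 1 :: 'k mat2_poly)"
      by (simp add: Xvar_power mult_single)
    then have "comult (Poly_Mapping.single m 1 :: 'k mat2_poly) = 
        comult (Xvar (i, j)) ^ CHAR('k) * comult (Poly_Mapping.single n 1)"
      by (simp add: hom_distribs)
    also have "comult (Xvar (i, j)) ^ CHAR('k) =
        (\<Sum>l\<in>UNIV. (Const (Xvar (i, l)) * Xvar (l, j) :: 'k mat2_poly mat2_poly) ^ CHAR('k))"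
      unfolding comult_Xvar by (rule freshmans_dream_sum) (use p in \<open>simp_all add: CHAR_mat2_poly\<close>)
    finally have "convolution \<phi> \<psi> (Poly_Mapping.single m 1) =
        (\<Sum>l\<in>UNIV. tensor_form \<phi> \<psi> (Const (Xvar (i, l) ^ CHAR('k)) *
           (Xvar (l, j) ^ CHAR('k) * comult (Poly_Mapping.single n 1))))"
      by (simp add: convolution_alt sum_distrib_right tensor_form_sum lin power_mult_distrib
        Const.hom_power mult.assoc)
    also have "\<dots> = 0"
    proof (intro sum.neutral ballI)
      fix l
      have *: "tensor_form (\<lambda>g. \<phi> (Xvar (i, l) ^ CHAR('k) * g)) (\<lambda>g. \<psi> (Xvar (l, j) ^ CHAR('k) * g)) F = 0" for F
      proof (cases "l = i")
        case True
        with \<open>i \<noteq> j\<close> show ?thesis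
          by (simp add: tensor_form_def schur_form_Xvar_power[OF \<psi>])
      next
        case False
        then show ?thesis
          by (simp add: tensor_form_def schur_form_Xvar_power[OF \<phi>])
      qed
      show "tensor_form \<phi> \<psi> (Const (Xvar (i, l) ^ CHAR('k)) *
           (Xvar (l, j) ^ CHAR('k) * comult (Poly_Mapping.single n 1))) = 0"
        unfolding Xvar_power[of "(l, j)"] tensor_form_mult[OF lin(1)] using * by (simp add: Xvar_power)
    qed
    finally show False using nz by contradiction
  qed
  then show "reduced CHAR('k) m" by (simp add: reduced_def)
qed


section \<open>Torus and Lie algebra\<close>

text \<open>
  Written as a sum over all monomials, with an additive summand, the homogeneous component is
  visibly additive.
\<close>

lemma hom_component_alt:
  "hom_component d f = (\<Sum>m\<in>Poly_Mapping.keys f.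
     if mon_deg m = d then Poly_Mapping.single m (Poly_Mapping.lookup f m) else 0)"
  by (simp add: hom_component_def sum.inter_filter)

lemma hom_component_single:
  "hom_component d (Poly_Mapping.single m c) = (if mon_deg m = d then Poly_Mapping.single m c else 0)"
  unfolding hom_component_alt by (subst sum_keys_single) auto

lemma hom_component_add: "hom_component d (f + g) = hom_component d f + hom_component d g"
  unfolding hom_component_alt by (rule sum_keys_add) (auto simp: single_add)

lemma hom_component_diff: "hom_component d (f - g) = hom_component d f - hom_component d g"
  using hom_component_add[of d "f - g" g] by simp

lemma hom_component_Const: "hom_component d (Const c * f) = Const c * hom_component d f"
  by (induction f rule: poly_mapping_single_induct)
     (auto simp: Const_mult_single hom_component_single hom_component_add distrib_left)

lemma hom_component_det:
  "hom_component (d + 2) (det_poly * f) = det_poly * hom_component d f"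
  by (induction f rule: poly_mapping_single_induct)
     (auto simp: det_poly_alt mult_single hom_component_single hom_component_add hom_component_diff
       ring_distribs mon_deg_add mon_deg_single)

context
  fixes \<iota> :: "'k::comm_ring_1 \<Rightarrow> 'r::comm_ring_1" and x :: "pos \<Rightarrow> 'r"
  assumes hom: "comm_ring_hom \<iota>"
begin

interpretation ev: comm_ring_hom "eval_at \<iota> x" by (rule comm_ring_hom_eval_at) (rule hom)

lemma eval_at_wmon_Nil: "eval_at \<iota> x (wmon [] []) = 1"
  by simp

lemma eval_at_wmon_Cons:
  "eval_at \<iota> x (wmon (i # I) (j # J)) = x (i, j) * eval_at \<iota> x (wmon I J)"
proof -
  have "(wmon (i # I) (j # J) :: 'k mat2_poly) = Xvar (i, j) * wmon I J"
    by (simp add: Xvar_def mult_single)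
  then show ?thesis by (simp add: ev.hom_mult eval_at_Xvar[OF hom])
qed

lemma eval_at_det: "eval_at \<iota> x det_poly = x (1, 1) * x (2, 2) - x (1, 2) * x (2, 1)"
  by (simp add: det_poly_def ev.hom_mult ev.hom_minus eval_at_Xvar[OF hom])

end

lemma comm_ring_hom_id: "comm_ring_hom id"
  by unfold_locales simp_all

lemma comm_ring_hom_pCons: "comm_ring_hom (\<lambda>c :: 'k::comm_ring_1. [:c:])"
  by unfold_locales (simp_all add: one_pCons)

abbreviation dual_point :: "pos \<Rightarrow> pos \<Rightarrow> 'k::comm_ring_1 poly" where
  "dual_point ij \<equiv> \<lambda>rs. (if fst rs = snd rs then 1 else 0) + (if rs = ij then [:0, 1:] else 0)"

lemma torus_form_linear: "linear_form (torus_form d t u)"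
proof -
  interpret ev: comm_ring_hom "eval_at id (diag_mat2 t u)"
    by (rule comm_ring_hom_eval_at) (rule comm_ring_hom_id)
  show ?thesis
    unfolding linear_form_def torus_form_def
    by (simp add: hom_component_add hom_component_Const ev.hom_add ev.hom_mult
        eval_at_Const comm_ring_hom_id)
qed

lemma lie_form_linear: "linear_form (lie_form d ij)"
proof -
  interpret ev: comm_ring_hom "eval_at (\<lambda>c. [:c:]) (dual_point ij)"
    by (rule comm_ring_hom_eval_at) (rule comm_ring_hom_pCons)
  show ?thesis
    unfolding linear_form_def lie_form_def
    by (simp add: hom_component_add hom_component_Const ev.hom_add ev.hom_mult
        eval_at_Const comm_ring_hom_pCons)
qed

lemma torus_form_in_schur_forms:
  assumes "prime CHAR('k)"
  shows "torus_form d t (u :: 'k::field) \<in> schur_forms d"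
  unfolding schur_forms_iff
proof (intro conjI allI impI)
  fix m assume nz: "torus_form d t u (Poly_Mapping.single m 1) \<noteq> 0"
  then show "mon_deg m = d"
    by (auto simp: torus_form_def hom_component_single eval_at_def split: if_splits)
  with nz have "Poly_Mapping.lookup m (1, 2) = 0" "Poly_Mapping.lookup m (2, 1) = 0"
    by (auto simp: torus_form_def hom_component_single eval_at_single[OF comm_ring_hom_id]
        prod_pos diag_mat2_def)
  with assms show "reduced CHAR('k) m" by (simp add: reduced_def prime_gt_0_nat)
qed (rule torus_form_linear)

text \<open>
  An off-diagonal variable is 0 or \<open>\<epsilon>\<close> at the dual point, so its square does not contribute
  to the coefficient of \<open>\<epsilon>\<close>; and \<open>p \<ge> 2\<close>.
\<close>

lemma lie_form_in_schur_forms: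
  assumes "prime CHAR('k::field)"
  shows "(lie_form d ij :: 'k form) \<in> schur_forms d"
  unfolding schur_forms_iff
proof (intro conjI allI impI)
  fix m assume nz: "(lie_form d ij :: 'k form) (Poly_Mapping.single m 1) \<noteq> 0"
  then show deg: "mon_deg m = d"
    by (auto simp: lie_form_def hom_component_single eval_at_def split: if_splits)
  have *: "Poly_Mapping.lookup m (r, s) < 2" if "r \<noteq> s" for r s
  proof (rule ccontr)
    assume "\<not> Poly_Mapping.lookup m (r, s) < 2"
    then have "([:0, 1:] :: 'k poly) ^ 2 dvd dual_point ij (r, s) ^ Poly_Mapping.lookup m (r, s)"
      using that by (auto simp: power_0_left intro!: le_imp_power_dvd)
    also have "\<dots> dvd (\<Prod>rs\<in>UNIV. dual_point ij rs ^ Poly_Mapping.lookup m rs)"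
      by (rule dvd_prodI) auto
    finally obtain q where q: "(\<Prod>rs\<in>UNIV. dual_point ij rs ^ Poly_Mapping.lookup m rs)
        = ([:0, 1:] :: 'k poly) ^ 2 * q" by (elim dvdE)
    have "lie_form d ij (Poly_Mapping.single m 1) = coeff (([:0, 1:] :: 'k poly) ^ 2 * q) 1"
      using deg unfolding lie_form_def
      by (simp add: hom_component_single eval_at_single[OF comm_ring_hom_pCons] flip: q)
    also have "\<dots> = 0" by (simp add: power2_eq_square)
    finally show False using nz by simp
  qed
  show "reduced CHAR('k) m"
    using *[of 1 2] *[of 2 1] prime_ge_2_nat[OF assms] by (simp add: reduced_def)
qed (rule lie_form_linear)

lemma torus_form_word:
  assumes "I \<in> words d" "J \<in> words d"
  shows "torus_form d t u (wmon I J) = (if I = J then t ^ count_list I 1 * u ^ count_list I 2 else 0)"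
proof -
  have "eval_at id (diag_mat2 t u) (wmon I J) = (if I = J then t ^ count_list I 1 * u ^ count_list I 2 else 0)"
    if "length I = length J" for I J
    using that
  proof (induction I J rule: list_induct2)
    case Nil
    show ?case unfolding eval_at_wmon_Nil[OF comm_ring_hom_id] by simp
  next
    case (Cons i I j J)
    show ?case
      unfolding eval_at_wmon_Cons[OF comm_ring_hom_id] Cons.IH
      using two_cases[of i] two_cases[of j] by (auto simp: diag_mat2_def)
  qed
  then show ?thesis
    using assms by (simp add: torus_form_def hom_component_single mon_deg_wexp words_def)
qed


section \<open>The Schur algebra is a ring\<close>

lemma schur_alg_simps [simp]:
  "carrier (schur_alg d) = schur_forms d" "x \<otimes>\<^bsub>schur_alg d\<^esub> y = convolution x y"
  "\<one>\<^bsub>schur_alg d\<^esub> = torus_form d 1 1" "\<zero>\<^bsub>schur_alg d\<^esub> = (\<lambda>f. 0)"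
  "x \<oplus>\<^bsub>schur_alg d\<^esub> y = (\<lambda>f. x f + y f)"
  by (simp_all add: schur_alg_def)

text \<open>
  On words, associativity and the unit laws are those of matrix multiplication.
\<close>

lemma schur_alg_ring:
  assumes "prime CHAR('k)"
  shows "ring (schur_alg d :: 'k::field form ring)"
proof (rule ringI)
  show "abelian_group (schur_alg d :: 'k form ring)"
  proof (rule abelian_groupI)
    fix x :: "'k form" assume "x \<in> carrier (schur_alg d)"
    then have "(\<lambda>f. - 1 * x f) \<in> schur_forms d"
      by (intro schur_forms_times) auto
    then show "\<exists>y\<in>carrier (schur_alg d). y \<oplus>\<^bsub>schur_alg d\<^esub> x = \<zero>\<^bsub>schur_alg d\<^esub>"
      by (intro bexI[of _ "\<lambda>f. - 1 * x f"]) auto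
  qed (auto simp: schur_forms_plus schur_forms_zero add_ac)
  note lin = schur_forms_linear linear_form_convolution
  note closed = convolution_closed[OF assms]
  note tor = torus_form_in_schur_forms[OF assms]
  show "monoid (schur_alg d :: 'k form ring)"
  proof (rule monoidI)
    fix x y z :: "'k form"
    assume "x \<in> carrier (schur_alg d)" "y \<in> carrier (schur_alg d)" "z \<in> carrier (schur_alg d)"
    then have xyz: "x \<in> schur_forms d" "y \<in> schur_forms d" "z \<in> schur_forms d" by simp_all
    show "x \<otimes>\<^bsub>schur_alg d\<^esub> y \<otimes>\<^bsub>schur_alg d\<^esub> z = x \<otimes>\<^bsub>schur_alg d\<^esub> (y \<otimes>\<^bsub>schur_alg d\<^esub> z)"
      unfolding schur_alg_simps
    proof (rule schur_forms_eqI)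
      fix I J assume IJ: "I \<in> words d" "J \<in> words d"
      have "convolution (convolution x y) z (wmon I J)
        = (\<Sum>L\<in>words d. \<Sum>M\<in>words d. x (wmon I M) * y (wmon M L) * z (wmon L J))"
        using xyz IJ by (simp add: convolution_word lin sum_distrib_right)
      also have "\<dots> = (\<Sum>M\<in>words d. \<Sum>L\<in>words d. x (wmon I M) * y (wmon M L) * z (wmon L J))"
        by (rule sum.swap)
      also have "\<dots> = convolution x (convolution y z) (wmon I J)"
        using xyz IJ by (simp add: convolution_word lin sum_distrib_left mult.assoc)
      finally show "convolution (convolution x y) z (wmon I J) = convolution x (convolution y z) (wmon I J)" .
    qed (use xyz closed in auto)
  next
    fix x :: "'k form" assume "x \<in> carrier (schur_alg d)"
    then have x: "x \<in> schur_forms d" by simp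
    have l: "convolution (torus_form d 1 1) x (wmon I J) = x (wmon I J)" if "I \<in> words d" "J \<in> words d" for I J
      using that x by (simp add: convolution_word torus_form_linear torus_form_word if_distrib[of "\<lambda>c. c * _"] sum.delta cong: if_cong)
    have r: "convolution x (torus_form d 1 1) (wmon I J) = x (wmon I J)" if "I \<in> words d" "J \<in> words d" for I J
      using that x by (simp add: convolution_word lin torus_form_word if_distrib[of "\<lambda>c. _ * c"] sum.delta cong: if_cong)
    show "\<one>\<^bsub>schur_alg d\<^esub> \<otimes>\<^bsub>schur_alg d\<^esub> x = x" "x \<otimes>\<^bsub>schur_alg d\<^esub> \<one>\<^bsub>schur_alg d\<^esub> = x"
      unfolding schur_alg_simps
      by (rule schur_forms_eqI[of _ d]; use x l r closed tor in auto)+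
  qed (use closed tor in auto)
  fix x y z :: "'k form"
  assume "x \<in> carrier (schur_alg d)" "y \<in> carrier (schur_alg d)" "z \<in> carrier (schur_alg d)"
  then have xyz: "x \<in> schur_forms d" "y \<in> schur_forms d" "z \<in> schur_forms d" by simp_all
  show "(x \<oplus>\<^bsub>schur_alg d\<^esub> y) \<otimes>\<^bsub>schur_alg d\<^esub> z = x \<otimes>\<^bsub>schur_alg d\<^esub> z \<oplus>\<^bsub>schur_alg d\<^esub> y \<otimes>\<^bsub>schur_alg d\<^esub> z"
    "z \<otimes>\<^bsub>schur_alg d\<^esub> (x \<oplus>\<^bsub>schur_alg d\<^esub> y) = z \<otimes>\<^bsub>schur_alg d\<^esub> x \<oplus>\<^bsub>schur_alg d\<^esub> z \<otimes>\<^bsub>schur_alg d\<^esub> y"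
    unfolding schur_alg_simps convolution_def
    by (simp_all add: algebra_simps sum.distrib)
qed


section \<open>Twisting by the determinant\<close>

text \<open>
  This is the map from \<open>S\<^sub>d\<^sub>+\<^sub>2(G\<^sub>1T)\<close> to \<open>S\<^sub>d(G\<^sub>1T)\<close> dual to multiplication by the
  determinant.
\<close>

definition det_twist :: "'k::field form \<Rightarrow> 'k form" where
  "det_twist \<phi> = (\<lambda>f. \<phi> (det_poly * f))"

lemma comult_det: "comult det_poly = Const det_poly * det_poly"
  unfolding det_poly_def
  by (simp add: comult.hom_minus comult.hom_mult comult_Xvar sum_two Const.hom_minus Const.hom_mult algebra_simps)

lemma det_twist_linear: "linear_form \<phi> \<Longrightarrow> linear_form (det_twist \<phi>)"
  unfolding det_twist_def by (rule linear_form_mult)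

text \<open>
  Because the determinant is group-like.
\<close>

lemma det_twist_convolution:
  assumes "linear_form \<phi>" "linear_form \<psi>"
  shows "det_twist (convolution \<phi> \<psi>) = convolution (det_twist \<phi>) (det_twist \<psi>)"
proof
  fix f
  have "tensor_form \<phi> \<psi> (Const det_poly * (det_poly * F)) = tensor_form (det_twist \<phi>) (det_twist \<psi>) F" for F
  proof -
    have split: "tensor_form \<phi>' \<psi> (Const det_poly * (det_poly * F)) = 
       tensor_form \<phi>' \<psi> (Const det_poly * (Poly_Mapping.single (Poly_Mapping.single (1, 1) 1 + Poly_Mapping.single (2, 2) 1) 1 * F))
     - tensor_form \<phi>' \<psi> (Const det_poly * (Poly_Mapping.single (Poly_Mapping.single (1, 2) 1 + Poly_Mapping.single (2, 1) 1) 1 * F))"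
      if "linear_form \<phi>'" for \<phi>'
      by (subst (2) det_poly_alt) (simp only: left_diff_distrib right_diff_distrib tensor_form_diff[OF that])
    have D: "\<psi> (det_poly * g) = 
        \<psi> (Poly_Mapping.single (Poly_Mapping.single (1, 1) 1 + Poly_Mapping.single (2, 2) 1) 1 * g)
      - \<psi> (Poly_Mapping.single (Poly_Mapping.single (1, 2) 1 + Poly_Mapping.single (2, 1) 1) 1 * g)" for g
      by (simp only: det_poly_alt left_diff_distrib linear_form_diff[OF assms(2)])
    show ?thesis
      unfolding split[OF assms(1)] tensor_form_mult[OF assms(1)]
      unfolding det_twist_def tensor_form_def D by (simp only: right_diff_distrib sum_subtractf)
  qed
  then show "det_twist (convolution \<phi> \<psi>) f = convolution (det_twist \<phi>) (det_twist \<psi>) f"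
    by (simp add: det_twist_def[of "convolution \<phi> \<psi>"] convolution_alt comult.hom_mult comult_det mult.assoc)
qed

text \<open>
  The scalar is the determinant of \<open>diag(t, u)\<close>.
\<close>

lemma det_twist_torus: "det_twist (torus_form (d + 2) t u) = (\<lambda>f. t * u * torus_form d t u f)"
proof -
  interpret ev: comm_ring_hom "eval_at id (diag_mat2 t u)"
    by (rule comm_ring_hom_eval_at) (rule comm_ring_hom_id)
  show ?thesis
    unfolding det_twist_def torus_form_def hom_component_det ev.hom_mult eval_at_det[OF comm_ring_hom_id]
    by (simp add: diag_mat2_def)
qed

lemma coeff_mult_1: "coeff (p * q) 1 = coeff p 0 * coeff q 1 + coeff p 1 * coeff q 0"
  by (simp add: coeff_mult)

text \<open>
  Setting \<open>\<epsilon> = 0\<close> in \<open>1 + \<epsilon> E\<^sub>i\<^sub>j\<close> leaves the unit matrix.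
\<close>

lemma coeff_0_dual_point: "coeff (eval_at (\<lambda>c. [:c:]) (dual_point ij) f) 0 = eval_at id (diag_mat2 1 1) f"
proof -
  interpret ev: comm_ring_hom "eval_at id (diag_mat2 1 1)"
    by (rule comm_ring_hom_eval_at) (rule comm_ring_hom_id)
  interpret ed: comm_ring_hom "eval_at (\<lambda>c. [:c:]) (dual_point ij)"
    by (rule comm_ring_hom_eval_at) (rule comm_ring_hom_pCons)
  have pt: "poly (dual_point ij rs) 0 = (diag_mat2 1 1 rs :: 'a)" for rs
    by (auto simp: diag_mat2_def case_prod_unfold)
  show ?thesis
    unfolding poly_0_coeff_0[symmetric]
  proof (induction f rule: poly_mapping_single_induct)
    case (single m c)
    show ?case
      unfolding eval_at_single[OF comm_ring_hom_id] eval_at_single[OF comm_ring_hom_pCons]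
        poly_mult poly_prod poly_power pt by simp
  next
    case (add f g)
    then show ?case by (simp only: ev.hom_add ed.hom_add poly_add)
  qed
qed

text \<open>
  The product rule, with \<open>det(1 + \<epsilon> E\<^sub>i\<^sub>j) = 1 + \<epsilon> \<delta>\<^sub>i\<^sub>j\<close>.
\<close>

lemma det_twist_lie:
  "det_twist (lie_form (d + 2) (i, j)) = (\<lambda>f. lie_form d (i, j) f + (if i = j then torus_form d 1 1 f else 0))"
proof -
  interpret ed: comm_ring_hom "eval_at (\<lambda>c. [:c:]) (dual_point (i, j))"
    by (rule comm_ring_hom_eval_at) (rule comm_ring_hom_pCons)
  have det: "eval_at (\<lambda>c. [:c:]) (dual_point (i, j)) det_poly = [:1, if i = j then 1 else 0:]"
    unfolding eval_at_det[OF comm_ring_hom_pCons]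
    using two_cases[of i] two_cases[of j] by (auto simp: one_pCons)
  show ?thesis
    unfolding det_twist_def lie_form_def hom_component_det ed.hom_mult det coeff_mult_1
      coeff_0_dual_point torus_form_def
    by (auto simp: fun_eq_iff)
qed

text \<open>
  The monomial \<open>X\<^sub>1\<^sub>1\<^sup>aX\<^sub>1\<^sub>2\<^sup>bX\<^sub>2\<^sub>1\<^sup>cX\<^sub>2\<^sub>2\<^sup>e\<close>.
\<close>

definition mon4 :: "nat \<Rightarrow> nat \<Rightarrow> nat \<Rightarrow> nat \<Rightarrow> pos \<Rightarrow>\<^sub>0 nat" where
  "mon4 a b c e = Poly_Mapping.single (1, 1) a + Poly_Mapping.single (1, 2) b
     + Poly_Mapping.single (2, 1) c + Poly_Mapping.single (2, 2) e"

lemma lookup_mon4 [simp]: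
  "Poly_Mapping.lookup (mon4 a b c e) (1, 1) = a" "Poly_Mapping.lookup (mon4 a b c e) (1, 2) = b"
  "Poly_Mapping.lookup (mon4 a b c e) (2, 1) = c" "Poly_Mapping.lookup (mon4 a b c e) (2, 2) = e"
  by (simp_all add: mon4_def lookup_add lookup_single)

lemma exponent_eqI:
  fixes m n :: "pos \<Rightarrow>\<^sub>0 nat"
  assumes "Poly_Mapping.lookup m (1, 1) = Poly_Mapping.lookup n (1, 1)"
    "Poly_Mapping.lookup m (1, 2) = Poly_Mapping.lookup n (1, 2)"
    "Poly_Mapping.lookup m (2, 1) = Poly_Mapping.lookup n (2, 1)"
    "Poly_Mapping.lookup m (2, 2) = Poly_Mapping.lookup n (2, 2)"
  shows "m = n"
proof (rule poly_mapping_eqI)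
  fix ij :: pos
  obtain i j where "ij = (i, j)" by (cases ij)
  then show "Poly_Mapping.lookup m ij = Poly_Mapping.lookup n ij"
    using two_cases[of i] two_cases[of j] assms by auto
qed

lemma mon4_eta: "m = mon4 (Poly_Mapping.lookup m (1, 1)) (Poly_Mapping.lookup m (1, 2))
    (Poly_Mapping.lookup m (2, 1)) (Poly_Mapping.lookup m (2, 2))"
  by (rule exponent_eqI) simp_all

lemma mon_deg_mon4: "mon_deg (mon4 a b c e) = a + b + c + e"
  by (simp add: mon4_def mon_deg_add mon_deg_single)

lemma reduced_mon4: "reduced p (mon4 a b c e) \<longleftrightarrow> b < p \<and> c < p"
  by (simp add: reduced_def)

lemma det_twist_mon4:
  assumes "linear_form \<phi>"
  shows "det_twist \<phi> (Poly_Mapping.single (mon4 a b c e) 1) =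
    \<phi> (Poly_Mapping.single (mon4 (Suc a) b c (Suc e)) 1) - \<phi> (Poly_Mapping.single (mon4 a (Suc b) (Suc c) e) 1)"
proof -
  have "Poly_Mapping.single (1, 1) 1 + Poly_Mapping.single (2, 2) 1 + mon4 a b c e = mon4 (Suc a) b c (Suc e)"
    "Poly_Mapping.single (1, 2) 1 + Poly_Mapping.single (2, 1) 1 + mon4 a b c e = mon4 a (Suc b) (Suc c) e"
    by (rule exponent_eqI; simp add: lookup_add lookup_single)+
  then show ?thesis
    by (simp only: det_twist_def det_poly_alt left_diff_distrib linear_form_diff[OF assms] mult_single mult_1)
qed

lemma det_twist_in_schur_forms:
  fixes \<phi> :: "'k::field form"
  assumes \<phi>: "\<phi> \<in> schur_forms (d + 2)"
  shows "det_twist \<phi> \<in> schur_forms d"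
  unfolding schur_forms_iff
proof (intro conjI allI impI)
  show "linear_form (det_twist \<phi>)" using \<phi> by (intro det_twist_linear schur_forms_linear)
  fix m assume nz: "det_twist \<phi> (Poly_Mapping.single m 1) \<noteq> 0"
  obtain a b c e where m: "m = mon4 a b c e" using mon4_eta by blast
  let ?m = "mon4 (Suc a) b c (Suc e)" and ?n = "mon4 a (Suc b) (Suc c) e"
  from nz have "\<phi> (Poly_Mapping.single ?m 1) \<noteq> 0 \<or> \<phi> (Poly_Mapping.single ?n 1) \<noteq> 0"
    using \<phi> by (auto simp: m det_twist_mon4 schur_forms_linear)
  then have "reduced CHAR('k) ?m \<and> mon_deg ?m = d + 2 \<or> reduced CHAR('k) ?n \<and> mon_deg ?n = d + 2"
    using \<phi> unfolding schur_forms_iff by blast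
  then show "mon_deg m = d" "reduced CHAR('k) m"
    by (auto simp: m reduced_mon4 mon_deg_mon4)
qed

text \<open>
  A section of \<open>det_twist\<close>. A preimage \<open>\<phi>\<close> of \<open>\<psi>\<close> has to satisfy
  \<open>\<phi>(X\<^sub>1\<^sub>1X\<^sub>2\<^sub>2m) = \<psi>(m) + \<phi>(X\<^sub>1\<^sub>2X\<^sub>2\<^sub>1m)\<close>. Starting from 0 on the monomials not divisible by
  \<open>X\<^sub>1\<^sub>1X\<^sub>2\<^sub>2\<close>, this recursion has the solution below; as it only raises the off-diagonal
  exponents, the solution vanishes on monomials that are not reduced.
\<close>

definition det_lift :: "'k::field form \<Rightarrow> 'k form" where
  "det_lift \<psi> = form_of (\<lambda>m.
     \<Sum>i<min (Poly_Mapping.lookup m (1, 1)) (Poly_Mapping.lookup m (2, 2)).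
       \<psi> (Poly_Mapping.single (mon4 (Poly_Mapping.lookup m (1, 1) - Suc i) (Poly_Mapping.lookup m (1, 2) + i)
            (Poly_Mapping.lookup m (2, 1) + i) (Poly_Mapping.lookup m (2, 2) - Suc i)) 1))"

lemma det_lift_mon4:
  "det_lift \<psi> (Poly_Mapping.single (mon4 a b c e) 1) =
    (\<Sum>i<min a e. \<psi> (Poly_Mapping.single (mon4 (a - Suc i) (b + i) (c + i) (e - Suc i)) 1))"
  by (simp add: det_lift_def)

lemma det_lift_in_schur_forms:
  fixes \<psi> :: "'k::field form"
  assumes "\<psi> \<in> schur_forms d"
  shows "det_lift \<psi> \<in> schur_forms (d + 2)"
  unfolding det_lift_def
proof (rule form_of_in_schur_forms)
  fix m :: "pos \<Rightarrow>\<^sub>0 nat"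
  obtain a b c e where m: "m = mon4 a b c e" using mon4_eta by blast
  assume "(\<Sum>i<min (Poly_Mapping.lookup m (1, 1)) (Poly_Mapping.lookup m (2, 2)).
       \<psi> (Poly_Mapping.single (mon4 (Poly_Mapping.lookup m (1, 1) - Suc i) (Poly_Mapping.lookup m (1, 2) + i)
            (Poly_Mapping.lookup m (2, 1) + i) (Poly_Mapping.lookup m (2, 2) - Suc i)) 1)) \<noteq> 0"
  then obtain i where i: "i < min a e"
    "\<psi> (Poly_Mapping.single (mon4 (a - Suc i) (b + i) (c + i) (e - Suc i)) 1) \<noteq> 0"
    unfolding m lookup_mon4 by (metis (no_types, lifting) lessThan_iff sum.neutral)
  then have "reduced CHAR('k) (mon4 (a - Suc i) (b + i) (c + i) (e - Suc i))"
    "mon_deg (mon4 (a - Suc i) (b + i) (c + i) (e - Suc i)) = d"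
    using assms by (auto simp: schur_forms_iff)
  with i(1) show "reduced CHAR('k) m \<and> mon_deg m = d + 2"
    by (auto simp: m reduced_mon4 mon_deg_mon4)
qed

lemma det_twist_det_lift:
  assumes "linear_form \<psi>"
  shows "det_twist (det_lift \<psi>) = \<psi>"
proof (rule linear_form_eqI)
  have lin: "linear_form (det_lift \<psi>)" unfolding det_lift_def by (rule linear_form_form_of)
  then show "linear_form (det_twist (det_lift \<psi>))" by (rule det_twist_linear)
  fix m :: "pos \<Rightarrow>\<^sub>0 nat"
  obtain a b c e where m: "m = mon4 a b c e" using mon4_eta by blast
  show "det_twist (det_lift \<psi>) (Poly_Mapping.single m 1) = \<psi> (Poly_Mapping.single m 1)"
    unfolding m det_twist_mon4[OF lin] det_lift_mon4
    by (simp add: sum.lessThan_Suc_shift del: sum.lessThan_Suc)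
qed (rule assms)


section \<open>Transfer of blocks along a surjective ring homomorphism\<close>

text \<open>
  The kernel of \<open>\<theta>\<close> is annihilated by the block idempotent \<open>b\<close>, so \<open>\<theta>\<close> maps the block algebra
  \<open>bR\<close> isomorphically onto \<open>\<theta>(b)S\<close>.
\<close>

locale block_transfer =
  fixes R :: "('a, 'm) ring_scheme" and S :: "('b, 'n) ring_scheme"
    and \<theta> :: "'a \<Rightarrow> 'b" and b :: 'a
  assumes R: "ring R" and S: "ring S" and hom: "\<theta> \<in> Ring.ring_hom R S"
    and surj: "\<theta> ` carrier R = carrier S" and block: "is_block R b"
    and kernel: "x \<in> carrier R \<Longrightarrow> \<theta> x = \<zero>\<^bsub>S\<^esub> \<Longrightarrow> b \<otimes>\<^bsub>R\<^esub> x = \<zero>\<^bsub>R\<^esub>"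
begin

interpretation R: ring R by (rule R)
interpretation S: ring S by (rule S)
interpretation hom: ring_hom_ring R S \<theta>
  by (intro ring_hom_ring.intro ring_hom_ring_axioms.intro R S hom)

lemma b_carrier: "b \<in> carrier R"
  and b_idem: "b \<otimes>\<^bsub>R\<^esub> b = b"
  and b_central: "x \<in> carrier R \<Longrightarrow> b \<otimes>\<^bsub>R\<^esub> x = x \<otimes>\<^bsub>R\<^esub> b"
  and b_nonzero: "b \<noteq> \<zero>\<^bsub>R\<^esub>"
  using block unfolding is_block_def central_idempotent_def by blast+

lemma inj_on_block:
  assumes "x \<in> carrier R" "y \<in> carrier R" "b \<otimes>\<^bsub>R\<^esub> x = x" "b \<otimes>\<^bsub>R\<^esub> y = y" "\<theta> x = \<theta> y"
  shows "x = y"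
proof -
  have "\<theta> (x \<ominus>\<^bsub>R\<^esub> y) = \<zero>\<^bsub>S\<^esub>"
    using assms by (simp add: R.minus_eq S.r_neg)
  then have "b \<otimes>\<^bsub>R\<^esub> (x \<ominus>\<^bsub>R\<^esub> y) = \<zero>\<^bsub>R\<^esub>"
    using assms by (intro kernel) simp_all
  then have "x \<ominus>\<^bsub>R\<^esub> y = \<zero>\<^bsub>R\<^esub>"
    using assms b_carrier by (simp add: R.minus_eq R.r_distr R.r_minus)
  moreover have "x = (x \<ominus>\<^bsub>R\<^esub> y) \<oplus>\<^bsub>R\<^esub> y"
    using assms by (simp add: R.minus_eq R.a_assoc R.l_neg)
  ultimately show ?thesis using assms by simp
qed

text \<open>
  The preimage of \<open>c\<close> in \<open>bR\<close> inherits its equations, since both sides of them lie in \<open>bR\<close>,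
  where \<open>\<theta>\<close> is injective.
\<close>

lemma lift_central_idempotent:
  assumes c: "central_idempotent S c" and c': "central_idempotent S c'"
    and orth: "c \<otimes>\<^bsub>S\<^esub> c' = \<zero>\<^bsub>S\<^esub>" and sum: "\<theta> b = c \<oplus>\<^bsub>S\<^esub> c'"
  shows "\<exists>e. central_idempotent R e \<and> b \<otimes>\<^bsub>R\<^esub> e = e \<and> \<theta> e = c"
proof -
  have cc: "c \<in> carrier S" "c' \<in> carrier S" "c \<otimes>\<^bsub>S\<^esub> c = c"
    and central: "\<And>y. y \<in> carrier S \<Longrightarrow> c \<otimes>\<^bsub>S\<^esub> y = y \<otimes>\<^bsub>S\<^esub> c"
    using c c' unfolding central_idempotent_def by blast+
  have c'c: "c' \<otimes>\<^bsub>S\<^esub> c = \<zero>\<^bsub>S\<^esub>"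
    using central[OF cc(2)] orth by simp
  obtain x where x: "x \<in> carrier R" "\<theta> x = c"
    using surj cc(1) by (metis imageE)
  define e where "e = b \<otimes>\<^bsub>R\<^esub> x"
  have e: "e \<in> carrier R" "b \<otimes>\<^bsub>R\<^esub> e = e"
    using x b_carrier by (simp_all add: e_def b_idem flip: R.m_assoc)
  have \<theta>e: "\<theta> e = c"
    using x b_carrier cc c'c by (simp add: e_def sum S.l_distr)
  have "e \<otimes>\<^bsub>R\<^esub> e = e"
    by (rule inj_on_block) (use e b_carrier cc \<theta>e in \<open>simp_all flip: R.m_assoc\<close>)
  moreover have "e \<otimes>\<^bsub>R\<^esub> y = y \<otimes>\<^bsub>R\<^esub> e" if y: "y \<in> carrier R" for y
  proof (rule inj_on_block)
    show "b \<otimes>\<^bsub>R\<^esub> (e \<otimes>\<^bsub>R\<^esub> y) = e \<otimes>\<^bsub>R\<^esub> y"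
      using e y b_carrier by (simp flip: R.m_assoc)
    have "b \<otimes>\<^bsub>R\<^esub> (y \<otimes>\<^bsub>R\<^esub> e) = y \<otimes>\<^bsub>R\<^esub> (b \<otimes>\<^bsub>R\<^esub> e)"
      using e(1) y b_carrier b_central[OF y] by (simp flip: R.m_assoc)
    then show "b \<otimes>\<^bsub>R\<^esub> (y \<otimes>\<^bsub>R\<^esub> e) = y \<otimes>\<^bsub>R\<^esub> e" by (simp add: e(2))
  qed (use e y \<theta>e central[of "\<theta> y"] in simp_all)
  ultimately show ?thesis
    using e \<theta>e unfolding central_idempotent_def by blast
qed

lemma is_block_image: "is_block S (\<theta> b)"
  unfolding is_block_def
proof (intro conjI allI impI)
  show "central_idempotent S (\<theta> b)"
    unfolding central_idempotent_def
  proof (intro conjI ballI)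
    fix y assume "y \<in> carrier S"
    then obtain x where "x \<in> carrier R" "y = \<theta> x" using surj by blast
    then show "\<theta> b \<otimes>\<^bsub>S\<^esub> y = y \<otimes>\<^bsub>S\<^esub> \<theta> b"
      using b_carrier b_central[of x] hom.hom_mult[of b x] hom.hom_mult[of x b] by simp
  qed (use b_carrier b_idem in \<open>simp_all flip: hom.hom_mult\<close>)
  show "\<theta> b \<noteq> \<zero>\<^bsub>S\<^esub>"
    using kernel[OF b_carrier] b_idem b_nonzero by auto
  fix c c'
  assume c: "central_idempotent S c" and c': "central_idempotent S c'"
    and orth: "c \<otimes>\<^bsub>S\<^esub> c' = \<zero>\<^bsub>S\<^esub>" and sum: "\<theta> b = c \<oplus>\<^bsub>S\<^esub> c'"
  have carrS: "c \<in> carrier S" "c' \<in> carrier S"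
    and "c \<otimes>\<^bsub>S\<^esub> c' = c' \<otimes>\<^bsub>S\<^esub> c"
    using c c' unfolding central_idempotent_def by blast+
  with orth have orth': "c' \<otimes>\<^bsub>S\<^esub> c = \<zero>\<^bsub>S\<^esub>" by simp
  obtain e where e: "central_idempotent R e" "b \<otimes>\<^bsub>R\<^esub> e = e" "\<theta> e = c"
    using lift_central_idempotent[OF c c' orth sum] by blast
  obtain e' where e': "central_idempotent R e'" "b \<otimes>\<^bsub>R\<^esub> e' = e'" "\<theta> e' = c'"
    using lift_central_idempotent[OF c' c orth'] sum S.a_comm[OF carrS] by auto
  have carr: "e \<in> carrier R" "e' \<in> carrier R"
    using e(1) e'(1) unfolding central_idempotent_def by blast+
  have "e \<otimes>\<^bsub>R\<^esub> e' = \<zero>\<^bsub>R\<^esub>"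
    by (rule inj_on_block) (use carr e(2,3) e'(2,3) orth b_carrier in \<open>simp_all flip: R.m_assoc\<close>)
  moreover have "b = e \<oplus>\<^bsub>R\<^esub> e'"
    by (rule inj_on_block) (use carr e(2,3) e'(2,3) sum b_carrier b_idem in \<open>simp_all add: R.r_distr\<close>)
  ultimately have "e = \<zero>\<^bsub>R\<^esub> \<or> e' = \<zero>\<^bsub>R\<^esub>"
    using block e(1) e'(1) unfolding is_block_def by blast
  then show "c = \<zero>\<^bsub>S\<^esub> \<or> c' = \<zero>\<^bsub>S\<^esub>"
    using e(3) e'(3) hom.hom_zero by auto
qed

lemma ideal_image:
  assumes "ideal I R"
  shows "ideal (\<theta> ` I) S"
proof -
  interpret I: ideal I R by (rule assms)
  note I_carr = I.a_subset
  show ?thesis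
  proof (rule idealI)
    show "subgroup (\<theta> ` I) (add_monoid S)"
    proof (rule S.add.subgroupI)
      show "\<theta> ` I \<noteq> {}" using I.zero_closed by blast
      show "\<theta> ` I \<subseteq> carrier S" using I_carr hom.hom_closed by blast
      fix a assume "a \<in> \<theta> ` I"
      then obtain x where x: "x \<in> I" "a = \<theta> x" by blast
      then have "x \<in> carrier R" using I_carr by blast
      then have "\<ominus>\<^bsub>S\<^esub> a = \<theta> (\<ominus>\<^bsub>R\<^esub> x)"
        using x by simp
      then show "\<ominus>\<^bsub>S\<^esub> a \<in> \<theta> ` I" using x I.a_inv_closed by blast
    next
      fix a a' assume "a \<in> \<theta> ` I" "a' \<in> \<theta> ` I"
      then obtain x x' where x: "x \<in> I" "a = \<theta> x" "x' \<in> I" "a' = \<theta> x'" by blast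
      moreover have "x \<in> carrier R" "x' \<in> carrier R" using x I_carr by blast+
      ultimately have "a \<oplus>\<^bsub>S\<^esub> a' = \<theta> (x \<oplus>\<^bsub>R\<^esub> x')" by simp
      then show "a \<oplus>\<^bsub>S\<^esub> a' \<in> \<theta> ` I" using x I.a_closed by blast
    qed
  next
    fix a y assume "a \<in> \<theta> ` I" "y \<in> carrier S"
    then obtain x z where x: "x \<in> I" "a = \<theta> x" "z \<in> carrier R" "y = \<theta> z"
      using surj by blast
    moreover have "x \<in> carrier R" using x I_carr by blast
    ultimately have "y \<otimes>\<^bsub>S\<^esub> a = \<theta> (z \<otimes>\<^bsub>R\<^esub> x)" "a \<otimes>\<^bsub>S\<^esub> y = \<theta> (x \<otimes>\<^bsub>R\<^esub> z)" by simp_all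
    then show "y \<otimes>\<^bsub>S\<^esub> a \<in> \<theta> ` I" "a \<otimes>\<^bsub>S\<^esub> y \<in> \<theta> ` I"
      using x I.I_l_closed I.I_r_closed by blast+
  qed (rule S)
qed

lemma simple_block_reflect:
  assumes "simple_block S (\<theta> b)"
  shows "simple_block R b"
  unfolding simple_block_def
proof (intro conjI allI impI)
  fix I assume I: "ideal I R" "I \<subseteq> block_ideal R b"
  interpret I: ideal I R by (rule I(1))
  have fixed: "x \<in> carrier R \<and> b \<otimes>\<^bsub>R\<^esub> x = x" if "x \<in> I" for x
  proof -
    from that I(2) obtain y where y: "y \<in> carrier R" "x = y \<otimes>\<^bsub>R\<^esub> b"
      unfolding block_ideal_def by blast
    then have "x = b \<otimes>\<^bsub>R\<^esub> y" by (simp add: b_central)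
    with y(1) b_carrier show ?thesis by (simp add: b_idem flip: R.m_assoc)
  qed
  have "\<theta> ` I \<subseteq> block_ideal S (\<theta> b)"
  proof
    fix a assume "a \<in> \<theta> ` I"
    then obtain y where "y \<in> carrier R" "a = \<theta> (y \<otimes>\<^bsub>R\<^esub> b)"
      using I(2) unfolding block_ideal_def by blast
    then show "a \<in> block_ideal S (\<theta> b)"
      using b_carrier unfolding block_ideal_def by auto
  qed
  with assms ideal_image[OF I(1)] have "\<theta> ` I = {\<zero>\<^bsub>S\<^esub>} \<or> \<theta> ` I = block_ideal S (\<theta> b)"
    unfolding simple_block_def by blast
  then show "I = {\<zero>\<^bsub>R\<^esub>} \<or> I = block_ideal R b"
  proof
    assume z: "\<theta> ` I = {\<zero>\<^bsub>S\<^esub>}"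
    have "x = \<zero>\<^bsub>R\<^esub>" if "x \<in> I" for x
      using fixed[OF that] kernel[of x] z that by auto
    with I.zero_closed have "I = {\<zero>\<^bsub>R\<^esub>}" by blast
    then show ?thesis ..
  next
    assume all: "\<theta> ` I = block_ideal S (\<theta> b)"
    have "\<theta> b = \<theta> b \<otimes>\<^bsub>S\<^esub> \<theta> b" using b_carrier b_idem by (simp flip: hom.hom_mult)
    then have "\<theta> b \<in> \<theta> ` I"
      unfolding all block_ideal_def using b_carrier hom.hom_closed by blast
    then obtain x where "x \<in> I" "\<theta> x = \<theta> b" by force
    then have "x = b"
      using inj_on_block[of x b] fixed[of x] b_carrier b_idem by simp
    with \<open>x \<in> I\<close> have "b \<in> I" by simp
    then have "block_ideal R b \<subseteq> I"
      unfolding block_ideal_def using I.I_l_closed by blast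
    with I(2) show ?thesis by blast
  qed
qed (rule block)

end


section \<open>Transfer of modules along the determinant twist\<close>

lemma det_twist_ring_hom:
  assumes "prime CHAR('k)"
  shows "det_twist \<in> Ring.ring_hom (schur_alg (d + 2)) (schur_alg d :: 'k::field form ring)"
proof (rule ring_hom_memI)
  show "det_twist \<one>\<^bsub>schur_alg (d + 2)\<^esub> = (\<one>\<^bsub>schur_alg d\<^esub> :: 'k form)"
    unfolding schur_alg_simps det_twist_torus by simp
  fix x y :: "'k form"
  assume x: "x \<in> carrier (schur_alg (d + 2))"
  then show "det_twist x \<in> carrier (schur_alg d)"
    unfolding schur_alg_simps by (rule det_twist_in_schur_forms)
  assume y: "y \<in> carrier (schur_alg (d + 2))"
  show "det_twist (x \<otimes>\<^bsub>schur_alg (d + 2)\<^esub> y) = det_twist x \<otimes>\<^bsub>schur_alg d\<^esub> det_twist y"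
    using x y unfolding schur_alg_simps by (intro det_twist_convolution schur_forms_linear)
qed (simp add: det_twist_def[abs_def])

lemma det_twist_surj: "det_twist ` schur_forms (d + 2) = schur_forms d"
proof (intro equalityI subsetI)
  fix \<psi> :: "'a form" assume "\<psi> \<in> schur_forms d"
  then show "\<psi> \<in> det_twist ` schur_forms (d + 2)"
    by (intro image_eqI[of _ _ "det_lift \<psi>"])
       (simp_all only: det_twist_det_lift schur_forms_linear det_lift_in_schur_forms)
qed (use det_twist_in_schur_forms in blast)

lemma G1T_module_cong:
  fixes \<rho> \<rho>' :: "'k::field form \<Rightarrow> 'k mat"
  assumes "prime CHAR('k)" "\<And>\<phi>. \<phi> \<in> schur_forms d \<Longrightarrow> \<rho> \<phi> = \<rho>' \<phi>"
  shows "G1T_module d n \<rho> = G1T_module d n \<rho>'"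
  using assms by (simp add: G1T_module_def torus_form_in_schur_forms lie_form_in_schur_forms)

lemma schur_module_det_twist:
  assumes "schur_module d n \<rho>"
  shows "schur_module (d + 2) n (\<rho> \<circ> det_twist)"
proof -
  have plus: "det_twist (\<lambda>f. \<phi> f + \<psi> f) = (\<lambda>f. det_twist \<phi> f + det_twist \<psi> f)"
    and scale: "det_twist (\<lambda>f. c * \<phi> f) = (\<lambda>f. c * det_twist \<phi> f)" for \<phi> \<psi> :: "'a form" and c
    by (simp_all add: det_twist_def)
  have one: "det_twist (torus_form (d + 2) 1 1) = (torus_form d 1 1 :: 'a form)"
    unfolding det_twist_torus by simp
  show ?thesis
    using assms unfolding schur_module_def
    by (simp add: plus scale one det_twist_in_schur_forms det_twist_convolution schur_forms_linear
        del: add_2_eq_Suc')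
qed

lemma smult_mat_mult_vec:
  fixes A :: "'a::comm_ring_1 mat"
  assumes "A \<in> carrier_mat n n" "v \<in> carrier_vec n"
  shows "(a \<cdot>\<^sub>m A) *\<^sub>v v = a \<cdot>\<^sub>v (A *\<^sub>v v)"
proof (rule eq_vecI)
  fix i assume "i < dim_vec (a \<cdot>\<^sub>v (A *\<^sub>v v))"
  then have i: "i < dim_row A" by simp
  then have "row A i \<in> carrier_vec n" using assms by auto
  with i show "((a \<cdot>\<^sub>m A) *\<^sub>v v) $ i = (a \<cdot>\<^sub>v (A *\<^sub>v v)) $ i"
    using assms by simp
qed simp

text \<open>
  The determinant multiplies the action of \<open>diag(t, u)\<close> by \<open>tu\<close>, which moves all weights by
  \<open>(1, 1)\<close>; it adds 1 to the actions of \<open>E\<^sub>1\<^sub>1\<close> and \<open>E\<^sub>2\<^sub>2\<close>, which cancels in \<open>h\<close>.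
\<close>

lemma G1T_module_det_twist:
  fixes \<rho> :: "'k::field form \<Rightarrow> 'k mat"
  assumes p: "prime CHAR('k)" and \<rho>: "schur_module d n \<rho>"
  shows "G1T_module (d + 2) n (\<rho> \<circ> det_twist) = shift (1, 1) (G1T_module d n \<rho>)"
proof -
  have carr: "\<rho> \<phi> \<in> carrier_mat n n" if "\<phi> \<in> schur_forms d" for \<phi>
    using \<rho> that by (simp add: schur_module_def)
  have tor: "\<rho> (det_twist (torus_form (d + 2) t u)) = (t * u) \<cdot>\<^sub>m \<rho> (torus_form d t u)" for t u
    using \<rho> torus_form_in_schur_forms[OF p] unfolding schur_module_def det_twist_torus by blast
  have lie: "\<rho> (det_twist (lie_form (d + 2) (i, j))) =
      (if i = j then \<rho> (lie_form d (i, j)) + 1\<^sub>m n else \<rho> (lie_form d (i, j)))" for i j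
  proof (cases "i = j")
    case True
    have "\<rho> (\<lambda>f. lie_form d (i, j) f + torus_form d 1 1 f) = \<rho> (lie_form d (i, j)) + 1\<^sub>m n"
      using \<rho> torus_form_in_schur_forms[OF p] lie_form_in_schur_forms[OF p]
      unfolding schur_module_def by metis
    with True show ?thesis unfolding det_twist_lie by simp
  qed (unfold det_twist_lie, simp)
  have "(\<rho> (det_twist (torus_form (d + 2) t u)) *\<^sub>v v = (t powi i * u powi j) \<cdot>\<^sub>v v) \<longleftrightarrow>
      (\<rho> (torus_form d t u) *\<^sub>v v = (t powi (i - 1) * u powi (j - 1)) \<cdot>\<^sub>v v)"
    if "v \<in> carrier_vec n" "t \<noteq> 0" "u \<noteq> 0" for v t u i j
  proof -
    have "t powi i * u powi j = (t * u) * (t powi (i - 1) * u powi (j - 1))"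
      using that by (simp add: power_int_diff field_simps)
    then have "(t powi i * u powi j) \<cdot>\<^sub>v v = (t * u) \<cdot>\<^sub>v ((t powi (i - 1) * u powi (j - 1)) \<cdot>\<^sub>v v)"
      by (simp add: smult_smult_assoc)
    moreover have "\<rho> (det_twist (torus_form (d + 2) t u)) *\<^sub>v v = (t * u) \<cdot>\<^sub>v (\<rho> (torus_form d t u) *\<^sub>v v)"
      unfolding tor using that(1) carr[OF torus_form_in_schur_forms[OF p]] by (rule smult_mat_mult_vec[rotated])
    moreover have "a \<cdot>\<^sub>v x = a \<cdot>\<^sub>v y \<longleftrightarrow> x = y" if "a \<noteq> 0" for a :: 'k and x y
      using that by (metis left_inverse one_smult_vec smult_smult_assoc)
    ultimately show ?thesis using that by simp
  qed
  moreover have "\<rho> (lie_form d (1, 1)) + 1\<^sub>m n - (\<rho> (lie_form d (2, 2)) + 1\<^sub>m n)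
      = \<rho> (lie_form d (1, 1)) - \<rho> (lie_form d (2, 2))"
    using carr[OF lie_form_in_schur_forms[OF p, of d "(1, 1)"]]
      carr[OF lie_form_in_schur_forms[OF p, of d "(2, 2)"]] by (intro eq_matI) auto
  ultimately show ?thesis
    by (auto simp: G1T_module_def shift_def lie fun_eq_iff simp del: add_2_eq_Suc')
qed

text \<open>
  On a module belonging to \<open>b\<close> every \<open>\<kappa>\<close> acts as \<open>b \<kappa>\<close>. So the kernel of \<open>det_twist\<close> acts as
  zero, and the module is a pullback.
\<close>

lemma block_modules_det_twist:
  fixes b :: "'k::field form"
  assumes p: "prime CHAR('k)" and b: "b \<in> schur_forms (d + 2)"
    and kernel: "\<And>\<kappa>. \<kappa> \<in> schur_forms (d + 2) \<Longrightarrow> det_twist \<kappa> = (\<lambda>f. 0) \<Longrightarrow> convolution b \<kappa> = (\<lambda>f. 0)"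
  shows "shift (1, 1) ` block_modules d (det_twist b) = block_modules (d + 2) b"
proof (intro equalityI subsetI)
  fix N assume "N \<in> shift (1, 1) ` block_modules d (det_twist b)"
  then obtain n \<rho> where "N = shift (1, 1) (G1T_module d n \<rho>)" "schur_module d n \<rho>" "\<rho> (det_twist b) = 1\<^sub>m n"
    unfolding block_modules_def by blast
  then have "N = G1T_module (d + 2) n (\<rho> \<circ> det_twist)" "schur_module (d + 2) n (\<rho> \<circ> det_twist)"
    "(\<rho> \<circ> det_twist) b = 1\<^sub>m n"
    using G1T_module_det_twist[OF p] schur_module_det_twist by auto
  then show "N \<in> block_modules (d + 2) b"
    unfolding block_modules_def by blast
next
  fix N assume "N \<in> block_modules (d + 2) b"
  then obtain n \<rho> where N: "N = G1T_module (d + 2) n \<rho>" and \<rho>: "schur_module (d + 2) n \<rho>" and \<rho>b: "\<rho> b = 1\<^sub>m n"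
    unfolding block_modules_def by blast
  from \<rho> have carr: "\<And>\<phi>. \<phi> \<in> schur_forms (d + 2) \<Longrightarrow> \<rho> \<phi> \<in> carrier_mat n n"
    and plus: "\<And>\<phi> \<psi>. \<phi> \<in> schur_forms (d + 2) \<Longrightarrow> \<psi> \<in> schur_forms (d + 2) \<Longrightarrow> \<rho> (\<lambda>f. \<phi> f + \<psi> f) = \<rho> \<phi> + \<rho> \<psi>"
    and scale: "\<And>c \<phi>. \<phi> \<in> schur_forms (d + 2) \<Longrightarrow> \<rho> (\<lambda>f. c * \<phi> f) = c \<cdot>\<^sub>m \<rho> \<phi>"
    and conv: "\<And>\<phi> \<psi>. \<phi> \<in> schur_forms (d + 2) \<Longrightarrow> \<psi> \<in> schur_forms (d + 2) \<Longrightarrow> \<rho> (convolution \<phi> \<psi>) = \<rho> \<phi> * \<rho> \<psi>"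
    and one: "\<rho> (torus_form (d + 2) 1 1) = 1\<^sub>m n"
    unfolding schur_module_def by blast+
  have factor: "\<rho> \<phi> = \<rho> \<psi>"
    if \<phi>: "\<phi> \<in> schur_forms (d + 2)" and \<psi>: "\<psi> \<in> schur_forms (d + 2)" and eq: "det_twist \<phi> = det_twist \<psi>" for \<phi> \<psi>
  proof -
    define \<kappa> where "\<kappa> = (\<lambda>f. \<phi> f + (- 1 * \<psi> f))"
    have \<psi>': "(\<lambda>f. - 1 * \<psi> f) \<in> schur_forms (d + 2)" by (rule schur_forms_times[OF \<psi>])
    have \<kappa>: "\<kappa> \<in> schur_forms (d + 2)"
      unfolding \<kappa>_def by (rule schur_forms_plus[OF \<phi> \<psi>'])
    have "det_twist \<kappa> = (\<lambda>f. 0)"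
      using fun_cong[OF eq] by (auto simp: \<kappa>_def det_twist_def)
    from kernel[OF \<kappa> this] have "\<rho> (\<lambda>f. 0) = \<rho> b * \<rho> \<kappa>" using conv[OF b \<kappa>] by simp
    also have "\<dots> = \<rho> \<kappa>" using carr[OF \<kappa>] by (simp add: \<rho>b)
    also have "\<dots> = \<rho> \<phi> + (- 1) \<cdot>\<^sub>m \<rho> \<psi>"
      unfolding \<kappa>_def using plus[OF \<phi> \<psi>'] scale[OF \<psi>, of "- 1"] by simp
    finally have *: "\<rho> \<phi> + (- 1) \<cdot>\<^sub>m \<rho> \<psi> = 0 \<cdot>\<^sub>m \<rho> \<phi>"
      using scale[OF \<phi>, of 0] by simp
    show ?thesis
    proof (rule eq_matI)
      fix i j assume "i < dim_row (\<rho> \<psi>)" "j < dim_col (\<rho> \<psi>)"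
      then show "\<rho> \<phi> $$ (i, j) = \<rho> \<psi> $$ (i, j)"
        using arg_cong[OF *, of "\<lambda>A. A $$ (i, j)"] carr[OF \<phi>] carr[OF \<psi>] by simp
    qed (use carr[OF \<phi>] carr[OF \<psi>] in auto)
  qed
  define \<rho>' where "\<rho>' = \<rho> \<circ> det_lift"
  have lift: "det_lift \<phi> \<in> schur_forms (d + 2)" "det_twist (det_lift \<phi>) = \<phi>" if "\<phi> \<in> schur_forms d" for \<phi> :: "'k form"
    using that by (simp_all only: det_lift_in_schur_forms det_twist_det_lift schur_forms_linear)
  have \<rho>': "\<rho>' (det_twist \<phi>) = \<rho> \<phi>" if "\<phi> \<in> schur_forms (d + 2)" for \<phi>
    unfolding \<rho>'_def comp_def
    by (rule factor) (use that lift[OF det_twist_in_schur_forms] in simp_all)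
  have "schur_module d n \<rho>'"
    unfolding schur_module_def
  proof (intro conjI ballI allI)
    fix \<phi> \<psi> :: "'k form" and c assume "\<phi> \<in> schur_forms d" "\<psi> \<in> schur_forms d"
    then obtain x y where x: "x \<in> schur_forms (d + 2)" "\<phi> = det_twist x"
      and y: "y \<in> schur_forms (d + 2)" "\<psi> = det_twist y"
      using det_twist_surj by blast
    have "(\<lambda>f. \<phi> f + \<psi> f) = det_twist (\<lambda>f. x f + y f)"
      by (simp add: x y det_twist_def)
    then show "\<rho>' (\<lambda>f. \<phi> f + \<psi> f) = \<rho>' \<phi> + \<rho>' \<psi>"
      using x y by (simp only: \<rho>' plus schur_forms_plus)
    have "convolution \<phi> \<psi> = det_twist (convolution x y)"
      by (simp add: x(2) y(2) det_twist_convolution schur_forms_linear[OF x(1)] schur_forms_linear[OF y(1)])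
    then show "\<rho>' (convolution \<phi> \<psi>) = \<rho>' \<phi> * \<rho>' \<psi>"
      using x y by (simp only: \<rho>' conv convolution_closed[OF p])
  next
    fix \<phi> :: "'k form" and c assume "\<phi> \<in> schur_forms d"
    then obtain x where x: "x \<in> schur_forms (d + 2)" "\<phi> = det_twist x"
      using det_twist_surj by blast
    then show "\<rho>' \<phi> \<in> carrier_mat n n" by (simp only: \<rho>' carr)
    have "(\<lambda>f. c * \<phi> f) = det_twist (\<lambda>f. c * x f)"
      by (simp add: x det_twist_def)
    then show "\<rho>' (\<lambda>f. c * \<phi> f) = c \<cdot>\<^sub>m \<rho>' \<phi>"
      using x by (simp only: \<rho>' scale schur_forms_times)
  next
    have "torus_form d 1 1 = (det_twist (torus_form (d + 2) 1 1) :: 'k form)"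
      unfolding det_twist_torus by simp
    then show "\<rho>' (torus_form d 1 1) = 1\<^sub>m n"
      by (simp only: \<rho>' one torus_form_in_schur_forms[OF p])
  qed
  moreover have "\<rho>' (det_twist b) = 1\<^sub>m n" by (simp only: \<rho>' b \<rho>b)
  moreover have "N = shift (1, 1) (G1T_module d n \<rho>')"
    unfolding N G1T_module_det_twist[OF p \<open>schur_module d n \<rho>'\<close>, symmetric]
    by (rule G1T_module_cong[OF p]) (simp only: comp_def \<rho>')
  ultimately show "N \<in> shift (1, 1) ` block_modules d (det_twist b)"
    unfolding block_modules_def by blast
qed

lemma shift_shift: "shift \<nu> (shift \<nu>' M) = shift (fst \<nu> + fst \<nu>', snd \<nu> + snd \<nu>') M"
  by (simp add: shift_def algebra_simps)

text \<open>
  A shift only renames the weights, so the homomorphisms are the same matrices before and after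
  it, and equality of the object classes is enough.
\<close>

lemma shift_equivalence_image:
  fixes C :: "'k::field graded_module set"
  assumes "\<And>M. M \<in> C \<Longrightarrow> act_e M \<in> carrier_mat (gdim M) (gdim M) \<and> act_f M \<in> carrier_mat (gdim M) (gdim M)
      \<and> act_h M \<in> carrier_mat (gdim M) (gdim M) \<and> (\<forall>\<mu>. gcomp M \<mu> \<subseteq> carrier_vec (gdim M))"
  shows "shift_equivalence \<nu> C (shift \<nu> ` C)"
  unfolding shift_equivalence_def
proof (intro conjI ballI)
  fix M N :: "'k graded_module"
  have "(\<forall>\<mu>. \<forall>v\<in>gcomp M \<mu>. P *\<^sub>v v \<in> gcomp N \<mu>) \<longleftrightarrow>
     (\<forall>\<mu>. \<forall>v\<in>gcomp (shift \<nu> M) \<mu>. P *\<^sub>v v \<in> gcomp (shift \<nu> N) \<mu>)" (is "?l \<longleftrightarrow> ?r") for P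
  proof
    assume r: ?r
    show ?l
    proof
      fix \<mu>
      show "\<forall>v\<in>gcomp M \<mu>. P *\<^sub>v v \<in> gcomp N \<mu>"
        using r[rule_format, of _ "(fst \<mu> + fst \<nu>, snd \<mu> + snd \<nu>)"] by (simp add: shift_def)
    qed
  qed (simp add: shift_def)
  then have "graded_hom (shift \<nu> M) (shift \<nu> N) = graded_hom M N"
    by (simp add: graded_hom_def) (simp add: shift_def)
  then show "bij_betw (\<lambda>P. P) (graded_hom M N) (graded_hom (shift \<nu> M) (shift \<nu> N))"
    by (simp add: bij_betw_def)
next
  fix N assume "N \<in> shift \<nu> ` C"
  then obtain M where M: "M \<in> C" "N = shift \<nu> M" by blast
  have *: "1\<^sub>m (gdim M) *\<^sub>v v = v" if "v \<in> gcomp M \<mu>" for v \<mu>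
  proof -
    have "v \<in> carrier_vec (gdim M)" using assms[OF M(1)] that by blast
    then show ?thesis by simp
  qed
  have E: "act_e M \<in> carrier_mat (gdim M) (gdim M)" and F: "act_f M \<in> carrier_mat (gdim M) (gdim M)"
    and H: "act_h M \<in> carrier_mat (gdim M) (gdim M)"
    using assms[OF M(1)] by blast+
  have "1\<^sub>m (gdim M) \<in> graded_hom (shift \<nu> M) (shift \<nu> M)"
    using * by (simp add: graded_hom_def shift_def left_mult_one_mat[OF E] right_mult_one_mat[OF E]
        left_mult_one_mat[OF F] right_mult_one_mat[OF F] left_mult_one_mat[OF H] right_mult_one_mat[OF H])
  then have "graded_iso (shift \<nu> M) N"
    unfolding graded_iso_def M(2) by (intro bexI[of _ "1\<^sub>m (gdim M)"]) (simp_all add: shift_def)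
  then show "\<exists>M\<in>C. graded_iso (shift \<nu> M) N" using M(1) by blast
qed auto

lemma is_shift_of_block_if_image:
  fixes b :: "'k::field form"
  assumes "prime CHAR('k)" "shift \<nu> ` block_modules d' b' = block_modules d b"
  shows "is_shift_of_block d b d' b'"
  unfolding is_shift_of_block_def assms(2)[symmetric]
proof (rule exI[of _ \<nu>], rule shift_equivalence_image)
  fix M assume "M \<in> block_modules d' b'"
  then obtain n \<rho> where "M = G1T_module d' n \<rho>" "schur_module d' n \<rho>"
    unfolding block_modules_def by blast
  then show "act_e M \<in> carrier_mat (gdim M) (gdim M) \<and> act_f M \<in> carrier_mat (gdim M) (gdim M)
      \<and> act_h M \<in> carrier_mat (gdim M) (gdim M) \<and> (\<forall>\<mu>. gcomp M \<mu> \<subseteq> carrier_vec (gdim M))"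
    using lie_form_in_schur_forms[OF assms(1)]
    by (auto simp: G1T_module_def schur_module_def intro!: minus_carrier_mat)
qed


section \<open>The module V(d) in tensor space\<close>

lemma letter_cases: "r \<noteq> s \<Longrightarrow> (l :: 2) = r \<or> l = s"
  using two_cases[of r] two_cases[of s] two_cases[of l] by auto

lemma sum_letters: "(r :: 2) \<noteq> s \<Longrightarrow> (\<Sum>l\<in>UNIV. f l) = f r + f s"
  using two_cases[of r] two_cases[of s] by (auto simp: sum_two add.commute)

text \<open>
  A generating function for words: going through \<open>I\<close> letter by letter, the variable of the
  polynomial marks the positions where \<open>J\<close> has the letter \<open>r\<close>.
\<close>

lemma word_sum_coeff:
  fixes \<iota> :: "'k::comm_ring_1 \<Rightarrow> 'r::comm_ring_1"
  assumes hom: "comm_ring_hom \<iota>" and "r \<noteq> s"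
  shows "(\<Sum>J | J \<in> words (length I) \<and> count_list J r = i. eval_at \<iota> x (wmon I J))
    = coeff (\<Prod>l\<leftarrow>I. [:x (l, s), x (l, r):]) i"
proof -
  have "(\<Sum>J\<in>words (length I). if count_list J r = i then eval_at \<iota> x (wmon I J) else 0)
    = coeff (\<Prod>l\<leftarrow>I. [:x (l, s), x (l, r):]) i" for i
  proof (induction I arbitrary: i)
    case Nil
    show ?case
      by (cases i) (simp_all add: eval_at_wmon_Nil[OF hom, simplified])
  next
    case (Cons l I)
    let ?S = "\<lambda>i. \<Sum>J\<in>words (length I). if count_list J r = i then eval_at \<iota> x (wmon I J) else 0"
    let ?c = "\<lambda>i. coeff (\<Prod>l\<leftarrow>I. [:x (l, s), x (l, r):]) i"
    have "(\<Sum>J\<in>words (length (l # I)). if count_list J r = i then eval_at \<iota> x (wmon (l # I) J) else 0)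
      = (\<Sum>J\<in>words (length I). if Suc (count_list J r) = i then x (l, r) * eval_at \<iota> x (wmon I J) else 0)
      + (\<Sum>J\<in>words (length I). if count_list J r = i then x (l, s) * eval_at \<iota> x (wmon I J) else 0)"
      using \<open>r \<noteq> s\<close>
      by (simp add: sum_words_Suc sum_letters[OF \<open>r \<noteq> s\<close>] eval_at_wmon_Cons[OF hom]
          del: wexp_simps(2) cong: if_cong)
    also have "\<dots> = (case i of 0 \<Rightarrow> 0 | Suc k \<Rightarrow> x (l, r) * ?S k) + x (l, s) * ?S i"
      by (cases i) (auto simp: sum_distrib_left intro!: arg_cong2[of _ _ _ _ "(+)"] sum.cong)
    also have "\<dots> = (case i of 0 \<Rightarrow> 0 | Suc k \<Rightarrow> x (l, r) * ?c k) + x (l, s) * ?c i"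
      by (simp only: Cons.IH)
    also have "\<dots> = coeff (\<Prod>l\<leftarrow>l # I. [:x (l, s), x (l, r):]) i"
      by (cases i) simp_all
    finally show ?case .
  qed
  from this[of i] show ?thesis by (simp add: sum.inter_filter)
qed

lemma prod_list_word:
  fixes F :: "2 \<Rightarrow> 'r::comm_monoid_mult"
  assumes "r \<noteq> s"
  shows "(\<Prod>l\<leftarrow>I. F l) = F r ^ count_list I r * F s ^ count_list I s"
  using assms
proof (induction I)
  case (Cons l I)
  then show ?case using letter_cases[OF assms, of l] by (auto simp: mult_ac)
qed simp

lemma count_list_letters: "r \<noteq> s \<Longrightarrow> count_list I r + count_list I (s :: 2) = length I"
  using count_list_two[of I] two_cases[of r] two_cases[of s] by auto

lemma eval_at_Const_Xvar: "length I = length J \<Longrightarrow> eval_at Const Xvar (wmon I J) = wmon I J"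
proof (induction I J rule: list_induct2)
  case Nil
  show ?case by (simp only: eval_at_wmon_Nil[OF comm_ring_hom_Const]) simp
next
  case (Cons i I j J)
  show ?case
    unfolding eval_at_wmon_Cons[OF comm_ring_hom_Const] Cons.IH by (simp add: Xvar_def mult_single)
qed

text \<open>
  In the type of letters, which is \<open>\<int>/2\<close>, the letter other than \<open>r\<close> is \<open>r + 1\<close>.
\<close>

definition std_word :: "2 \<Rightarrow> nat \<Rightarrow> nat \<Rightarrow> 2 list" where
  "std_word r d n = replicate n r @ replicate (d - n) (r + 1)"

text \<open>
  The sums \<open>v\<^sub>i\<close> of all words with \<open>i\<close> occurrences of \<open>r\<close> span a submodule of tensor space, and
  this is the coefficient of \<open>v\<^sub>n\<close> in \<open>\<phi> v\<^sub>i\<close>, read off at one particular word. For \<open>r = 1\<close> the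
  module is \<open>V(d)\<close> with its standard basis; for \<open>r = 2\<close> the basis is reversed, so that what is
  proved near \<open>v\<^sub>0\<close> also holds near the other end.
\<close>

definition weyl :: "nat \<Rightarrow> 2 \<Rightarrow> 'k::field form \<Rightarrow> nat \<Rightarrow> nat \<Rightarrow> 'k" where
  "weyl d r \<phi> n i = (\<Sum>J | J \<in> words d \<and> count_list J r = i. \<phi> (wmon (std_word r d n) J))"

lemma std_word_in_words: "n \<le> d \<Longrightarrow> std_word r d n \<in> words d"
  by (simp add: std_word_def words_def)

lemma count_list_replicate: "count_list (replicate n x) y = (if x = y then n else 0)"
  by (induction n) auto

lemma count_list_std_word: "n \<le> d \<Longrightarrow> count_list (std_word r d n) r = n"
  by (simp add: std_word_def count_list_replicate)

lemma count_list_le: "I \<in> words d \<Longrightarrow> count_list I r \<le> d"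
  using count_le_length[of I r] by (simp add: words_def)

text \<open>
  The coefficient does not depend on the word at which it is read off, because the generating
  function is a product over the letters of \<open>I\<close> in any order.
\<close>

lemma weyl_word:
  assumes "linear_form \<phi>" "I \<in> words d"
  shows "(\<Sum>J | J \<in> words d \<and> count_list J r = i. \<phi> (wmon I J)) = weyl d r \<phi> (count_list I r) i"
proof -
  have *: "(\<Sum>J | J \<in> words d \<and> count_list J r = i. \<phi> (wmon K J)) =
      \<phi> (coeff ([:Xvar (r, r + 1), Xvar (r, r):] ^ count_list K r *
        [:Xvar (r + 1, r + 1), Xvar (r + 1, r):] ^ (d - count_list K r)) i)" if "K \<in> words d" for K
  proof -
    have len: "length K = d" using that by (simp add: words_def)
    have "(\<Sum>J | J \<in> words d \<and> count_list J r = i. \<phi> (wmon K J))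
      = \<phi> (\<Sum>J | J \<in> words (length K) \<and> count_list J r = i. eval_at Const Xvar (wmon K J))"
      unfolding linear_form_sum[OF assms(1)]
      by (rule sum.cong) (use len in \<open>auto simp: eval_at_Const_Xvar words_def\<close>)
    moreover have "count_list K (r + 1) = d - count_list K r"
      using count_list_letters[of r "r + 1" K] len by auto
    ultimately show ?thesis
      by (simp add: word_sum_coeff[OF comm_ring_hom_Const, of r "r + 1"] prod_list_word[of r "r + 1"])
  qed
  show ?thesis
    unfolding weyl_def
    using *[OF assms(2)] *[OF std_word_in_words[of "count_list I r" d r]] count_list_le[OF assms(2)]
    by (simp add: count_list_std_word)
qed

lemma sum_words_by_count:
  "(\<Sum>L\<in>words d. F L) = (\<Sum>l\<le>d. \<Sum>L | L \<in> words d \<and> count_list L r = l. F L)"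
  by (rule sum.group[symmetric]) (auto intro: count_list_le)

lemma weyl_convolution:
  assumes "linear_form \<phi>" "linear_form \<psi>" "n \<le> d"
  shows "weyl d r (convolution \<phi> \<psi>) n i = (\<Sum>l\<le>d. weyl d r \<phi> n l * weyl d r \<psi> l i)"
proof -
  let ?I = "std_word r d n" and ?W = "\<lambda>l. {L. L \<in> words d \<and> count_list L r = l}"
  have "weyl d r (convolution \<phi> \<psi>) n i = (\<Sum>J\<in>?W i. \<Sum>L\<in>words d. \<phi> (wmon ?I L) * \<psi> (wmon L J))"
    unfolding weyl_def using assms std_word_in_words by (intro sum.cong) (auto simp: convolution_word)
  also have "\<dots> = (\<Sum>L\<in>words d. \<phi> (wmon ?I L) * (\<Sum>J\<in>?W i. \<psi> (wmon L J)))"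
    by (subst sum.swap) (simp add: sum_distrib_left)
  also have "\<dots> = (\<Sum>L\<in>words d. \<phi> (wmon ?I L) * weyl d r \<psi> (count_list L r) i)"
    by (intro sum.cong refl) (simp add: weyl_word[OF assms(2)])
  also have "\<dots> = (\<Sum>l\<le>d. \<Sum>L\<in>?W l. \<phi> (wmon ?I L) * weyl d r \<psi> (count_list L r) i)"
    by (rule sum_words_by_count)
  also have "\<dots> = (\<Sum>l\<le>d. weyl d r \<phi> n l * weyl d r \<psi> l i)"
    by (simp add: weyl_def sum_distrib_right)
  finally show ?thesis .
qed

lemma weyl_torus:
  assumes "n \<le> d"
  shows "weyl d 1 (torus_form d t u) n i = (if n = i then t ^ n * u ^ (d - n) else 0)"
proof -
  let ?I = "std_word 1 d n"
  have I: "?I \<in> words d" "count_list ?I 1 = n" "count_list ?I 2 = d - n"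
    using assms std_word_in_words count_list_std_word[of n d 1] count_list_two[of ?I]
    by (auto simp: words_def std_word_def count_list_replicate)
  have "weyl d 1 (torus_form d t u) n i =
      (\<Sum>J | J \<in> words d \<and> count_list J 1 = i. if J = ?I then t ^ n * u ^ (d - n) else 0)"
    unfolding weyl_def using I by (intro sum.cong) (auto simp: torus_form_word)
  also have "\<dots> = (if n = i then t ^ n * u ^ (d - n) else 0)"
    using I by (auto simp: sum.delta)
  finally show ?thesis .
qed

lemma coeff_linear_power:
  fixes a b :: "'r::comm_ring_1"
  shows "coeff ([:a, b:] ^ n) i = of_nat (n choose i) * b ^ i * a ^ (n - i)"
proof (cases "i \<le> n")
  case False
  have "degree ([:a, b:] ^ n) \<le> degree [:a, b:] * n" by (rule degree_power_le)
  also have "\<dots> \<le> 1 * n" by (intro mult_right_mono) auto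
  finally show ?thesis using False by (simp add: coeff_eq_0 binomial_eq_0)
qed (rule coeff_linear_poly_power)

lemma weyl_lie:
  assumes "n \<le> d"
  shows "weyl d 1 (lie_form d ij) n i = coeff (coeff
    ([:dual_point ij (1, 2), dual_point ij (1, 1):] ^ n *
     [:dual_point ij (2, 2), dual_point ij (2, 1):] ^ (d - n)) i) 1"
proof -
  let ?I = "std_word 1 d n"
  have I: "?I \<in> words d" "length ?I = d" "count_list ?I 1 = n" "count_list ?I 2 = d - n"
    using assms std_word_in_words count_list_std_word[of n d 1]
    by (auto simp: words_def std_word_def count_list_replicate)
  have neq: "(1 :: 2) \<noteq> 2" by simp
  have "weyl d 1 (lie_form d ij) n i = coeff (\<Sum>J | J \<in> words (length ?I) \<and> count_list J 1 = i.
      eval_at (\<lambda>c. [:c:]) (dual_point ij) (wmon ?I J)) 1"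
    unfolding weyl_def coeff_sum using I
    by (intro sum.cong) (auto simp: lie_form_def hom_component_single mon_deg_wexp words_def)
  also have "(\<Sum>J | J \<in> words (length ?I) \<and> count_list J 1 = i.
      eval_at (\<lambda>c. [:c:]) (dual_point ij) (wmon ?I J)) =
      coeff (\<Prod>l\<leftarrow>?I. [:dual_point ij (l, 2), dual_point ij (l, 1):]) i"
    by (rule word_sum_coeff[OF comm_ring_hom_pCons neq])
  finally show ?thesis
    unfolding prod_list_word[OF neq] I .
qed

lemma X_power: "[:0, 1:] ^ n = monom (1 :: 'r::comm_ring_1) n"
  by (simp add: monom_altdef)

lemma coeff_1_of_nat_mult: "coeff (of_nat c * p) 1 = of_nat c * coeff (p :: 'r::comm_ring_1 poly) 1"
  by (simp add: of_nat_poly)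

lemma weyl_lie_12:
  assumes "n \<le> d"
  shows "weyl d 1 (lie_form d (1, 2)) n i = (if n = i + 1 then of_nat (i + 1) else 0)"
proof -
  have "weyl d 1 (lie_form d (1, 2)) n i = coeff (coeff ([:[:0, 1:], 1:] ^ n) i) 1"
    unfolding weyl_lie[OF assms] by (simp add: one_pCons[symmetric])
  also have "\<dots> = (if n = i + 1 then of_nat (i + 1) else 0)"
    unfolding coeff_linear_power X_power mult.assoc coeff_1_of_nat_mult
    by (auto simp: coeff_monom)
  finally show ?thesis .
qed

lemma weyl_lie_21:
  assumes "n \<le> d"
  shows "weyl d 1 (lie_form d (2, 1)) n i = (if i = n + 1 then of_nat (d - n) else 0)"
proof -
  have "weyl d 1 (lie_form d (2, 1)) n i = coeff (coeff (monom 1 n * [:1, [:0, 1:]:] ^ (d - n)) i) 1"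
    unfolding weyl_lie[OF assms] by (simp add: X_power)
  also have "\<dots> = (if i = n + 1 then of_nat (d - n) else 0)"
    unfolding coeff_monom_mult coeff_linear_power X_power mult.assoc
    by (auto simp: coeff_monom coeff_1_of_nat_mult[simplified])
  finally show ?thesis .
qed

lemma coeff_one_plus_X_power: "coeff ([:1, 1:] ^ n) 1 = (of_nat n :: 'r::comm_ring_1)"
  unfolding coeff_linear_power by simp

lemma weyl_lie_11:
  assumes "n \<le> d"
  shows "weyl d 1 (lie_form d (1, 1)) n i = (if n = i then of_nat n else 0)"
proof -
  have "weyl d 1 (lie_form d (1, 1)) n i = coeff (coeff ([:0, [:1, 1:]:] ^ n) i) 1"
    unfolding weyl_lie[OF assms] by (simp add: one_pCons[symmetric]) (simp add: one_pCons)
  also have "\<dots> = (if n = i then of_nat n else 0)"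
    unfolding coeff_linear_power mult.assoc coeff_1_of_nat_mult
    using coeff_one_plus_X_power
    by (cases i n rule: linorder_cases) (auto simp: power_0_left binomial_eq_0)
  finally show ?thesis .
qed

lemma weyl_lie_22:
  assumes "n \<le> d"
  shows "weyl d 1 (lie_form d (2, 2)) n i = (if n = i then of_nat (d - n) else 0)"
proof -
  have "weyl d 1 (lie_form d (2, 2)) n i = coeff (coeff (monom 1 n * [:[:1, 1:] ^ (d - n):]) i) 1"
    unfolding weyl_lie[OF assms] by (simp add: X_power poly_const_pow) (simp add: one_pCons)
  also have "\<dots> = (if n = i then of_nat (d - n) else 0)"
    unfolding coeff_monom_mult
    using coeff_one_plus_X_power by (auto simp: coeff_pCons split: nat.splits)
  finally show ?thesis .
qed

definition weyl_mat :: "nat \<Rightarrow> 'k::field form \<Rightarrow> 'k mat" where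
  "weyl_mat d \<phi> = mat (d + 1) (d + 1) (\<lambda>(n, i). weyl d 1 \<phi> n i)"

lemma schur_module_weyl_mat: "schur_module d (d + 1) (weyl_mat d :: 'k::field form \<Rightarrow> 'k mat)"
  unfolding schur_module_def
proof (intro conjI ballI allI)
  fix \<phi> \<psi> :: "'k form" and c
  assume "\<phi> \<in> schur_forms d" "\<psi> \<in> schur_forms d"
  then have lin: "linear_form \<phi>" "linear_form \<psi>" by (auto dest: schur_forms_linear)
  show "weyl_mat d (\<lambda>f. \<phi> f + \<psi> f) = weyl_mat d \<phi> + weyl_mat d \<psi>"
    by (rule eq_matI) (auto simp: weyl_mat_def weyl_def sum.distrib)
  show "weyl_mat d (convolution \<phi> \<psi>) = weyl_mat d \<phi> * weyl_mat d \<psi>"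
    by (rule eq_matI)
       (auto simp: weyl_mat_def scalar_prod_def weyl_convolution[OF lin] atMost_atLeast0
         atLeastLessThanSuc_atLeastAtMost intro!: sum.cong)
next
  fix \<phi> :: "'k form" and c
  show "weyl_mat d (\<lambda>f. c * \<phi> f) = c \<cdot>\<^sub>m weyl_mat d \<phi>"
    by (rule eq_matI) (auto simp: weyl_mat_def weyl_def sum_distrib_left)
next
  show "weyl_mat d (torus_form d 1 1) = (1\<^sub>m (d + 1) :: 'k mat)"
    by (rule eq_matI) (auto simp: weyl_mat_def weyl_torus)
qed (simp add: weyl_mat_def)

text \<open>
  Over a finite field, 1 plus the product of all \<open>x - a\<close> has no root.
\<close>

lemma alg_closed_infinite: "infinite (UNIV :: 'k::alg_closed_field set)"
proof
  assume fin: "finite (UNIV :: 'k set)"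
  define q where "q = (\<Prod>a\<in>UNIV. [:- a, 1 :: 'k:])"
  have "degree q = card (UNIV :: 'k set)"
    unfolding q_def by (subst degree_prod_eq_sum_degree) auto
  then have "degree q > 0" using fin by (simp add: card_gt_0_iff)
  then have "degree (q + 1) > 0" by (subst degree_add_eq_left) auto
  then obtain z where "poly (q + 1) z = 0" using alg_closed_imp_poly_has_root by blast
  moreover have "poly q z = 0" unfolding q_def poly_prod by (rule prod_zero) (use fin in auto)
  ultimately show False by simp
qed

text \<open>
  Different exponents give different characters: otherwise all nonzero elements of an infinite
  field would be roots of unity of one order.
\<close>

lemma powers_distinct:
  fixes n :: nat and m :: int
  assumes "\<And>t :: 'k::alg_closed_field. t \<noteq> 0 \<Longrightarrow> t ^ n = t powi m"
  shows "int n = m"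
proof (rule ccontr)
  assume "int n \<noteq> m"
  define k where "k = nat \<bar>int n - m\<bar>"
  have "k > 0" using \<open>int n \<noteq> m\<close> by (simp add: k_def)
  have "t ^ k = 1" if "t \<noteq> 0" for t :: 'k
  proof (cases "int n \<ge> m")
    case True
    then have "t powi int k = t ^ n / t powi m"
      using that by (simp add: k_def power_int_diff)
    then show ?thesis using assms[OF that] that by simp
  next
    case False
    then have "t powi int k = t powi m / t ^ n"
      using that by (simp add: k_def power_int_diff)
    then show ?thesis using assms[OF that] that by simp
  qed
  then have "UNIV - {0} \<subseteq> {t :: 'k. t ^ k = 1}" by blast
  moreover have "{t :: 'k. t ^ k = 1} \<subseteq> {t. poly (monom 1 k - 1) t = 0}"
    by (auto simp: poly_monom)
  moreover have "monom 1 k - 1 \<noteq> (0 :: 'k poly)"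
  proof
    assume "monom 1 k - 1 = (0 :: 'k poly)"
    then have "coeff (monom 1 k - 1 :: 'k poly) 0 = 0" by simp
    with \<open>k > 0\<close> show False by simp
  qed
  then have "finite {t. poly (monom 1 k - 1 :: 'k poly) t = 0}" by (rule poly_roots_finite)
  ultimately have "finite (UNIV - {0 :: 'k})" by (meson finite_subset)
  then show False using alg_closed_infinite[where 'k = 'k] by simp
qed

lemma G1T_module_weyl_mat:
  "G1T_module d (d + 1) (weyl_mat d) = (V_hat d :: 'k::alg_closed_field graded_module)"
proof -
  have act: "weyl_mat d (torus_form d t u) *\<^sub>v v = c \<cdot>\<^sub>v v \<longleftrightarrow> (\<forall>i\<le>d. t ^ i * u ^ (d - i) * v $ i = c * v $ i)"
    if "v \<in> carrier_vec (d + 1)" for t u c and v :: "'k vec"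
  proof -
    have "(weyl_mat d (torus_form d t u) *\<^sub>v v) $ i = t ^ i * u ^ (d - i) * v $ i" if "i \<le> d" for i
    proof -
      have "(weyl_mat d (torus_form d t u) *\<^sub>v v) $ i
          = (\<Sum>l<d + 1. (if i = l then t ^ i * u ^ (d - i) else 0) * v $ l)"
        using that \<open>v \<in> _\<close> by (auto simp: weyl_mat_def scalar_prod_def weyl_torus atLeast0LessThan intro!: sum.cong)
      also have "\<dots> = (\<Sum>l<d + 1. if i = l then t ^ i * u ^ (d - i) * v $ l else 0)"
        by (intro sum.cong) auto
      finally show ?thesis using that by (simp add: sum.delta)
    qed
    then show ?thesis
      using that by (auto simp: vec_eq_iff weyl_mat_def less_Suc_eq_le)
  qed
  have weight: "(\<forall>t u. t \<noteq> 0 \<longrightarrow> u \<noteq> 0 \<longrightarrow> (\<forall>i\<le>d. t ^ i * u ^ (d - i) * v $ i = t powi a * u powi b * v $ i))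
      \<longleftrightarrow> (\<forall>i\<le>d. v $ i \<noteq> 0 \<longrightarrow> (a, b) = (int i, int d - int i))" for v :: "'k vec" and a b
  proof
    assume *: "\<forall>t u. t \<noteq> 0 \<longrightarrow> u \<noteq> 0 \<longrightarrow> (\<forall>i\<le>d. t ^ i * u ^ (d - i) * v $ i = t powi a * u powi b * v $ i)"
    show "\<forall>i\<le>d. v $ i \<noteq> 0 \<longrightarrow> (a, b) = (int i, int d - int i)"
    proof (intro allI impI)
      fix i assume i: "i \<le> d" "v $ i \<noteq> 0"
      have "int i = a"
        by (rule powers_distinct[where 'k = 'k]) (use *[rule_format, of _ 1, OF _ _ i(1)] i(2) in simp)
      moreover have "int (d - i) = b"
        by (rule powers_distinct[where 'k = 'k]) (use *[rule_format, of 1, OF _ _ i(1)] i(2) in simp)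
      ultimately show "(a, b) = (int i, int d - int i)" using i by auto
    qed
  next
    assume *: "\<forall>i\<le>d. v $ i \<noteq> 0 \<longrightarrow> (a, b) = (int i, int d - int i)"
    show "\<forall>t u. t \<noteq> 0 \<longrightarrow> u \<noteq> 0 \<longrightarrow> (\<forall>i\<le>d. t ^ i * u ^ (d - i) * v $ i = t powi a * u powi b * v $ i)"
    proof (intro allI impI)
      fix t u :: 'k and i assume i: "i \<le> d"
      show "t ^ i * u ^ (d - i) * v $ i = t powi a * u powi b * v $ i"
        using *[rule_format, OF i] i by (cases "v $ i = 0") (auto simp flip: of_nat_diff)
    qed
  qed
  have "(\<forall>t u. t \<noteq> 0 \<longrightarrow> u \<noteq> 0 \<longrightarrow>
        weyl_mat d (torus_form d t u) *\<^sub>v v = (t powi fst \<mu> * u powi snd \<mu>) \<cdot>\<^sub>v v)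
      \<longleftrightarrow> (\<forall>i\<le>d. v $ i \<noteq> 0 \<longrightarrow> \<mu> = (int i, int d - int i))"
    if "v \<in> carrier_vec (d + 1)" for v :: "'k vec" and \<mu>
    using weight[of v "fst \<mu>" "snd \<mu>"] by (simp only: act[OF that] prod.collapse)
  then have "gcomp (G1T_module d (d + 1) (weyl_mat d)) = gcomp (V_hat d :: 'k graded_module)"
    unfolding G1T_module_def V_hat_def graded_module.simps
    by (intro ext Collect_cong conj_cong refl) auto
  moreover have "weyl_mat d (lie_form d (1, 2)) = (act_e (V_hat d) :: 'k mat)"
    by (rule eq_matI) (auto simp: weyl_mat_def weyl_lie_12 V_hat_def)
  moreover have "weyl_mat d (lie_form d (2, 1)) = (act_f (V_hat d) :: 'k mat)"
    by (rule eq_matI) (auto simp: weyl_mat_def weyl_lie_21 V_hat_def Suc_diff_Suc less_Suc_eq_le)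
  moreover have "weyl_mat d (lie_form d (1, 1)) - weyl_mat d (lie_form d (2, 2)) = (act_h (V_hat d) :: 'k mat)"
    by (rule eq_matI) (auto simp: weyl_mat_def weyl_lie_11 weyl_lie_22 V_hat_def of_nat_diff)
  ultimately show ?thesis
    by (simp add: G1T_module_def V_hat_def)
qed


section \<open>Forms that vanish on multiples of the determinant\<close>

text \<open>
  The form \<open>\<kappa>\<close> takes the same value on \<open>X\<^sub>1\<^sub>1X\<^sub>2\<^sub>2m\<close> and \<open>X\<^sub>1\<^sub>2X\<^sub>2\<^sub>1m\<close>. So every monomial can be replaced
  by one in which \<open>X\<^sub>1\<^sub>1\<close> or \<open>X\<^sub>2\<^sub>2\<close> is missing, and this one is determined by its weights. Its
  exponent of \<open>X\<^sub>1\<^sub>2\<close> is then \<open>l\<close>, or its exponent of \<open>X\<^sub>2\<^sub>1\<close> is \<open>d - l\<close>.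
\<close>

lemma det_twist_kernel_word:
  fixes \<kappa> :: "'k::field form"
  assumes \<kappa>: "\<kappa> \<in> schur_forms d" and ker: "det_twist \<kappa> = (\<lambda>f. 0)"
  obtains g where "\<And>L J. L \<in> words d \<Longrightarrow> J \<in> words d \<Longrightarrow> \<kappa> (wmon L J) = g (count_list L 1) (count_list J 1)"
    and "\<And>l j. l \<le> d \<Longrightarrow> g l j \<noteq> 0 \<Longrightarrow> l < CHAR('k) \<or> d - l < CHAR('k)"
proof -
  let ?\<kappa> = "\<lambda>a b c e. \<kappa> (Poly_Mapping.single (mon4 a b c e) 1)"
  have step: "?\<kappa> (Suc a) b c (Suc e) = ?\<kappa> a (Suc b) (Suc c) e" for a b c e
    using det_twist_mon4[OF schur_forms_linear[OF \<kappa>], of a b c e] by (simp add: ker)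
  have move: "?\<kappa> (a + k) b c (e + k) = ?\<kappa> a (b + k) (c + k) e" for a b c e k
  proof (induction k arbitrary: b c)
    case (Suc k)
    have "?\<kappa> (a + Suc k) b c (e + Suc k) = ?\<kappa> (a + k) (Suc b) (Suc c) (e + k)"
      using step by simp
    also have "\<dots> = ?\<kappa> a (Suc b + k) (Suc c + k) e" by (rule Suc.IH)
    finally show ?case by simp
  qed simp
  define g where "g l j = (if l + j \<le> d then ?\<kappa> 0 l j (d - l - j) else ?\<kappa> (l + j - d) (d - j) (d - l) 0)" for l j
  show ?thesis
  proof
    fix L J assume LJ: "L \<in> words d" "J \<in> words d"
    obtain a b c e where m: "wexp L J = mon4 a b c e" using mon4_eta by blast
    have "length L = length J" "length L = d" using LJ by (simp_all add: words_def)
    then have l: "count_list L 1 = a + b" and j: "count_list J 1 = a + c" and d: "d = a + b + c + e"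
      using lookup_wexp_row[of L J 1] lookup_wexp_col[of L J 1] mon_deg_wexp[of L J]
      by (simp_all add: m mon_deg_mon4)
    show "\<kappa> (wmon L J) = g (count_list L 1) (count_list J 1)"
    proof (cases "a \<le> e")
      case True
      then show ?thesis
        using move[of 0 a b c "e - a"] by (simp add: g_def m l j d add.commute)
    next
      case False
      then show ?thesis
        using move[of "a - e" e b c 0] by (simp add: g_def m l j d add.commute)
    qed
  next
    fix l j assume "l \<le> d" "g l j \<noteq> 0"
    then have "reduced CHAR('k) (mon4 0 l j (d - l - j)) \<or> reduced CHAR('k) (mon4 (l + j - d) (d - j) (d - l) 0)"
      using schur_forms_reduced[OF \<kappa>] by (auto simp: g_def split: if_splits)
    then show "l < CHAR('k) \<or> d - l < CHAR('k)" by (auto simp: reduced_mon4)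
  qed
qed

text \<open>
  As the values of \<open>\<kappa>\<close> depend only on contents, the sum over the middle word collapses to a sum
  over columns of the matrix of \<open>b\<close> on \<open>V(d)\<close>.
\<close>

lemma convolution_det_twist_kernel:
  fixes b :: "'k::field form"
  assumes p: "prime CHAR('k)" and b: "b \<in> schur_forms d" and \<kappa>: "\<kappa> \<in> schur_forms d"
    and ker: "det_twist \<kappa> = (\<lambda>f. 0)"
    and zero: "\<And>n l. n \<le> d \<Longrightarrow> l \<le> d \<Longrightarrow> l < CHAR('k) \<or> d - l < CHAR('k) \<Longrightarrow> weyl d 1 b n l = 0"
  shows "convolution b \<kappa> = (\<lambda>f. 0)"
proof (rule schur_forms_eqI)
  show "convolution b \<kappa> \<in> schur_forms d" by (rule convolution_closed[OF p b \<kappa>])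
  show "(\<lambda>f. 0) \<in> schur_forms d" by (rule schur_forms_zero)
  fix I J assume IJ: "I \<in> words d" "J \<in> words d"
  obtain g where g: "\<And>L J. L \<in> words d \<Longrightarrow> J \<in> words d \<Longrightarrow> \<kappa> (wmon L J) = g (count_list L 1) (count_list J 1)"
    and g0: "\<And>l j. l \<le> d \<Longrightarrow> g l j \<noteq> 0 \<Longrightarrow> l < CHAR('k) \<or> d - l < CHAR('k)"
    by (rule det_twist_kernel_word[OF \<kappa> ker]) blast
  have lin: "linear_form b" using b by (rule schur_forms_linear)
  have "convolution b \<kappa> (wmon I J) = (\<Sum>L\<in>words d. b (wmon I L) * g (count_list L 1) (count_list J 1))"
    using IJ by (simp add: convolution_word[OF lin] g)
  also have "\<dots> = (\<Sum>l\<le>d. \<Sum>L | L \<in> words d \<and> count_list L 1 = l. b (wmon I L) * g (count_list L 1) (count_list J 1))"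
    by (rule sum_words_by_count)
  also have "\<dots> = (\<Sum>l\<le>d. weyl d 1 b (count_list I 1) l * g l (count_list J 1))"
    by (simp add: weyl_word[OF lin IJ(1), symmetric] sum_distrib_right)
  also have "\<dots> = 0"
  proof (intro sum.neutral ballI)
    fix l assume "l \<in> {..d}"
    then show "weyl d 1 b (count_list I 1) l * g l (count_list J 1) = 0"
      using zero[OF count_list_le[OF IJ(1)], of l] g0[of l "count_list J 1"] by auto
  qed
  finally show "convolution b \<kappa> (wmon I J) = 0" .
qed


section \<open>Central idempotents on V(d)\<close>

lemma weyl_commute:
  assumes "linear_form b" "linear_form \<psi>" "convolution b \<psi> = convolution \<psi> b" "n \<le> d"
  shows "(\<Sum>l\<le>d. weyl d r b n l * weyl d r \<psi> l i) = (\<Sum>l\<le>d. weyl d r \<psi> n l * weyl d r b l i)"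
  using assms by (simp flip: weyl_convolution)

text \<open>
  The torus acts on the \<open>v\<^sub>i\<close> by pairwise different characters.
\<close>

lemma weyl_central_diagonal:
  fixes b :: "'k::alg_closed_field form"
  assumes p: "prime CHAR('k)" and b: "b \<in> schur_forms d"
    and central: "\<And>\<psi>. \<psi> \<in> schur_forms d \<Longrightarrow> convolution b \<psi> = convolution \<psi> b"
    and ni: "n \<le> d" "i \<le> d" "n \<noteq> i"
  shows "weyl d 1 b n i = 0"
proof (rule ccontr)
  assume nz: "weyl d 1 b n i \<noteq> 0"
  have "t ^ n = t powi int i" for t :: 'k
  proof -
    have "(\<Sum>l\<le>d. weyl d 1 b n l * weyl d 1 (torus_form d t 1) l i)
        = (\<Sum>l\<le>d. weyl d 1 (torus_form d t 1) n l * weyl d 1 b l i)"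
      using b ni p by (intro weyl_commute central torus_form_in_schur_forms torus_form_linear schur_forms_linear)
    moreover have "(\<Sum>l\<le>d. weyl d 1 b n l * weyl d 1 (torus_form d t 1) l i)
        = (\<Sum>l\<le>d. if l = i then weyl d 1 b n i * t ^ i else 0)"
      by (intro sum.cong) (auto simp: weyl_torus)
    moreover have "(\<Sum>l\<le>d. weyl d 1 (torus_form d t 1) n l * weyl d 1 b l i)
        = (\<Sum>l\<le>d. if l = n then t ^ n * weyl d 1 b n i else 0)"
      using ni by (intro sum.cong) (auto simp: weyl_torus)
    ultimately show ?thesis using nz ni by simp
  qed
  then have "int n = int i" by (rule powers_distinct)
  with ni show False by simp
qed

text \<open>
  The coefficient of \<open>e\<close> from \<open>v\<^sub>i\<close> to \<open>v\<^sub>i\<^sub>+\<^sub>1\<close> is \<open>i + 1\<close>, that of \<open>f\<close> back to \<open>v\<^sub>i\<close> is \<open>d - i\<close>.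
  If both are zero in \<open>k\<close>, then \<open>p\<close> divides their sum \<open>d + 1\<close>.
\<close>

lemma weyl_central_scalar:
  fixes b :: "'k::alg_closed_field form"
  assumes p: "prime CHAR('k)" and b: "b \<in> schur_forms d"
    and central: "\<And>\<psi>. \<psi> \<in> schur_forms d \<Longrightarrow> convolution b \<psi> = convolution \<psi> b"
    and d: "\<not> CHAR('k) dvd d + 1" and "n \<le> d"
  shows "weyl d 1 b n n = weyl d 1 b 0 0"
  using \<open>n \<le> d\<close>
proof (induction n)
  case (Suc i)
  note diag = weyl_central_diagonal[OF p b central]
  have comm: "(\<Sum>l\<le>d. weyl d 1 b n l * weyl d 1 (lie_form d ij) l m)
        = (\<Sum>l\<le>d. weyl d 1 (lie_form d ij) n l * weyl d 1 b l m)" if "n \<le> d" for n m ij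
    using b p that by (intro weyl_commute central lie_form_in_schur_forms lie_form_linear schur_forms_linear)
  have e: "of_nat (Suc i) * weyl d 1 b (Suc i) (Suc i) = of_nat (Suc i) * weyl d 1 b i i"
  proof -
    have "(\<Sum>l\<le>d. weyl d 1 b (Suc i) l * weyl d 1 (lie_form d (1, 2)) l i)
        = (\<Sum>l\<le>d. if l = Suc i then of_nat (Suc i) * weyl d 1 b (Suc i) (Suc i) else 0)"
      by (intro sum.cong) (auto simp: weyl_lie_12 mult.commute)
    moreover have "(\<Sum>l\<le>d. weyl d 1 (lie_form d (1, 2)) (Suc i) l * weyl d 1 b l i)
        = (\<Sum>l\<le>d. if l = i then of_nat (Suc i) * weyl d 1 b i i else 0)"
      using Suc.prems by (intro sum.cong) (auto simp: weyl_lie_12)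
    ultimately show ?thesis using comm[of "Suc i" "(1, 2)" i] Suc.prems by auto
  qed
  have f: "of_nat (d - i) * weyl d 1 b i i = of_nat (d - i) * weyl d 1 b (Suc i) (Suc i)"
  proof -
    have "(\<Sum>l\<le>d. weyl d 1 b i l * weyl d 1 (lie_form d (2, 1)) l (Suc i))
        = (\<Sum>l\<le>d. if l = i then of_nat (d - i) * weyl d 1 b i i else 0)"
      by (intro sum.cong) (auto simp: weyl_lie_21 mult.commute)
    moreover have "(\<Sum>l\<le>d. weyl d 1 (lie_form d (2, 1)) i l * weyl d 1 b l (Suc i))
        = (\<Sum>l\<le>d. if l = Suc i then of_nat (d - i) * weyl d 1 b (Suc i) (Suc i) else 0)"
      using Suc.prems by (intro sum.cong) (auto simp: weyl_lie_21)
    ultimately show ?thesis using comm[of i "(2, 1)" "Suc i"] Suc.prems by auto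
  qed
  have "(of_nat (Suc i) :: 'k) \<noteq> 0 \<or> (of_nat (d - i) :: 'k) \<noteq> 0"
  proof (rule ccontr)
    assume "\<not> ?thesis"
    then have "CHAR('k) dvd Suc i" "CHAR('k) dvd d - i"
      unfolding of_nat_eq_0_iff_char_dvd by blast+
    then have "CHAR('k) dvd Suc i + (d - i)" by (rule dvd_add)
    with d Suc.prems show False by simp
  qed
  then have "weyl d 1 b (Suc i) (Suc i) = weyl d 1 b i i"
    using e f by (metis mult_left_cancel)
  with Suc show ?case by simp
qed simp

lemma V_hat_in_block_modules:
  fixes b :: "'k::alg_closed_field form"
  assumes p: "prime CHAR('k)" and b: "central_idempotent (schur_alg d) b"
    and d: "\<not> CHAR('k) dvd d + 1" and nz: "n \<le> d" "i \<le> d" "weyl d 1 b n i \<noteq> 0"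
  shows "V_hat d \<in> block_modules d b"
proof -
  from b have bS: "b \<in> schur_forms d" and idem: "convolution b b = b"
    and central: "\<And>\<psi>. \<psi> \<in> schur_forms d \<Longrightarrow> convolution b \<psi> = convolution \<psi> b"
    unfolding central_idempotent_def schur_alg_simps by blast+
  note diag = weyl_central_diagonal[OF p bS central]
  have scalar: "weyl d 1 b l l = weyl d 1 b 0 0" if "l \<le> d" for l
    using weyl_central_scalar[OF p bS central d that] by simp
  have "weyl d 1 b 0 0 \<noteq> 0"
    using nz diag[of n i] scalar[of n] by (cases "n = i") auto
  moreover have "weyl d 1 b 0 0 = weyl d 1 b 0 0 * weyl d 1 b 0 0"
  proof -
    have "weyl d 1 b 0 0 = (\<Sum>l\<le>d. weyl d 1 b 0 l * weyl d 1 b l 0)"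
      using weyl_convolution[of b b 0 d 1 0] schur_forms_linear[OF bS] by (simp add: idem)
    also have "\<dots> = (\<Sum>l\<le>d. if l = 0 then weyl d 1 b 0 0 * weyl d 1 b 0 0 else 0)"
      using diag by (intro sum.cong) auto
    finally show ?thesis by simp
  qed
  ultimately have one: "weyl d 1 b 0 0 = 1" by simp
  have "weyl_mat d b = 1\<^sub>m (d + 1)"
    using diag scalar one by (intro eq_matI) (auto simp: weyl_mat_def)
  then show ?thesis
    unfolding block_modules_def
    by (intro CollectI exI[of _ "d + 1"] exI[of _ "weyl_mat d"] conjI schur_module_weyl_mat
        G1T_module_weyl_mat[symmetric])
qed


section \<open>Steinberg blocks\<close>

text \<open>
  Consecutive binomial coefficients differ by the factor \<open>(d - i) / (i + 1)\<close>, and modulo \<open>p\<close>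
  the numerator is \<open>-(i + 1)\<close>.
\<close>

lemma choose_not_dvd:
  assumes p: "prime p" and d: "p dvd d + 1" and "i < p"
  shows "\<not> p dvd (d choose i)"
  using \<open>i < p\<close>
proof (induction i)
  case 0
  then show ?case using p by (simp add: prime_nat_iff)
next
  case (Suc i)
  have "i < d" using d Suc.prems dvd_imp_le[OF d] by simp
  have "\<not> p dvd d - i"
  proof
    assume "p dvd d - i"
    with d have "p dvd (d + 1) - (d - i)" by (rule dvd_diff_nat)
    also have "(d + 1) - (d - i) = Suc i" using \<open>i < d\<close> by simp
    finally show False using Suc.prems by (simp add: nat_dvd_not_less)
  qed
  moreover have "\<not> p dvd (d choose i)" using Suc by simp
  ultimately have "\<not> p dvd (d - i) * (d choose i)"
    using p by (simp add: prime_dvd_mult_iff)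
  also have "(d - i) * (d choose i) = Suc i * (d choose Suc i)"
    by (simp only: binomial_absorb_comp binomial_absorption)
  finally show ?case by (metis dvd_mult)
qed

text \<open>
  The sum stands for the number of words, taken in the ring in which it will be inverted.
\<close>

lemma sum_words_one:
  "(\<Sum>J | J \<in> words d \<and> count_list J r = i. 1) = (of_nat (d choose i) :: 'k::comm_ring_1)"
proof -
  let ?I = "replicate d r"
  have eval: "eval_at id (\<lambda>_. 1) (wmon I J) = (1 :: 'k)" for I J
    by (simp add: eval_at_single[OF comm_ring_hom_id])
  have "(\<Sum>J | J \<in> words (length ?I) \<and> count_list J r = i. eval_at id (\<lambda>_. 1 :: 'k) (wmon ?I J))
      = coeff (\<Prod>l\<leftarrow>?I. [:1, 1:]) i"
    by (rule word_sum_coeff[OF comm_ring_hom_id, of r "r + 1"]) simp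
  then show ?thesis by (simp only: eval length_replicate) (simp add: prod_list_replicate coeff_linear_power)
qed

text \<open>
  A primitive central idempotent cannot be decomposed as \<open>b z + (b - b z)\<close>.
\<close>

lemma (in ring) block_absorb:
  assumes b: "is_block R b" and z: "central_idempotent R z" and nz: "b \<otimes> z \<noteq> \<zero>"
  shows "b \<otimes> z = b"
proof -
  have bR: "b \<in> carrier R" and bb: "b \<otimes> b = b" and bc: "\<And>x. x \<in> carrier R \<Longrightarrow> b \<otimes> x = x \<otimes> b"
    using b unfolding is_block_def central_idempotent_def by blast+
  have zR: "z \<in> carrier R" and zz: "z \<otimes> z = z" and zc: "\<And>x. x \<in> carrier R \<Longrightarrow> z \<otimes> x = x \<otimes> z"
    using z unfolding central_idempotent_def by blast+
  define c where "c = b \<otimes> z"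
  define c' where "c' = b \<ominus> c"
  have cR: "c \<in> carrier R" "c' \<in> carrier R" using bR zR by (simp_all add: c_def c'_def)
  have bc1: "b \<otimes> c = c" using bR zR by (simp add: c_def bb flip: m_assoc)
  have cb1: "c \<otimes> b = c" using bc[OF cR(1)] bc1 by simp
  have "c \<otimes> c = b \<otimes> (z \<otimes> c)" using bR zR cR by (simp add: c_def m_assoc)
  also have "z \<otimes> c = c" using zc[OF cR(1)] bR zR by (simp add: c_def m_assoc zz)
  finally have cc: "c \<otimes> c = c" using bc1 by simp
  have central: "c \<otimes> x = x \<otimes> c" if x: "x \<in> carrier R" for x
  proof -
    have "c \<otimes> x = b \<otimes> (x \<otimes> z)" using x bR zR zc[OF x] by (simp add: c_def m_assoc)
    also have "\<dots> = x \<otimes> c" using x bR zR bc[OF x] by (simp add: c_def flip: m_assoc)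
    finally show ?thesis .
  qed
  have orth: "c \<otimes> c' = \<zero>" using bR cR by (simp add: c'_def minus_eq r_distr r_minus cb1 cc r_neg)
  have bc': "b \<otimes> c' = c'" using bR cR by (simp add: c'_def minus_eq r_distr r_minus bc1 bb)
  have "c' \<otimes> c' = b \<otimes> c' \<oplus> \<ominus> (c \<otimes> c')"
    using bR cR by (subst c'_def) (simp add: minus_eq l_distr l_minus)
  then have c'c': "c' \<otimes> c' = c'" using cR by (simp add: orth bc')
  have central': "c' \<otimes> x = x \<otimes> c'" if x: "x \<in> carrier R" for x
    using x bR cR bc[OF x] central[OF x] by (simp add: c'_def minus_eq l_distr r_distr r_minus l_minus)
  have sum: "b = c \<oplus> c'"
    using bR cR by (simp add: c'_def minus_eq a_lcomm r_neg)
  have "central_idempotent R c" "central_idempotent R c'"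
    unfolding central_idempotent_def by (intro conjI ballI cR cc c'c' central central'; assumption)+
  with b orth sum have "c = \<zero> \<or> c' = \<zero>" unfolding is_block_def by blast
  with nz have "c' = \<zero>" by (simp add: c_def)
  with sum cR show ?thesis by (simp add: c_def)
qed

text \<open>
  These are matrix units up to scalars: the product of the forms for \<open>(i, j)\<close> and \<open>(j, l)\<close> is
  \<open>d choose j\<close> times the form for \<open>(i, l)\<close>, and the other products vanish.
\<close>

definition unit_form :: "nat \<Rightarrow> 2 \<Rightarrow> nat \<Rightarrow> nat \<Rightarrow> 'k::field form" where
  "unit_form d r i j = form_of (\<lambda>m. if mon_deg m = d
     \<and> Poly_Mapping.lookup m (r, 1) + Poly_Mapping.lookup m (r, 2) = i
     \<and> Poly_Mapping.lookup m (1, r) + Poly_Mapping.lookup m (2, r) = j then 1 else 0)"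

lemma linear_form_unit_form: "linear_form (unit_form d r i j)"
  unfolding unit_form_def by (rule linear_form_form_of)

lemma unit_form_word:
  assumes "I \<in> words d" "J \<in> words d"
  shows "unit_form d r i j (wmon I J) = (if count_list I r = i \<and> count_list J r = j then 1 else 0)"
  using assms by (simp add: unit_form_def words_def mon_deg_wexp lookup_wexp_row lookup_wexp_col)

lemma unit_form_in_schur_forms:
  assumes "i < CHAR('k)" "j < CHAR('k)"
  shows "(unit_form d r i j :: 'k::field form) \<in> schur_forms d"
  unfolding unit_form_def
  by (rule form_of_in_schur_forms)
     (use assms two_cases[of r] in \<open>auto simp: reduced_def split: if_splits\<close>)

lemma convolution_unit_form:
  assumes s: "linear_form s" and IJ: "I \<in> words d" "J \<in> words d"
  shows "convolution s (unit_form d r i j) (wmon I J) =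
    (if count_list J r = j then weyl d r s (count_list I r) i else 0)"
proof -
  have "convolution s (unit_form d r i j) (wmon I J) =
      (\<Sum>L\<in>words d. if count_list L r = i then (if count_list J r = j then s (wmon I L) else 0) else 0)"
    unfolding convolution_word[OF s IJ] using IJ by (intro sum.cong) (auto simp: unit_form_word)
  also have "\<dots> = (if count_list J r = j then weyl d r s (count_list I r) i else 0)"
    by (simp add: weyl_word[OF s IJ(1), symmetric] flip: sum.inter_filter)
  finally show ?thesis .
qed

lemma unit_form_convolution:
  assumes IJ: "I \<in> words d" "J \<in> words d"
  shows "convolution (unit_form d r i j) s (wmon I J) =
    (if count_list I r = i then \<Sum>L | L \<in> words d \<and> count_list L r = j. s (wmon L J) else 0)"
proof -
  have "convolution (unit_form d r i j) s (wmon I J) =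
      (\<Sum>L\<in>words d. if count_list L r = j then (if count_list I r = i then s (wmon L J) else 0) else 0)"
    unfolding convolution_word[OF linear_form_unit_form IJ]
    using IJ by (intro sum.cong) (auto simp: unit_form_word)
  also have "\<dots> = (if count_list I r = i then \<Sum>L | L \<in> words d \<and> count_list L r = j. s (wmon L J) else 0)"
    by (simp flip: sum.inter_filter)
  finally show ?thesis .
qed

text \<open>
  The analogue of \<open>weyl\<close> for the transposed matrix.
\<close>

definition coweyl :: "nat \<Rightarrow> 2 \<Rightarrow> 'k::field form \<Rightarrow> nat \<Rightarrow> nat \<Rightarrow> 'k" where
  "coweyl d r s j n = (\<Sum>L | L \<in> words d \<and> count_list L r = j. s (wmon L (std_word r d n)))"

lemma wexp_replicate_left:
  "r \<noteq> s \<Longrightarrow> wexp (replicate (length J) s) J =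
    Poly_Mapping.single (s, r) (count_list J r) + Poly_Mapping.single (s, s) (count_list J s)"
proof (induction J)
  case (Cons j J)
  show ?case
    using letter_cases[OF Cons.prems, of j] Cons
    by (intro poly_mapping_eqI) (auto simp: lookup_add lookup_single when_def)
qed simp

text \<open>
  Multiplication by \<open>unit_form d r 0 j\<close> moves the sum into the row of a constant word, and the
  monomial of a constant word and \<open>J\<close> depends only on the content of \<open>J\<close>.
\<close>

lemma coweyl_word:
  fixes s :: "'k::field form"
  assumes J: "J \<in> words d"
  shows "(\<Sum>L | L \<in> words d \<and> count_list L r = j. s (wmon L J)) = coweyl d r s j (count_list J r)"
proof -
  let ?K = "std_word r d (count_list J r)"
  have K: "?K \<in> words d" "count_list ?K r = count_list J r"
    using count_list_le[OF J] by (simp_all add: std_word_in_words count_list_std_word)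
  have I: "std_word r d 0 \<in> words d" "count_list (std_word r d 0) r = 0"
    by (simp_all add: std_word_in_words count_list_std_word)
  have "wexp (std_word r d 0) L = Poly_Mapping.single (r + 1, r) (count_list L r)
      + Poly_Mapping.single (r + 1, r + 1) (d - count_list L r)" if "L \<in> words d" for L
  proof -
    have "length L = d" using that by (simp add: words_def)
    moreover from this have "count_list L (r + 1) = d - count_list L r"
      using count_list_letters[of r "r + 1" L] by simp
    ultimately show ?thesis using wexp_replicate_left[of r "r + 1" L] by (simp add: std_word_def)
  qed
  then have "wexp (std_word r d 0) J = wexp (std_word r d 0) ?K" using J K by simp
  then have "convolution (unit_form d r 0 j) s (wmon (std_word r d 0) J)
      = convolution (unit_form d r 0 j) s (wmon (std_word r d 0) ?K)" by simp
  then show ?thesis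
    unfolding unit_form_convolution[OF I(1) J] unit_form_convolution[OF I(1) K(1)] by (simp add: I coweyl_def)
qed

text \<open>
  The vectors \<open>v\<^sub>0, \<dots>, v\<^sub>p\<^sub>-\<^sub>1\<close> span a submodule: the coefficient is also a value of an element of
  the Schur algebra on a monomial with off-diagonal exponent \<open>n \<ge> p\<close>.
\<close>

lemma weyl_vanishes:
  fixes s :: "'k::field form"
  assumes p: "prime CHAR('k)" and s: "s \<in> schur_forms d"
    and "i < CHAR('k)" "CHAR('k) \<le> n" "n \<le> d"
  shows "weyl d r s n i = 0"
proof -
  let ?I = "std_word r d n" and ?J = "std_word r d 0"
  have I: "?I \<in> words d" "count_list ?I r = n" and J: "?J \<in> words d" "count_list ?J r = 0"
    using assms by (simp_all add: std_word_in_words count_list_std_word)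
  then have "length ?I = length ?J" by (simp add: words_def)
  then have "\<not> reduced CHAR('k) (wexp ?I ?J)"
    using lookup_wexp_row[of ?I ?J r] lookup_wexp_col[of ?I ?J r] two_cases[of r] I J assms(4)
    by (auto simp: reduced_def)
  moreover have "convolution s (unit_form d r i 0) \<in> schur_forms d"
    using assms by (intro convolution_closed[OF p s] unit_form_in_schur_forms) auto
  ultimately have "convolution s (unit_form d r i 0) (wmon ?I ?J) = 0"
    by (intro schur_forms_reduced)
  then show ?thesis by (simp add: convolution_unit_form[OF schur_forms_linear[OF s] I(1) J(1)] I J)
qed

lemma coweyl_vanishes:
  fixes s :: "'k::field form"
  assumes p: "prime CHAR('k)" and s: "s \<in> schur_forms d"
    and "j < CHAR('k)" "CHAR('k) \<le> n" "n \<le> d"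
  shows "coweyl d r s j n = 0"
proof -
  let ?I = "std_word r d 0" and ?J = "std_word r d n"
  have J: "?J \<in> words d" "count_list ?J r = n" and I: "?I \<in> words d" "count_list ?I r = 0"
    using assms by (simp_all add: std_word_in_words count_list_std_word)
  then have "length ?I = length ?J" by (simp add: words_def)
  then have "\<not> reduced CHAR('k) (wexp ?I ?J)"
    using lookup_wexp_row[of ?I ?J r] lookup_wexp_col[of ?I ?J r] two_cases[of r] I J assms(4)
    by (auto simp: reduced_def)
  moreover have "convolution (unit_form d r 0 j) s \<in> schur_forms d"
    using assms by (intro convolution_closed[OF p _ s] unit_form_in_schur_forms) auto
  ultimately have "convolution (unit_form d r 0 j) s (wmon ?I ?J) = 0"
    by (intro schur_forms_reduced)
  then show ?thesis by (simp add: unit_form_convolution[OF I(1) J(1)] I coweyl_def)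
qed

text \<open>
  Both sides are the sum of \<open>s\<close> over all pairs of words with contents \<open>n\<close> and \<open>i\<close>.
\<close>

lemma weyl_coweyl:
  fixes s :: "'k::field form"
  assumes s: "linear_form s"
  shows "of_nat (d choose n) * weyl d r s n i = of_nat (d choose i) * coweyl d r s n i"
proof -
  let ?W = "\<lambda>n. {L. L \<in> words d \<and> count_list L r = n}"
  have "(\<Sum>L\<in>?W n. \<Sum>J\<in>?W i. s (wmon L J)) = (\<Sum>L\<in>?W n. 1 * weyl d r s n i)"
    by (intro sum.cong) (auto simp: weyl_word[OF s])
  moreover have "(\<Sum>J\<in>?W i. \<Sum>L\<in>?W n. s (wmon L J)) = (\<Sum>J\<in>?W i. 1 * coweyl d r s n i)"
    by (intro sum.cong) (auto simp: coweyl_word)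
  moreover have "(\<Sum>L\<in>?W n. \<Sum>J\<in>?W i. s (wmon L J)) = (\<Sum>J\<in>?W i. \<Sum>L\<in>?W n. s (wmon L J))"
    by (rule sum.swap)
  ultimately show ?thesis
    unfolding sum_words_one[symmetric, of d n r] sum_words_one[symmetric, of d i r] sum_distrib_right
    by simp
qed

text \<open>
  The unit of the matrix algebra that the forms \<open>unit_form d r i j\<close> with \<open>i, j < p\<close> span when \<open>p\<close>
  divides \<open>d + 1\<close>.
\<close>

definition steinberg_form :: "nat \<Rightarrow> 2 \<Rightarrow> 'k::field form" where
  "steinberg_form d r = (\<lambda>f. \<Sum>a<CHAR('k). inverse (of_nat (d choose a)) * unit_form d r a a f)"

lemma steinberg_form_in_schur_forms: "steinberg_form d r \<in> schur_forms d"
  unfolding steinberg_form_def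
  by (intro schur_forms_sum schur_forms_times unit_form_in_schur_forms) auto

lemma steinberg_form_word:
  assumes "I \<in> words d" "J \<in> words d"
  shows "(steinberg_form d r :: 'k::field form) (wmon I J) =
    (if count_list I r = count_list J r \<and> count_list J r < CHAR('k)
     then inverse (of_nat (d choose count_list J r)) else 0)"
proof -
  have "(steinberg_form d r :: 'k form) (wmon I J) = (\<Sum>a<CHAR('k). if a = count_list J r
      then (if count_list I r = count_list J r then inverse (of_nat (d choose count_list J r)) else 0) else 0)"
    unfolding steinberg_form_def using assms by (intro sum.cong) (auto simp: unit_form_word)
  then show ?thesis by (simp add: sum.delta')
qed

lemma convolution_steinberg_form:
  fixes s :: "'k::field form"
  assumes s: "linear_form s" and IJ: "I \<in> words d" "J \<in> words d"
  shows "convolution s (steinberg_form d r) (wmon I J) =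
    (if count_list J r < CHAR('k)
     then weyl d r s (count_list I r) (count_list J r) * inverse (of_nat (d choose count_list J r)) else 0)"
proof -
  let ?c = "if count_list J r < CHAR('k) then inverse (of_nat (d choose count_list J r)) else (0 :: 'k)"
  have "convolution s (steinberg_form d r) (wmon I J) =
      (\<Sum>L\<in>words d. if count_list L r = count_list J r then s (wmon I L) * ?c else 0)"
    unfolding convolution_word[OF s IJ] using IJ by (intro sum.cong) (auto simp: steinberg_form_word)
  also have "\<dots> = weyl d r s (count_list I r) (count_list J r) * ?c"
    by (simp add: weyl_word[OF s IJ(1), symmetric] sum_distrib_right flip: sum.inter_filter)
  finally show ?thesis by simp
qed

lemma steinberg_form_convolution:
  fixes s :: "'k::field form"
  assumes IJ: "I \<in> words d" "J \<in> words d"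
  shows "convolution (steinberg_form d r) s (wmon I J) =
    (if count_list I r < CHAR('k)
     then coweyl d r s (count_list I r) (count_list J r) * inverse (of_nat (d choose count_list I r)) else 0)"
proof -
  let ?c = "if count_list I r < CHAR('k) then inverse (of_nat (d choose count_list I r)) else (0 :: 'k)"
  have "convolution (steinberg_form d r) s (wmon I J) =
      (\<Sum>L\<in>words d. if count_list L r = count_list I r then s (wmon L J) * ?c else 0)"
    unfolding convolution_word[OF schur_forms_linear[OF steinberg_form_in_schur_forms] IJ]
    using IJ by (intro sum.cong) (auto simp: steinberg_form_word)
  also have "\<dots> = coweyl d r s (count_list I r) (count_list J r) * ?c"
    by (simp add: coweyl_word[OF IJ(2), symmetric] sum_distrib_right flip: sum.inter_filter)
  finally show ?thesis by simp
qed

lemma of_nat_choose_nonzero: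
  assumes "prime CHAR('k)" "CHAR('k) dvd d + 1" "i < CHAR('k)"
  shows "(of_nat (d choose i) :: 'k::field) \<noteq> 0"
  using choose_not_dvd[OF assms] by (simp add: of_nat_eq_0_iff_char_dvd)

text \<open>
  Both products with \<open>s\<close> vanish on words with \<open>p\<close> or more letters \<open>r\<close>, since \<open>v\<^sub>0, \<dots>, v\<^sub>p\<^sub>-\<^sub>1\<close>
  span a submodule and the same holds for the transposed action; on the other words they agree by
  double counting.
\<close>

lemma central_idempotent_steinberg_form:
  assumes p: "prime CHAR('k)" and d: "CHAR('k) dvd d + 1"
  shows "central_idempotent (schur_alg d) (steinberg_form d r :: 'k::field form)"
proof -
  let ?z = "steinberg_form d r :: 'k form"
  have z: "?z \<in> schur_forms d" by (rule steinberg_form_in_schur_forms)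
  note nz = of_nat_choose_nonzero[OF p d]
  have "convolution ?z ?z = ?z"
  proof (rule schur_forms_eqI)
    fix I J assume IJ: "I \<in> words d" "J \<in> words d"
    let ?W = "{L. L \<in> words d \<and> count_list L r = count_list J r}"
    have "weyl d r ?z (count_list I r) (count_list J r) = (\<Sum>L\<in>?W. 1 * 
        (if count_list I r = count_list J r \<and> count_list J r < CHAR('k)
         then inverse (of_nat (d choose count_list J r)) else 0))"
      unfolding weyl_word[OF schur_forms_linear[OF z] IJ(1), symmetric]
      using IJ by (intro sum.cong) (auto simp: steinberg_form_word)
    also have "\<dots> = (if count_list I r = count_list J r \<and> count_list J r < CHAR('k) then 1 else 0)"
      unfolding sum_distrib_right[symmetric] sum_words_one using nz by simp
    finally have *: "weyl d r ?z (count_list I r) (count_list J r) =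
        (if count_list I r = count_list J r \<and> count_list J r < CHAR('k) then 1 else 0)" .
    show "convolution ?z ?z (wmon I J) = ?z (wmon I J)"
      unfolding convolution_steinberg_form[OF schur_forms_linear[OF z] IJ] steinberg_form_word[OF IJ] *
      by simp
  qed (intro convolution_closed[OF p] z)+
  moreover have "convolution ?z s = convolution s ?z" if s: "s \<in> schur_forms d" for s
  proof (rule schur_forms_eqI)
    fix I J assume IJ: "I \<in> words d" "J \<in> words d"
    let ?n = "count_list I r" and ?i = "count_list J r"
    have le: "?n \<le> d" "?i \<le> d" using IJ count_list_le by auto
    have eq: "of_nat (d choose ?n) * weyl d r s ?n ?i = of_nat (d choose ?i) * coweyl d r s ?n ?i"
      by (rule weyl_coweyl[OF schur_forms_linear[OF s]])
    consider "?n < CHAR('k)" "?i < CHAR('k)" | "?n < CHAR('k)" "CHAR('k) \<le> ?i"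
      | "CHAR('k) \<le> ?n" "?i < CHAR('k)" | "CHAR('k) \<le> ?n" "CHAR('k) \<le> ?i" by linarith
    then show "convolution ?z s (wmon I J) = convolution s ?z (wmon I J)"
    proof cases
      case 1
      then show ?thesis
        using eq nz[OF 1(1)] nz[OF 1(2)] IJ
        by (simp add: convolution_steinberg_form steinberg_form_convolution schur_forms_linear[OF s] field_simps)
    next
      case 2
      then show ?thesis
        using IJ le coweyl_vanishes[OF p s 2]
        by (simp add: convolution_steinberg_form steinberg_form_convolution schur_forms_linear[OF s])
    next
      case 3
      then show ?thesis
        using IJ le weyl_vanishes[OF p s 3(2,1)]
        by (simp add: convolution_steinberg_form steinberg_form_convolution schur_forms_linear[OF s])
    next
      case 4
      then show ?thesis
        using IJ by (simp add: convolution_steinberg_form steinberg_form_convolution schur_forms_linear[OF s])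
    qed
  qed (intro convolution_closed[OF p] z s)+
  ultimately show ?thesis
    unfolding central_idempotent_def schur_alg_simps using z by blast
qed

text \<open>
  The element \<open>b\<close> has a nonzero product with the central idempotent \<open>z = steinberg_form d r\<close>, so
  \<open>b z = b\<close>. Multiplying a nonzero element of an ideal of the block by matrix units on both sides
  isolates one of its entries, so the ideal contains all the matrix units that make up \<open>z\<close>.
\<close>

lemma steinberg_block_simple:
  fixes b :: "'k::field form"
  assumes p: "prime CHAR('k)" and d: "CHAR('k) dvd d + 1" and block: "is_block (schur_alg d) b"
    and nl: "n \<le> d" "l < CHAR('k)" "weyl d r b n l \<noteq> 0"
  shows "simple_block (schur_alg d) b"
  unfolding simple_block_def
proof (intro conjI allI impI)
  let ?S = "schur_alg d :: 'k form ring" and ?z = "steinberg_form d r :: 'k form"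
  interpret S: ring ?S by (rule schur_alg_ring[OF p])
  have z: "?z \<in> schur_forms d" by (rule steinberg_form_in_schur_forms)
  note nz = of_nat_choose_nonzero[OF p d]
  have pd: "CHAR('k) \<le> d + 1" using d by (intro dvd_imp_le) auto
  have b: "b \<in> schur_forms d" and bb: "convolution b b = b"
    using block unfolding is_block_def central_idempotent_def schur_alg_simps by blast+
  have bz: "convolution b ?z = b"
  proof -
    let ?I = "std_word r d n" and ?J = "std_word r d l"
    have l: "l \<le> d" using nl pd by simp
    have "convolution b ?z (wmon ?I ?J) \<noteq> 0"
      using nl l nz[OF nl(2)]
      by (simp add: convolution_steinberg_form schur_forms_linear[OF b] std_word_in_words count_list_std_word)
    then have "convolution b ?z \<noteq> (\<lambda>f. 0)" by auto
    then show ?thesis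
      using S.block_absorb[OF block central_idempotent_steinberg_form[OF p d, of r]] by simp
  qed
  fix I assume I: "ideal I ?S" "I \<subseteq> block_ideal ?S b"
  interpret I: ideal I ?S by (rule I(1))
  show "I = {\<zero>\<^bsub>?S\<^esub>} \<or> I = block_ideal ?S b"
  proof (cases "I = {\<zero>\<^bsub>?S\<^esub>}")
    case False
    then obtain w where w: "w \<in> I" "w \<noteq> (\<lambda>f. 0)"
      using I.zero_closed by auto
    obtain y where y: "y \<in> schur_forms d" "w = convolution y b"
      using w(1) I(2) unfolding block_ideal_def schur_alg_simps by blast
    have wS: "w \<in> schur_forms d" unfolding y(2) by (rule convolution_closed[OF p y(1) b])
    have wlin: "linear_form w" by (rule schur_forms_linear[OF wS])
    have "convolution w ?z = w"
      using S.m_assoc[of y b ?z] y b z by (simp add: bz)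
    moreover have "\<exists>K\<in>words d. \<exists>L\<in>words d. w (wmon K L) \<noteq> 0"
    proof (rule ccontr)
      assume "\<not> ?thesis"
      then have "w = (\<lambda>f. 0)" by (intro schur_forms_eqI[OF wS schur_forms_zero]) auto
      with w(2) show False by contradiction
    qed
    then obtain K L where KL: "K \<in> words d" "L \<in> words d" "w (wmon K L) \<noteq> 0" by blast
    moreover note KL(3)
    ultimately have "convolution w ?z (wmon K L) \<noteq> 0" by simp
    then have i: "count_list L r < CHAR('k)" and ni: "weyl d r w (count_list K r) (count_list L r) \<noteq> 0"
      using KL by (auto simp: convolution_steinberg_form[OF wlin] split: if_splits)
    define m i where "m = count_list K r" and "i = count_list L r"
    have m: "m < CHAR('k)"
      using weyl_vanishes[OF p wS i, of m r] ni count_list_le[OF KL(1)] unfolding m_def by force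
    have scale: "(\<lambda>f. c * x f) \<in> I" if "x \<in> I" for x and c :: 'k
    proof -
      have x: "x \<in> schur_forms d" using that I.a_subset by auto
      have "(\<lambda>f. c * torus_form d 1 1 f) \<in> schur_forms d"
        by (intro schur_forms_times torus_form_in_schur_forms[OF p])
      then have "convolution (\<lambda>f. c * torus_form d 1 1 f) x \<in> I"
        using I.I_l_closed[OF that] by simp
      moreover have "convolution (\<lambda>f. c * torus_form d 1 1 f) x = (\<lambda>f. c * convolution (torus_form d 1 1) x f)"
        by (simp add: fun_eq_iff convolution_def sum_distrib_left mult.assoc)
      moreover have "convolution (torus_form d 1 1) x = x" using S.l_one x by simp
      ultimately show ?thesis by simp
    qed
    \<comment> \<open>The entry of \<open>w\<close> at \<open>(m, i)\<close> is moved to the diagonal position \<open>a\<close>.\<close>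
    have unit: "unit_form d r a a \<in> I" if a: "a < CHAR('k)" for a
    proof -
      let ?l = "unit_form d r a m :: 'k form" and ?r = "unit_form d r i a :: 'k form"
      have lr: "?l \<in> schur_forms d" "?r \<in> schur_forms d"
        using a m i by (auto simp: i_def intro!: unit_form_in_schur_forms)
      define c where "c = of_nat (d choose m) * weyl d r w m i"
      have "c \<noteq> 0" using nz[OF m] ni by (simp add: c_def m_def i_def)
      have "convolution ?l (convolution w ?r) \<in> I"
        using I.I_l_closed[OF I.I_r_closed[OF w(1)]] lr by simp
      moreover have "convolution ?l (convolution w ?r) =
          (\<lambda>f. c * unit_form d r a a f)"
      proof (rule schur_forms_eqI)
        fix I J assume IJ: "I \<in> words d" "J \<in> words d"
        have "(\<Sum>L | L \<in> words d \<and> count_list L r = m. convolution w ?r (wmon L J))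
            = (\<Sum>L | L \<in> words d \<and> count_list L r = m. 1 * (if count_list J r = a then weyl d r w m i else 0))"
          using IJ by (intro sum.cong) (auto simp: convolution_unit_form[OF wlin])
        also have "\<dots> = of_nat (d choose m) * (if count_list J r = a then weyl d r w m i else 0)"
          unfolding sum_distrib_right[symmetric] sum_words_one ..
        finally show "convolution ?l (convolution w ?r) (wmon I J) =
            c * unit_form d r a a (wmon I J)"
          using IJ by (simp add: unit_form_convolution unit_form_word c_def)
      qed (intro convolution_closed[OF p] lr wS schur_forms_times unit_form_in_schur_forms a)+
      ultimately have "(\<lambda>f. c * unit_form d r a a f) \<in> I" by simp
      from scale[OF this, of "inverse c"] \<open>c \<noteq> 0\<close> show ?thesis
        by (simp add: mult.assoc[symmetric])
    qed
    have "(\<lambda>f. \<Sum>a<k. inverse (of_nat (d choose a)) * unit_form d r a a f) \<in> I" if "k \<le> CHAR('k)" for k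
      using that
    proof (induction k)
      case 0
      then show ?case using I.zero_closed by simp
    next
      case (Suc k)
      have "(\<lambda>f. inverse (of_nat (d choose k)) * unit_form d r k k f) \<in> I"
        using Suc.prems by (intro scale unit) simp
      from I.a_closed[OF Suc.IH this] Suc.prems show ?case by simp
    qed
    then have "?z \<in> I" unfolding steinberg_form_def by blast
    then have "b \<in> I" using I.I_l_closed[of ?z b] b by (simp add: bz)
    then have "block_ideal ?S b \<subseteq> I" unfolding block_ideal_def using I.I_l_closed by blast
    with I(2) show ?thesis by blast
  qed simp
qed (rule block)

text \<open>
  The basis for the letter 2 is the basis for the letter 1 in reversed order.
\<close>

lemma weyl_letters:
  fixes \<phi> :: "'k::field form"
  assumes "linear_form \<phi>" "n \<le> d" "i \<le> d"
  shows "weyl d 2 \<phi> (d - n) (d - i) = weyl d 1 \<phi> n i"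
proof -
  let ?I = "std_word 1 d n"
  have I: "?I \<in> words d" "count_list ?I 1 = n" using assms by (simp_all add: std_word_in_words count_list_std_word)
  have two: "count_list J 2 = d - count_list J 1" "count_list J 1 \<le> d" if "J \<in> words d" for J
    using count_list_two[of J] that by (auto simp: words_def)
  have "{J. J \<in> words d \<and> count_list J 2 = d - i} = {J. J \<in> words d \<and> count_list J 1 = i}"
    using two assms(3) by force
  then show ?thesis
    using weyl_word[OF assms(1) I(1), of 2 "d - i"] weyl_word[OF assms(1) I(1), of 1 i]
    by (simp add: I two)
qed


section \<open>Descent in the degree\<close>

text \<open>
  Descent: either the kernel of \<open>det_twist\<close> is annihilated by \<open>b\<close>, and the block comes from degree
  \<open>d - 2\<close>, or \<open>b\<close> acts nontrivially near an end of \<open>V(d)\<close>, and \<open>V(d)\<close> belongs to it.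
\<close>

lemma nonsimple_block_image_shift:
  fixes b :: "'k::alg_closed_field form"
  assumes p: "prime CHAR('k)" and "is_block (schur_alg d) b" "\<not> simple_block (schur_alg d) b"
  shows "\<exists>d' b' \<nu>. d' \<le> d \<and> \<not> CHAR('k) dvd d' + 1 \<and> is_block (schur_alg d') b'
     \<and> V_hat d' \<in> block_modules d' b' \<and> shift \<nu> ` block_modules d' b' = block_modules d b"
  using assms(2,3)
proof (induction d arbitrary: b rule: less_induct)
  case (less d b)
  have b: "b \<in> schur_forms d" and bb: "convolution b b = b" and b0: "b \<noteq> (\<lambda>f. 0)"
    and central: "central_idempotent (schur_alg d) b"
    using less.prems(1) unfolding is_block_def central_idempotent_def schur_alg_simps by blast+
  note lin = schur_forms_linear[OF b]
  show ?case
  proof (cases "\<exists>n l. n \<le> d \<and> l \<le> d \<and> (l < CHAR('k) \<or> d - l < CHAR('k)) \<and> weyl d 1 b n l \<noteq> 0")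
    case True
    then obtain n l where nl: "n \<le> d" "l \<le> d" "l < CHAR('k) \<or> d - l < CHAR('k)" "weyl d 1 b n l \<noteq> 0"
      by blast
    have ndvd: "\<not> CHAR('k) dvd d + 1"
    proof
      assume dvd: "CHAR('k) dvd d + 1"
      from nl(3) have "simple_block (schur_alg d) b"
      proof
        assume "l < CHAR('k)"
        then show ?thesis using steinberg_block_simple[OF p dvd less.prems(1) nl(1)] nl(4) by blast
      next
        assume "d - l < CHAR('k)"
        moreover have "weyl d 2 b (d - n) (d - l) \<noteq> 0"
          using nl weyl_letters[OF lin nl(1,2)] by simp
        ultimately show ?thesis
          using steinberg_block_simple[OF p dvd less.prems(1), of "d - n" "d - l" 2] by simp
      qed
      with less.prems(2) show False by contradiction
    qed
    have "V_hat d \<in> block_modules d b"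
      by (rule V_hat_in_block_modules[OF p central ndvd nl(1,2,4)])
    moreover have "shift (0, 0) M = M" for M :: "'k graded_module"
      by (simp add: shift_def)
    then have "shift (0, 0) ` block_modules d b = block_modules d b" by simp
    ultimately show ?thesis using less.prems(1) ndvd by blast
  next
    case False
    have kernel: "convolution b \<kappa> = (\<lambda>f. 0)" if "\<kappa> \<in> schur_forms d" "det_twist \<kappa> = (\<lambda>f. 0)" for \<kappa>
      using False by (intro convolution_det_twist_kernel[OF p b that]) blast
    \<comment> \<open>A form of degree below 2 vanishes on all multiples of the determinant, so \<open>det_twist\<close> kills \<open>b\<close>.\<close>
    have "d \<ge> 2"
    proof (rule ccontr)
      assume "\<not> d \<ge> 2"
      have "det_twist b = (\<lambda>f. 0)"
      proof (rule linear_form_eqI)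
        fix m
        obtain a1 a2 a3 a4 where m: "m = mon4 a1 a2 a3 a4" using mon4_eta by blast
        show "det_twist b (Poly_Mapping.single m 1) = 0"
          using \<open>\<not> d \<ge> 2\<close> by (simp add: m det_twist_mon4[OF lin] schur_forms_mon_deg[OF b] mon_deg_mon4)
      qed (intro det_twist_linear lin linear_form_zero)+
      with kernel[OF b] bb b0 show False by simp
    qed
    then obtain e where e: "d = e + 2" by (metis add.commute le_Suc_ex)
    note S = less.prems[unfolded e] b[unfolded e] kernel[unfolded e]
    interpret tr: block_transfer "schur_alg (e + 2) :: 'k form ring" "schur_alg e :: 'k form ring" det_twist b
      by (rule block_transfer.intro)
         (simp_all only: schur_alg_simps schur_alg_ring[OF p] det_twist_ring_hom[OF p] det_twist_surj S)
    have "is_block (schur_alg e) (det_twist b)" by (rule tr.is_block_image)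
    moreover have "\<not> simple_block (schur_alg e) (det_twist b)"
      using tr.simple_block_reflect S(2) by blast
    moreover have "e < d" by (simp add: e)
    ultimately obtain d' b' \<nu> where IH: "d' \<le> e" "\<not> CHAR('k) dvd d' + 1" "is_block (schur_alg d') b'"
      "V_hat d' \<in> block_modules d' b'" "shift \<nu> ` block_modules d' b' = block_modules e (det_twist b)"
      using less.IH[of e "det_twist b"] by blast
    have "block_modules d b = shift (1, 1) ` shift \<nu> ` block_modules d' b'"
      unfolding IH(5) e by (rule block_modules_det_twist[OF p S(3,4), symmetric])
    then have "shift (1 + fst \<nu>, 1 + snd \<nu>) ` block_modules d' b' = block_modules d b"
      by (simp add: image_image shift_shift)
    moreover have "d' \<le> d" using IH(1) e by simp
    ultimately show ?thesis using IH(2-4) by blast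
  qed
qed

theorem corollary5p10:
  fixes d :: nat and b :: "'k::alg_closed_field form"
  assumes "CHAR('k) \<ge> 3"
    and "is_block (schur_alg d) b"
    and "\<not> simple_block (schur_alg d) b"
  shows "\<exists>d' s a. \<exists>b' :: 'k form.
           d' \<le> d \<and> d' = s * CHAR('k) + a \<and> a \<le> CHAR('k) - 2
           \<and> is_block (schur_alg d') b' \<and> V_hat d' \<in> block_modules d' b'
           \<and> is_shift_of_block d b d' b'"
proof -
  have p: "prime CHAR('k)" using assms(1) by (intro prime_CHAR_semidom) simp
  obtain d' b' \<nu> where *: "d' \<le> d" "\<not> CHAR('k) dvd d' + 1" "is_block (schur_alg d') (b' :: 'k form)"
    "V_hat d' \<in> block_modules d' b'" "shift \<nu> ` block_modules d' b' = block_modules d b"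
    using nonsimple_block_image_shift[OF p assms(2,3)] by blast
  have "d' mod CHAR('k) \<noteq> CHAR('k) - 1"
  proof
    assume "d' mod CHAR('k) = CHAR('k) - 1"
    then have "(d' + 1) mod CHAR('k) = 0" using assms(1) by (simp add: mod_Suc)
    with *(2) show False by (simp add: mod_eq_0_iff_dvd)
  qed
  moreover have "d' mod CHAR('k) < CHAR('k)" using assms(1) by (intro mod_less_divisor) simp
  ultimately have "d' mod CHAR('k) \<le> CHAR('k) - 2" by linarith
  moreover have "d' = d' div CHAR('k) * CHAR('k) + d' mod CHAR('k)" by simp
  moreover have "is_shift_of_block d b d' b'" by (rule is_shift_of_block_if_image[OF p *(5)])
  ultimately show ?thesis using *(1,3,4) by blast
qed

end
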